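(* There is a one-to-one correspondence between third-order Hessian structures $K$ on $M$ and special second-order connections $\widetilde\nabla$ on $T^{(2)}M$, such that if $K$ and $\widetilde\nabla$ correspond to each other, then for every chart $(U,\varphi)$ on $M$, all smooth vector fields $X,Y,Z$ on $M$ and every $f\in\mathcal F(U)$, $$Kf(X,Y,Z)=D^3f_\varphi(X_\varphi,Y_\varphi,Z_\varphi)+D^2f_\varphi\cdot C_\varphi(X_\varphi,Y_\varphi,Z_\varphi)+Df_\varphi\cdot R_\varphi(X_\varphi,Y_\varphi,Z_\varphi)$$ (at each $m\in U$, the right-hand side being evaluated at $\varphi m$), where $R_\varphi$ and $C_\varphi$ are the Christoffel symbols of $\widetilde\nabla$ in the chart $(U,\varphi)$.
   Context: $M$ is a Hausdorff, paracompact, smooth manifold modelled on a finite-dimensional Banach space $\mathbf E$; $\mathcal F(U)$ is the space of smooth real functions on an open set $U\subset M$. For a chart $(U,\varphi)$: $f_\varphi=f\circ\varphi^{-1}$, and $X_\varphi:\varphi U\to\mathbf E$ is the local representative of a vector field $X$. Hessian structures. For $m\in M$, $F_m^3$ is the space of sums of products of three smooth functions defined near $m$ and vanishing at $m$ (equivalently, all partial derivatives of order $0,1,2$ vanish at $m$ in a chart). For $f\in F_m^3$, $D^3f(m)(v_1,v_2,v_3)=(X_1\cdot X_2\cdot X_3\cdot f)(m)$ for any smooth vector fields with $X_i(m)=v_i$ (well-defined, symmetric). A third-order Hessian structure on $M$ (no symmetry is required) is a map $K:f\mapsto Kf$ from $\mathcal F(M)$ to smooth covariant tensor fields of order $3$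 on $M$ such that (i) $K$ is real linear in $f$, and (ii) if $f\in F_m^3$ then $Kf(m)=D^3f(m)$. $K$ is localizable ($Kf(m)$ depends only on the germ of $f$ at $m$), so $Kf$ makes sense for $f\in\mathcal F(U)$. Second-order tangent bundle. $\mathbf E\Delta\mathbf E$ is the symmetric tensor product of $\mathbf E$ with itself, with product $y\Delta z=z\Delta y$; symmetric bilinear maps on $\mathbf E\times\mathbf E$ are identified with linear maps on $\mathbf E\Delta\mathbf E$, so $D^2F(u)\cdot(y\Delta z)=D^2F(u)(y,z)$; for linear $A$, $(A\Delta A)(y\Delta z)=Ay\Delta Az$. $T^{(2)}M$ is the vector bundle over $M$ with fibre $\mathbf E\oplus(\mathbf E\Delta\mathbf E)$ whose local representatives $e\oplus s$ in a chart $\varphi$ and $\bar e\oplus\bar s$ in a chart $\psi$ of the same element over $m$ are related, with $F=\psi\circ\varphi^{-1}$ and $u=\varphi m$, by $\bar e=DF(u)\cdot e+D^2F(u)\cdot s$ and $\bar s=(DF(u)\Delta DF(u))\cdot s$. Connections. A connection $\widetilde\nabla$ on $T^{(2)}M$ is a Koszul connection on this vector bundle. In a chart, $(\widetilde\nabla_X\tau)_\varphi=D\tau_\varphi\cdot X_\varphi-\widetilde\Gamma_\varphi(X_\varphi,\tau_\varphi)$, where $\tau_\varphi:\varphi U\to\mathbf E\oplus(\mathbf E\Delta\mathbf E)$ is the local representative of the section $\tau$ and $\widetilde\Gamma_\varphi$ is a smooth map from $\varphi U$ to bilinear maps $\mathbf E\times(\mathbf E\oplus\mathbf E\Delta\mathbf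 E)\to\mathbf E\oplus\mathbf E\Delta\mathbf E$. $\widetilde\nabla$ is a special second-order connection if in charts $$\widetilde\Gamma_\varphi(X_\varphi,V_\varphi\oplus S_\varphi)=R_\varphi(X_\varphi,S_\varphi)\oplus\big(-X_\varphi\Delta V_\varphi+C_\varphi(X_\varphi,S_\varphi)\big),$$ where $V_\varphi$ has values in $\mathbf E$ and $S_\varphi$ in $\mathbf E\Delta\mathbf E$, $R_\varphi$ has values in $\mathbf E$ and $C_\varphi$ in $\mathbf E\Delta\mathbf E$ (a condition independent of the chart); $R_\varphi,C_\varphi$ are called the Christoffel symbols of $\widetilde\nabla$ in the chart. One writes $R_\varphi(X_\varphi,Y_\varphi,Z_\varphi)=R_\varphi(X_\varphi,Y_\varphi\Delta Z_\varphi)$ and similarly for $C_\varphi$.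
   Formalization: As stated this is false (Kf = D³f + fT or D³f + df⊗ω, ω alternating, are Hessian structures violating the formula); the correspondence is proved for those K with Kc = 0 for constants c and Kf(X,Y,Z) = Kf(X,Z,Y), both of which the formula forces. *)

theory Defs
  imports "HOL-Analysis.Analysis"
begin

section \<open>Finite-dimensional Banach spaces\<close>

class finite_dim_banach = banach +
  assumes finite_dim: "\<exists>B. finite B \<and> (\<forall>x. \<exists>a. x = (\<Sum>b\<in>B. a b *\<^sub>R b))"

instance euclidean_space \<subseteq> finite_dim_banach
proof
  show "\<exists>B::'a set. finite B \<and> (\<forall>x. \<exists>a. x = (\<Sum>b\<in>B. a b *\<^sub>R b))"
  proof (intro exI conjI allI)
    show "finite (Basis :: 'a set)" by (rule finite_Basis)
    show "x = (\<Sum>b\<in>Basis. (x \<bullet> b) *\<^sub>R b)" for x :: 'a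
      by (rule euclidean_representation[symmetric])
  qed
qed

lemma finite_basis_exists:
  "\<exists>B::'a::finite_dim_banach set. finite B \<and> independent B \<and> span B = UNIV"
proof -
  obtain S :: "'a set" where S: "finite S" "\<And>x. \<exists>a. x = (\<Sum>b\<in>S. a b *\<^sub>R b)"
    using finite_dim by blast
  have sS: "x \<in> span S" for x
  proof -
    obtain a where a: "x = (\<Sum>b\<in>S. a b *\<^sub>R b)" using S(2) by blast
    show ?thesis unfolding a by (intro span_sum span_scale span_base)
  qed
  obtain B where B: "B \<subseteq> S" "independent B" "S \<subseteq> span B"
    using maximal_independent_subset[of S] by blast
  have "span S \<subseteq> span B" using B(3) by (simp add: span_minimal)
  then have "span B = UNIV" using sS by blast
  moreover have "finite B" using B(1) S(1) by (rule finite_subset)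
  ultimately show ?thesis using B(2) by (intro exI conjI)
qed

lemma finite_independent_coefficient_bound:
  fixes B :: "'a::real_normed_vector set"
  assumes "finite B" "independent B"
  shows "\<exists>k>0. \<forall>a. k * (\<Sum>b\<in>B. \<bar>a b\<bar>) \<le> norm (\<Sum>b\<in>B. a b *\<^sub>R b)"
  using assms
proof (induction B rule: finite_induct)
  case empty
  show ?case by (rule exI[of _ 1]) simp
next
  case (insert x B)
  have indB: "independent B" and xB: "x \<notin> span B"
    using insert by (auto simp: independent_insert)
  obtain k where k: "k > 0" "\<And>a. k * (\<Sum>b\<in>B. \<bar>a b\<bar>) \<le> norm (\<Sum>b\<in>B. a b *\<^sub>R b)"
    using insert.IH[OF indB] by blast
  have clo: "closed (span B)"
    unfolding closed_sequential_limits
  proof (intro allI impI, elim conjE)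
    fix y l
    assume y: "\<forall>n. y n \<in> span B" and lim: "y \<longlonglongrightarrow> l"
    have "\<forall>n. \<exists>c. y n = (\<Sum>b\<in>B. c b *\<^sub>R b)"
      using y span_finite[OF insert.hyps(1)] by auto
    then obtain c where c: "\<And>n. y n = (\<Sum>b\<in>B. c n b *\<^sub>R b)" by metis
    have est: "k * \<bar>c m b - c n b\<bar> \<le> norm (y m - y n)" if "b \<in> B" for m n b
    proof -
      have "k * \<bar>c m b - c n b\<bar> \<le> k * (\<Sum>b\<in>B. \<bar>c m b - c n b\<bar>)"
        using k(1) that insert.hyps(1)
        by (intro mult_left_mono member_le_sum[of b B "\<lambda>b. \<bar>c m b - c n b\<bar>"]) auto
      also have "\<dots> \<le> norm (\<Sum>b\<in>B. (c m b - c n b) *\<^sub>R b)" using k(2) .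
      also have "(\<Sum>b\<in>B. (c m b - c n b) *\<^sub>R b) = y m - y n"
        by (simp add: c scaleR_diff_left sum_subtractf)
      finally show ?thesis .
    qed
    have cau: "Cauchy y" using lim by (rule LIMSEQ_imp_Cauchy)
    have "convergent (\<lambda>n. c n b)" if b: "b \<in> B" for b
    proof -
      have "Cauchy (\<lambda>n. c n b)"
      proof (rule metric_CauchyI)
        fix e :: real assume "e > 0"
        then obtain M where M: "\<And>m n. m \<ge> M \<Longrightarrow> n \<ge> M \<Longrightarrow> dist (y m) (y n) < k * e"
          using metric_CauchyD[OF cau, of "k * e"] k(1) by auto
        have "dist (c m b) (c n b) < e" if "m \<ge> M" "n \<ge> M" for m n
        proof -
          have "k * \<bar>c m b - c n b\<bar> < k * e"
            using est[OF b, of m n] M[OF that] by (simp add: dist_norm)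
          then show ?thesis using k(1) by (simp add: dist_real_def)
        qed
        then show "\<exists>M. \<forall>m\<ge>M. \<forall>n\<ge>M. dist (c m b) (c n b) < e" by blast
      qed
      then show ?thesis by (simp add: Cauchy_convergent_iff)
    qed
    then obtain d where d: "\<And>b. b \<in> B \<Longrightarrow> (\<lambda>n. c n b) \<longlonglongrightarrow> d b"
      unfolding convergent_def by metis
    have "(\<lambda>n. \<Sum>b\<in>B. c n b *\<^sub>R b) \<longlonglongrightarrow> (\<Sum>b\<in>B. d b *\<^sub>R b)"
      by (intro tendsto_sum tendsto_scaleR d tendsto_const)
    then have "l = (\<Sum>b\<in>B. d b *\<^sub>R b)"
      using lim c LIMSEQ_unique by (metis (no_types, lifting) ext)
    then show "l \<in> span B"
      by (simp add: span_sum span_scale span_base)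
  qed
  obtain d where d: "d > 0" "\<And>y. y \<in> span B \<Longrightarrow> d \<le> dist x y"
  proof -
    obtain e where "e > 0" "ball x e \<subseteq> - span B"
      using clo xB by (metis ComplI openE open_Compl)
    then show ?thesis using that[of e] by (force simp: subset_iff)
  qed
  define q where "q = 1 / d + (1 + norm x / d) / k"
  have q: "q > 0" unfolding q_def using d(1) k(1)
    by (intro add_pos_nonneg divide_nonneg_pos) auto
  have "(1 / q) * (\<Sum>b\<in>insert x B. \<bar>a b\<bar>) \<le> norm (\<Sum>b\<in>insert x B. a b *\<^sub>R b)" for a
  proof -
    define s where "s = (\<Sum>b\<in>B. a b *\<^sub>R b)"
    define N where "N = norm (a x *\<^sub>R x + s)"
    have s: "s \<in> span B" unfolding s_def by (intro span_sum span_scale span_base)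
    have ax: "\<bar>a x\<bar> \<le> N / d"
    proof (cases "a x = 0")
      case True then show ?thesis using d(1) by (simp add: N_def)
    next
      case False
      have "d \<le> dist x ((- (1 / a x)) *\<^sub>R s)" using s by (intro d(2) span_scale)
      also have "dist x ((- (1 / a x)) *\<^sub>R s) = norm ((1 / a x) *\<^sub>R (a x *\<^sub>R x + s))"
        using False by (simp add: dist_norm scaleR_add_right)
      also have "\<dots> = N / \<bar>a x\<bar>" by (simp add: N_def)
      finally show ?thesis using False d(1) by (simp add: field_simps)
    qed
    have "norm s \<le> N + \<bar>a x\<bar> * norm x"
      using norm_triangle_ineq4[of "a x *\<^sub>R x + s" "a x *\<^sub>R x"] by (simp add: N_def)
    also have "\<dots> \<le> N + N / d * norm x"
      by (rule add_left_mono[OF mult_right_mono[OF ax norm_ge_zero]])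
    finally have "norm s \<le> N * (1 + norm x / d)" by (simp add: algebra_simps)
    then have "k * (\<Sum>b\<in>B. \<bar>a b\<bar>) \<le> N * (1 + norm x / d)"
      using k(2)[of a] by (simp add: s_def)
    then have "(\<Sum>b\<in>B. \<bar>a b\<bar>) \<le> N * ((1 + norm x / d) / k)"
      using k(1) by (simp add: field_simps)
    then have "(\<Sum>b\<in>insert x B. \<bar>a b\<bar>) \<le> N * q"
      using ax insert.hyps by (simp add: q_def algebra_simps)
    then have "(\<Sum>b\<in>insert x B. \<bar>a b\<bar>) / q \<le> N" using q by (simp add: field_simps)
    then show ?thesis using insert.hyps by (simp add: N_def s_def)
  qed
  then show ?case using q by (intro exI[of _ "1 / q"]) auto
qed

lemma bounded_linear_finite_dim:
  fixes f :: "'a::finite_dim_banach \<Rightarrow> 'b::real_normed_vector"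
  assumes "linear f"
  shows "bounded_linear f"
proof -
  obtain B :: "'a set" where fB: "finite B" and iB: "independent B" and sB: "span B = UNIV"
    using finite_basis_exists by blast
  obtain k where k: "k > 0" "\<And>a. k * (\<Sum>b\<in>B. \<bar>a b\<bar>) \<le> norm (\<Sum>b\<in>B. a b *\<^sub>R b)"
    using finite_independent_coefficient_bound[OF fB iB] by blast
  define L where "L = (\<Sum>b\<in>B. norm (f b))"
  show ?thesis
  proof (intro bounded_linear_intro)
    fix x
    have "x \<in> span B" using sB by simp
    then obtain a where a: "x = (\<Sum>b\<in>B. a b *\<^sub>R b)"
      using span_finite[OF fB] by auto
    have "norm (f x) = norm (\<Sum>b\<in>B. a b *\<^sub>R f b)"
      by (simp add: a linear_sum[OF assms] linear_cmul[OF assms])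
    also have "\<dots> \<le> (\<Sum>b\<in>B. \<bar>a b\<bar> * norm (f b))" by (rule order_trans[OF norm_sum]) simp
    also have "\<dots> \<le> (\<Sum>b\<in>B. \<bar>a b\<bar> * L)"
      using fB by (intro sum_mono mult_left_mono) (auto simp: L_def intro: member_le_sum)
    also have "\<dots> = (\<Sum>b\<in>B. \<bar>a b\<bar>) * L" by (simp add: sum_distrib_right)
    also have "\<dots> \<le> (norm x / k) * L"
      using k by (intro mult_right_mono) (auto simp: a field_simps L_def intro: sum_nonneg)
    finally show "norm (f x) \<le> norm x * (L / k)" by simp
  qed (use assms in \<open>auto simp: linear_add linear_cmul\<close>)
qed


section \<open>The symmetric tensor square\<close>

text \<open>A pair \<^term>\<open>(y, z)\<close> acts on bilinear forms by symmetrised evaluation; the symmetric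
  tensor square is the span of these functionals in the dual of the space of bilinear forms.
  The lemma \<open>sym_ext_unique_existence\<close> below is its universal property.\<close>

definition sym_dyad :: "'e::real_normed_vector \<Rightarrow> 'e \<Rightarrow> ('e \<Rightarrow>\<^sub>L 'e \<Rightarrow>\<^sub>L real) \<Rightarrow>\<^sub>L real"
  where "sym_dyad y z = Blinfun (\<lambda>B :: 'e \<Rightarrow>\<^sub>L 'e \<Rightarrow>\<^sub>L real. (B y z + B z y) / 2)"

lemma sym_dyad_apply: "blinfun_apply (sym_dyad y z) B = (B y z + B z y) / 2"
proof -
  have "bounded_linear (\<lambda>B::'a \<Rightarrow>\<^sub>L 'a \<Rightarrow>\<^sub>L real. (B y z + B z y) / 2)"
    by (intro bounded_linear_compose[OF bounded_linear_divide] bounded_linear_add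
        bounded_linear_compose[OF blinfun.bounded_linear_left blinfun.bounded_linear_left])
  then show ?thesis unfolding sym_dyad_def by (simp add: bounded_linear_Blinfun_apply)
qed

typedef (overloaded) 'e sym_square =
  "span {sym_dyad y z | y z :: 'e::real_normed_vector. True}"
  by (rule exI[of _ 0]) (rule span_zero)

setup_lifting type_definition_sym_square

instantiation sym_square :: (real_normed_vector) real_normed_vector
begin

lift_definition zero_sym_square :: "'a sym_square" is 0 by (rule span_zero)
lift_definition plus_sym_square :: "'a sym_square \<Rightarrow> 'a sym_square \<Rightarrow> 'a sym_square" is "(+)"
  by (rule span_add)
lift_definition minus_sym_square :: "'a sym_square \<Rightarrow> 'a sym_square \<Rightarrow> 'a sym_square" is "(-)"
  by (rule span_diff)
lift_definition uminus_sym_square :: "'a sym_square \<Rightarrow> 'a sym_square" is uminus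
  by (rule span_neg)
lift_definition scaleR_sym_square :: "real \<Rightarrow> 'a sym_square \<Rightarrow> 'a sym_square" is "(*\<^sub>R)"
  by (rule span_scale)
lift_definition norm_sym_square :: "'a sym_square \<Rightarrow> real" is norm .
definition "dist (s::'a sym_square) t = norm (s - t)"
definition "sgn (s::'a sym_square) = inverse (norm s) *\<^sub>R s"
definition "(uniformity :: ('a sym_square \<times> 'a sym_square) filter) =
  (INF e\<in>{0<..}. principal {(s, t). dist s t < e})"
definition "open (U :: 'a sym_square set) \<longleftrightarrow>
  (\<forall>s\<in>U. eventually (\<lambda>(s', t). s' = s \<longrightarrow> t \<in> U) uniformity)"

instance
proof
  fix a b :: real and s t u :: "'a sym_square" and U :: "'a sym_square set"
  show "s + t + u = s + (t + u)" "s + t = t + s" "0 + s = s" "- s + s = 0" "s - t = s + - t"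
    by (transfer; simp)+
  show "a *\<^sub>R (s + t) = a *\<^sub>R s + a *\<^sub>R t" "(a + b) *\<^sub>R s = a *\<^sub>R s + b *\<^sub>R s"
    "a *\<^sub>R b *\<^sub>R s = (a * b) *\<^sub>R s" "1 *\<^sub>R s = s"
    by (transfer; simp add: algebra_simps)+
  show "(norm s = 0) = (s = 0)" "norm (s + t) \<le> norm s + norm t" "norm (a *\<^sub>R s) = \<bar>a\<bar> * norm s"
    by (transfer; simp add: norm_triangle_ineq)+
qed (rule dist_sym_square_def sgn_sym_square_def uniformity_sym_square_def open_sym_square_def)+

end

lift_definition sym_prod :: "'e::real_normed_vector \<Rightarrow> 'e \<Rightarrow> 'e sym_square" (infixl "\<triangle>" 75)
  is sym_dyad
  by (intro span_base) auto

definition sym_ext ::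
    "('e::real_normed_vector \<Rightarrow> 'e \<Rightarrow> 'b::real_vector) \<Rightarrow> 'e sym_square \<Rightarrow> 'b"
  where "sym_ext \<beta> = (THE L. linear L \<and> (\<forall>y z. L (y \<triangle> z) = \<beta> y z))"

lemma sym_prod_commute: "y \<triangle> z = z \<triangle> y"
  by transfer (auto intro!: blinfun_eqI simp: sym_dyad_apply)

lemma linear_sym_prod: "linear (\<lambda>y. y \<triangle> z)"
proof
  show "(a + b) \<triangle> z = a \<triangle> z + b \<triangle> z" for a b
    by transfer (rule blinfun_eqI, simp add: sym_dyad_apply blinfun.bilinear_simps field_simps)
  show "(r *\<^sub>R a) \<triangle> z = r *\<^sub>R (a \<triangle> z)" for r a
    by transfer (rule blinfun_eqI, simp add: sym_dyad_apply blinfun.bilinear_simps field_simps)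
qed

lemma span_sym_prod: "span {y \<triangle> z | y z. True} = (UNIV :: 'e::real_normed_vector sym_square set)"
proof -
  have "s \<in> span {y \<triangle> z | y z. True}" for s :: "'e sym_square"
  proof -
    have lin: "linear (Rep_sym_square :: 'e sym_square \<Rightarrow> _)"
      by standard (simp_all add: plus_sym_square.rep_eq scaleR_sym_square.rep_eq)
    have "Rep_sym_square ` {y \<triangle> z | y z :: 'e. True} = {sym_dyad y z | y z. True}"
      unfolding sym_prod.rep_eq[symmetric] by blast
    then have "Rep_sym_square ` span {y \<triangle> z | y z :: 'e. True} = span {sym_dyad y z | y z. True}"
      by (simp add: linear_span_image[OF lin, symmetric])
    then have "Rep_sym_square s \<in> Rep_sym_square ` span {y \<triangle> z | y z :: 'e. True}"
      using Rep_sym_square[of s] by simp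
    then show ?thesis by (auto simp: Rep_sym_square_inject)
  qed
  then show ?thesis by auto
qed

lemma sym_ext_unique_existence:
  fixes \<beta> :: "'e::finite_dim_banach \<Rightarrow> 'e \<Rightarrow> 'b::real_vector"
  assumes lin: "\<And>z. linear (\<lambda>y. \<beta> y z)" and sym: "\<And>y z. \<beta> y z = \<beta> z y"
  shows "\<exists>!L. linear L \<and> (\<forall>y z. L (y \<triangle> z) = \<beta> y z)"
proof (rule ex_ex1I)
  obtain B :: "'e set" where fB: "finite B" and iB: "independent B" and sB: "span B = UNIV"
    using finite_basis_exists by blast
  define r where "r b = (\<lambda>y. representation B y b)" for b
  have linr: "linear (r b)" for b
    unfolding r_def
    by (rule linearI) (simp_all add: representation_add[OF iB] representation_scale[OF iB] sB)
  have blr: "bounded_linear (r b)" for b using linr by (rule bounded_linear_finite_dim)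
  have exp: "(\<Sum>b\<in>B. r b y *\<^sub>R b) = y" for y
    unfolding r_def using sum_representation_eq[OF iB _ fB subset_refl] sB by simp
  define \<rho> where "\<rho> b = Blinfun (r b)" for b
  have \<rho>: "blinfun_apply (\<rho> b) y = r b y" for b y
    unfolding \<rho>_def by (simp add: bounded_linear_Blinfun_apply[OF blr])
  define \<Phi> :: "'e \<Rightarrow> 'e \<Rightarrow> 'e \<Rightarrow>\<^sub>L 'e \<Rightarrow>\<^sub>L real" where
    "\<Phi> i j = Blinfun (\<lambda>y. \<rho> i y *\<^sub>R \<rho> j)" for i j
  have \<Phi>: "blinfun_apply (blinfun_apply (\<Phi> i j) y) z = r i y * r j z" for i j y z
  proof -
    have "bounded_linear (\<lambda>y. \<rho> i y *\<^sub>R \<rho> j)" by (intro bounded_linear_intros)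
    then show ?thesis
      unfolding \<Phi>_def by (simp add: bounded_linear_Blinfun_apply scaleR_blinfun.rep_eq \<rho>)
  qed
  have lin': "linear (\<lambda>z. \<beta> y z)" for y using lin[of y] sym by simp
  have \<beta>_exp: "(\<Sum>i\<in>B. \<Sum>j\<in>B. (r i y * r j z) *\<^sub>R \<beta> i j) = \<beta> y z" for y z
  proof -
    have "\<beta> y z = \<beta> (\<Sum>i\<in>B. r i y *\<^sub>R i) (\<Sum>j\<in>B. r j z *\<^sub>R j)" by (simp only: exp)
    also have "\<dots> = (\<Sum>i\<in>B. r i y *\<^sub>R \<beta> i (\<Sum>j\<in>B. r j z *\<^sub>R j))"
      by (simp add: linear_sum[OF lin] linear_cmul[OF lin])
    also have "\<dots> = (\<Sum>i\<in>B. r i y *\<^sub>R (\<Sum>j\<in>B. r j z *\<^sub>R \<beta> i j))"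
      by (simp add: linear_sum[OF lin'] linear_cmul[OF lin'])
    finally show ?thesis by (simp add: scaleR_sum_right)
  qed
  define L where "L s = (\<Sum>i\<in>B. \<Sum>j\<in>B. blinfun_apply (Rep_sym_square s) (\<Phi> i j) *\<^sub>R \<beta> i j)"
    for s :: "'e sym_square"
  have "linear L"
  proof
    show "L (s + t) = L s + L t" for s t
      by (simp add: L_def plus_sym_square.rep_eq blinfun.add_left scaleR_add_left sum.distrib)
    show "L (c *\<^sub>R s) = c *\<^sub>R L s" for c s
      by (simp add: L_def scaleR_sym_square.rep_eq blinfun.scaleR_left scaleR_sum_right)
  qed
  moreover have "L (y \<triangle> z) = \<beta> y z" for y z
  proof -
    have "L (y \<triangle> z) = (\<Sum>i\<in>B. \<Sum>j\<in>B. ((r i y * r j z + r i z * r j y) / 2) *\<^sub>R \<beta> i j)"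
      by (simp add: L_def sym_prod.rep_eq sym_dyad_apply \<Phi>)
    also have "\<dots> = (1/2) *\<^sub>R ((\<Sum>i\<in>B. \<Sum>j\<in>B. (r i y * r j z) *\<^sub>R \<beta> i j)
        + (\<Sum>i\<in>B. \<Sum>j\<in>B. (r i z * r j y) *\<^sub>R \<beta> i j))"
      by (simp add: add_divide_distrib scaleR_add_left sum.distrib scaleR_add_right scaleR_sum_right)
    also have "\<dots> = \<beta> y z"
      unfolding \<beta>_exp using sym[of z y] by (simp flip: scaleR_2)
    finally show ?thesis .
  qed
  ultimately show "\<exists>L. linear L \<and> (\<forall>y z. L (y \<triangle> z) = \<beta> y z)" by blast
next
  fix L L' :: "'e sym_square \<Rightarrow> 'b"
  assume L: "linear L \<and> (\<forall>y z. L (y \<triangle> z) = \<beta> y z)" and L': "linear L' \<and> (\<forall>y z. L' (y \<triangle> z) = \<beta> y z)"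
  show "L = L'"
  proof
    fix s :: "'e sym_square"
    have "s \<in> span {y \<triangle> z | y z. True}" using span_sym_prod by blast
    moreover have "L x = L' x" if "x \<in> {y \<triangle> z | y z. True}" for x using that L L' by auto
    ultimately show "L s = L' s" using L L' linear_eq_on_span by blast
  qed
qed


section \<open>Smooth maps between normed spaces\<close>

abbreviation D1 :: "('a::real_normed_vector \<Rightarrow> 'b::real_normed_vector) \<Rightarrow> 'a \<Rightarrow> 'a \<Rightarrow> 'b"
  where "D1 f u \<equiv> frechet_derivative f (at u)"

definition D2 :: "('a::real_normed_vector \<Rightarrow> 'b::real_normed_vector) \<Rightarrow> 'a \<Rightarrow> 'a \<Rightarrow> 'a \<Rightarrow> 'b"
  where "D2 f u x y = D1 (\<lambda>w. D1 f w y) u x"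

definition D3 ::
    "('a::real_normed_vector \<Rightarrow> 'b::real_normed_vector) \<Rightarrow> 'a \<Rightarrow> 'a \<Rightarrow> 'a \<Rightarrow> 'a \<Rightarrow> 'b"
  where "D3 f u x y z = D1 (\<lambda>w. D2 f w y z) u x"

text \<open>Both notions are meant for open \<open>S\<close> in a finite-dimensional space, where they are the usual
  \<open>C\<^sup>k\<close> and \<open>C\<^sup>\<infinity>\<close> conditions; the values of \<open>f\<close> off \<open>S\<close> are irrelevant.\<close>

primrec Ck_on ::
    "nat \<Rightarrow> ('a::real_normed_vector \<Rightarrow> 'b::real_normed_vector) \<Rightarrow> 'a set \<Rightarrow> bool"
  where
    "Ck_on 0 f S \<longleftrightarrow> continuous_on S f"
  | "Ck_on (Suc k) f S \<longleftrightarrow>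
      (\<forall>u\<in>S. f differentiable (at u)) \<and> (\<forall>v. Ck_on k (\<lambda>u. D1 f u v) S)"

definition smooth_on :: "'a set \<Rightarrow> ('a::real_normed_vector \<Rightarrow> 'b::real_normed_vector) \<Rightarrow> bool"
  where "smooth_on S f \<longleftrightarrow> (\<forall>k. Ck_on k f S)"


section \<open>Smooth manifolds\<close>

definition paracompact_space :: "'m topology \<Rightarrow> bool"
  where "paracompact_space X \<longleftrightarrow>
    (\<forall>\<U>. (\<forall>U\<in>\<U>. openin X U) \<and> \<Union>\<U> = topspace X \<longrightarrow>
      (\<exists>\<V>. (\<forall>V\<in>\<V>. openin X V) \<and> \<Union>\<V> = topspace X \<and>
        (\<forall>V\<in>\<V>. \<exists>U\<in>\<U>. V \<subseteq> U) \<and> locally_finite_in X \<V>))"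

text \<open>A chart is a pair \<open>(U, \<phi>)\<close>; the values of \<open>\<phi>\<close> off \<open>U\<close> play no role.\<close>

type_synonym ('m, 'e) chart = "'m set \<times> ('m \<Rightarrow> 'e)"

definition cdom :: "('m, 'e) chart \<Rightarrow> 'm set"
  where "cdom c = fst c"

definition cmap :: "('m, 'e) chart \<Rightarrow> 'm \<Rightarrow> 'e"
  where "cmap c = snd c"

definition cinv :: "('m, 'e) chart \<Rightarrow> 'e \<Rightarrow> 'm"
  where "cinv c = inv_into (cdom c) (cmap c)"

definition topological_chart :: "('m::topological_space, 'e::topological_space) chart \<Rightarrow> bool"
  where "topological_chart c \<longleftrightarrow> open (cdom c) \<and> open (cmap c ` cdom c) \<and>
    homeomorphism (cdom c) (cmap c ` cdom c) (cmap c) (cinv c)"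

definition transition :: "('m, 'e) chart \<Rightarrow> ('m, 'e) chart \<Rightarrow> 'e \<Rightarrow> 'e"
  where "transition c d = cmap d \<circ> cinv c"

definition compatible :: "('m, 'e::real_normed_vector) chart \<Rightarrow> ('m, 'e) chart \<Rightarrow> bool"
  where "compatible c d \<longleftrightarrow>
    smooth_on (cmap c ` (cdom c \<inter> cdom d)) (transition c d) \<and>
    smooth_on (cmap d ` (cdom c \<inter> cdom d)) (transition d c)"

text \<open>\<open>A\<close> is a maximal smooth atlas, i.e. the set of all charts of the manifold; the underlying
  manifold is the whole type \<open>'m\<close>.\<close>

definition smooth_structure :: "('m::topological_space, 'e::real_normed_vector) chart set \<Rightarrow> bool"
  where "smooth_structure A \<longleftrightarrow>
    (\<forall>c\<in>A. topological_chart c) \<and> (\<Union>c\<in>A. cdom c) = UNIV \<and>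
    (\<forall>c\<in>A. \<forall>d\<in>A. compatible c d) \<and>
    (\<forall>c. topological_chart c \<and> (\<forall>d\<in>A. compatible c d) \<longrightarrow> c \<in> A)"

definition charts_at :: "('m, 'e) chart set \<Rightarrow> 'm \<Rightarrow> ('m, 'e) chart set"
  where "charts_at A m = {c \<in> A. m \<in> cdom c}"

definition smooth_funs ::
    "('m, 'e::real_normed_vector) chart set \<Rightarrow> 'm set \<Rightarrow> ('m \<Rightarrow> real) set"
  where "smooth_funs A W = {f. \<forall>c\<in>A. smooth_on (cmap c ` (cdom c \<inter> W)) (f \<circ> cinv c)}"


section \<open>Vector bundles through local representatives\<close>

text \<open>An element of the fibre over \<open>m\<close> of a bundle with typical fibre \<open>'f\<close> is the family of its local
  representatives in the charts at \<open>m\<close>, subject to the bundle's transformation law; \<open>law c d m a b\<close>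
  says that \<open>a\<close> and \<open>b\<close> represent the same element over \<open>m\<close> in the charts \<open>c\<close> and \<open>d\<close>. Families are
  set to \<open>0\<close> at charts not containing \<open>m\<close>, so equality of families is equality of elements, and the
  vector space operations of the fibres are pointwise.\<close>

type_synonym ('m, 'e, 'f) family = "'m \<Rightarrow> ('m, 'e) chart \<Rightarrow> 'f"

type_synonym ('m, 'e, 'f) law = "('m, 'e) chart \<Rightarrow> ('m, 'e) chart \<Rightarrow> 'm \<Rightarrow> 'f \<Rightarrow> 'f \<Rightarrow> bool"

definition rep :: "('m, 'e, 'f) family \<Rightarrow> ('m, 'e) chart \<Rightarrow> 'e \<Rightarrow> 'f"
  where "rep \<sigma> c u = \<sigma> (cinv c u) c"

definition smooth_sections ::
    "('m, 'e::real_normed_vector) chart set \<Rightarrow> ('m, 'e, 'f::real_normed_vector) law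
      \<Rightarrow> ('m, 'e, 'f) family set"
  where "smooth_sections A law = {\<sigma>.
    (\<forall>m. \<forall>c\<in>charts_at A m. \<forall>d\<in>charts_at A m. law c d m (\<sigma> m c) (\<sigma> m d)) \<and>
    (\<forall>m. \<forall>c. c \<notin> charts_at A m \<longrightarrow> \<sigma> m c = 0) \<and>
    (\<forall>c\<in>A. smooth_on (cmap c ` cdom c) (rep \<sigma> c))}"

definition zero_field :: "('m, 'e, 'f::real_vector) family"
  where "zero_field = (\<lambda>m c. 0)"

definition add_field ::
    "('m, 'e, 'f::real_vector) family \<Rightarrow> ('m, 'e, 'f) family \<Rightarrow> ('m, 'e, 'f) family"
  where "add_field \<sigma> \<tau> = (\<lambda>m c. \<sigma> m c + \<tau> m c)"

definition scale_field ::
    "('m \<Rightarrow> real) \<Rightarrow> ('m, 'e, 'f::real_vector) family \<Rightarrow> ('m, 'e, 'f) family"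
  where "scale_field f \<sigma> = (\<lambda>m c. f m *\<^sub>R \<sigma> m c)"


subsection \<open>The tangent bundle\<close>

definition tangent_law :: "('m, 'e::real_normed_vector, 'e) law"
  where "tangent_law c d m v w \<longleftrightarrow> w = D1 (transition c d) (cmap c m) v"

definition vector_fields ::
    "('m, 'e::real_normed_vector) chart set \<Rightarrow> ('m, 'e, 'e) family set"
  where "vector_fields A = smooth_sections A tangent_law"

text \<open>The derivative \<open>X \<cdot> f\<close> may be computed in any chart at \<open>m\<close>.\<close>

definition vf_apply ::
    "('m, 'e::real_normed_vector) chart set \<Rightarrow> ('m, 'e, 'e) family \<Rightarrow> ('m \<Rightarrow> real) \<Rightarrow> 'm \<Rightarrow> real"
  where "vf_apply A X f m =
    (let c = (SOME c. c \<in> charts_at A m) in D1 (f \<circ> cinv c) (cmap c m) (X m c))"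


subsection \<open>Covariant tensor fields of order three\<close>

definition cov3_law ::
    "('m, 'e::real_normed_vector, 'e \<Rightarrow>\<^sub>L 'e \<Rightarrow>\<^sub>L 'e \<Rightarrow>\<^sub>L real) law"
  where "cov3_law c d m T T' \<longleftrightarrow>
    (let A = D1 (transition c d) (cmap c m) in \<forall>x y z. T x y z = T' (A x) (A y) (A z))"

definition cov3_fields ::
    "('m, 'e::real_normed_vector) chart set \<Rightarrow> ('m, 'e, 'e \<Rightarrow>\<^sub>L 'e \<Rightarrow>\<^sub>L 'e \<Rightarrow>\<^sub>L real) family set"
  where "cov3_fields A = smooth_sections A cov3_law"


subsection \<open>The second-order tangent bundle\<close>

definition t2_law :: "('m, 'e::real_normed_vector, 'e \<times> 'e sym_square) law"
  where "t2_law c d m a b \<longleftrightarrow>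
    (let F = transition c d; u = cmap c m in
      fst b = D1 F u (fst a) + sym_ext (D2 F u) (snd a) \<and>
      snd b = sym_ext (\<lambda>y z. D1 F u y \<triangle> D1 F u z) (snd a))"

definition t2_sections ::
    "('m, 'e::real_normed_vector) chart set \<Rightarrow> ('m, 'e, 'e \<times> 'e sym_square) family set"
  where "t2_sections A = smooth_sections A t2_law"


section \<open>Third-order Hessian structures\<close>

text \<open>The functions in \<open>F\<^sub>m\<^sup>3\<close>, as a condition on the germ of \<open>f\<close> at \<open>m\<close>.\<close>

definition F3 ::
    "('m::topological_space, 'e::real_normed_vector) chart set \<Rightarrow> 'm \<Rightarrow> ('m \<Rightarrow> real) set"
  where "F3 A m = {f. \<exists>W (n::nat) p q r. open W \<and> m \<in> W \<and>
    (\<forall>i<n. p i \<in> smooth_funs A W \<and> q i \<in> smooth_funs A W \<and> r i \<in> smooth_funs A W \<and>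
      p i m = 0 \<and> q i m = 0 \<and> r i m = 0) \<and>
    (\<forall>x\<in>W. f x = (\<Sum>i<n. p i x * q i x * r i x))}"

text \<open>Maps on smooth functions (and, below, on smooth sections) are made extensional, so that
  equality of such maps is equality on the arguments that matter.\<close>

definition third_order_hessian ::
    "('m::topological_space, 'e::real_normed_vector) chart set
      \<Rightarrow> (('m \<Rightarrow> real) \<Rightarrow> ('m, 'e, 'e \<Rightarrow>\<^sub>L 'e \<Rightarrow>\<^sub>L 'e \<Rightarrow>\<^sub>L real) family) \<Rightarrow> bool"
  where "third_order_hessian A K \<longleftrightarrow>
    K \<in> smooth_funs A UNIV \<rightarrow>\<^sub>E cov3_fields A \<and>
    (\<forall>f\<in>smooth_funs A UNIV. \<forall>g\<in>smooth_funs A UNIV. \<forall>a b.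
      K (\<lambda>x. a * f x + b * g x) =
        add_field (scale_field (\<lambda>_. a) (K f)) (scale_field (\<lambda>_. b) (K g))) \<and>
    (\<forall>m. \<forall>f \<in> smooth_funs A UNIV \<inter> F3 A m.
      \<forall>X\<in>vector_fields A. \<forall>Y\<in>vector_fields A. \<forall>Z\<in>vector_fields A. \<forall>c\<in>charts_at A m.
        K f m c (X m c) (Y m c) (Z m c) = vf_apply A X (vf_apply A Y (vf_apply A Z f)) m)"

text \<open>The next two conditions do not follow from \<^const>\<open>third_order_hessian\<close>: if \<open>K\<close> is a Hessian
  structure, \<open>T\<close> a smooth covariant tensor field of order three and \<open>\<omega>\<close> one of order two, then
  \<open>f \<mapsto> K f + f T\<close> and \<open>f \<mapsto> K f + df \<otimes> \<omega>\<close> are Hessian structures as well. Both conditions are forced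
  by a representation of \<open>K f\<close> through Christoffel symbols, because only derivatives of \<open>f\<close> enter and
  because \<open>R(X, Y, Z) = R(X, Y \<triangle> Z)\<close> and \<open>C(X, Y, Z) = C(X, Y \<triangle> Z)\<close> are symmetric in \<open>Y\<close> and
  \<open>Z\<close>.\<close>

definition kills_constants :: "(('m \<Rightarrow> real) \<Rightarrow> ('m, 'e, 'f::real_vector) family) \<Rightarrow> bool"
  where "kills_constants K \<longleftrightarrow> (\<forall>a. K (\<lambda>_. a) = zero_field)"

definition symmetric_in_last_two ::
    "('m, 'e::real_normed_vector) chart set
      \<Rightarrow> (('m \<Rightarrow> real) \<Rightarrow> ('m, 'e, 'e \<Rightarrow>\<^sub>L 'e \<Rightarrow>\<^sub>L 'e \<Rightarrow>\<^sub>L real) family) \<Rightarrow> bool"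
  where "symmetric_in_last_two A K \<longleftrightarrow>
    (\<forall>f\<in>smooth_funs A UNIV. \<forall>m. \<forall>c\<in>charts_at A m. \<forall>x y z. K f m c x y z = K f m c x z y)"

text \<open>\<open>K f\<close> for a function \<open>f\<close> that is smooth only near \<open>m\<close>: the value at \<open>m\<close> of \<open>K g\<close> for any global
  smooth \<open>g\<close> with the same germ at \<open>m\<close>.\<close>

definition local_hessian ::
    "('m::topological_space, 'e::real_normed_vector) chart set
      \<Rightarrow> (('m \<Rightarrow> real) \<Rightarrow> ('m, 'e, 'f) family) \<Rightarrow> ('m \<Rightarrow> real) \<Rightarrow> ('m, 'e, 'f) family"
  where "local_hessian A K f m =
    K (SOME g. g \<in> smooth_funs A UNIV \<and> eventually (\<lambda>x. g x = f x) (nhds m)) m"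


section \<open>Connections on the second-order tangent bundle\<close>

type_synonym ('m, 'e) t2_connection =
  "('m, 'e, 'e) family \<Rightarrow> ('m, 'e, 'e \<times> 'e sym_square) family \<Rightarrow> ('m, 'e, 'e \<times> 'e sym_square) family"

definition koszul_connection ::
    "('m, 'e::real_normed_vector) chart set \<Rightarrow> ('m, 'e) t2_connection \<Rightarrow> bool"
  where "koszul_connection A nabla \<longleftrightarrow>
    nabla \<in> vector_fields A \<rightarrow>\<^sub>E (t2_sections A \<rightarrow>\<^sub>E t2_sections A) \<and>
    (\<forall>X\<in>vector_fields A. \<forall>Y\<in>vector_fields A. \<forall>\<tau>\<in>t2_sections A.
      nabla (add_field X Y) \<tau> = add_field (nabla X \<tau>) (nabla Y \<tau>)) \<and>
    (\<forall>f\<in>smooth_funs A UNIV. \<forall>X\<in>vector_fields A. \<forall>\<tau>\<in>t2_sections A.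
      nabla (scale_field f X) \<tau> = scale_field f (nabla X \<tau>)) \<and>
    (\<forall>X\<in>vector_fields A. \<forall>\<sigma>\<in>t2_sections A. \<forall>\<tau>\<in>t2_sections A.
      nabla X (add_field \<sigma> \<tau>) = add_field (nabla X \<sigma>) (nabla X \<tau>)) \<and>
    (\<forall>f\<in>smooth_funs A UNIV. \<forall>X\<in>vector_fields A. \<forall>\<tau>\<in>t2_sections A.
      nabla X (scale_field f \<tau>) =
        add_field (scale_field (vf_apply A X f) \<tau>) (scale_field f (nabla X \<tau>)))"

text \<open>In the chart \<open>c\<close>, \<open>nabla\<close> has the connection form
  \<open>(x, v \<oplus> s) \<mapsto> R(x, s) \<oplus> (- x \<triangle> v + C(x, s))\<close>, which enters with a minus sign.\<close>

definition christoffel_symbols ::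
    "('m, 'e::real_normed_vector) chart set \<Rightarrow> ('m, 'e) t2_connection \<Rightarrow> ('m, 'e) chart
      \<Rightarrow> ('e \<Rightarrow> 'e \<Rightarrow>\<^sub>L 'e sym_square \<Rightarrow>\<^sub>L 'e) \<Rightarrow> ('e \<Rightarrow> 'e \<Rightarrow>\<^sub>L 'e sym_square \<Rightarrow>\<^sub>L 'e sym_square) \<Rightarrow> bool"
  where "christoffel_symbols A nabla c R C \<longleftrightarrow>
    smooth_on (cmap c ` cdom c) R \<and> smooth_on (cmap c ` cdom c) C \<and>
    (\<forall>X\<in>vector_fields A. \<forall>\<tau>\<in>t2_sections A. \<forall>u\<in>cmap c ` cdom c.
      let x = rep X c u; v = fst (rep \<tau> c u); s = snd (rep \<tau> c u) in
        rep (nabla X \<tau>) c u = D1 (rep \<tau> c) u x - (R u x s, - (x \<triangle> v) + C u x s))"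

definition special_connection ::
    "('m, 'e::real_normed_vector) chart set \<Rightarrow> ('m, 'e) t2_connection \<Rightarrow> bool"
  where "special_connection A nabla \<longleftrightarrow>
    koszul_connection A nabla \<and> (\<forall>c\<in>A. \<exists>R C. christoffel_symbols A nabla c R C)"

end

theory Submission
  imports Defs
begin

text \<open>An element \<open>\<tau> = v \<oplus> s\<close> of the second-order tangent bundle acts on functions by
  \<open>\<tau> \<cdot> f = Df v + D\<^sup>2f s\<close>. This action does not depend on the chart and determines \<open>\<tau>\<close>. In these terms
  a Hessian structure \<open>K\<close> and its connection are related by
  \<open>(\<nabla>\<^sub>X \<tau>) \<cdot> f = X \<cdot> (\<tau> \<cdot> f) - K f(X, s)\<close>, so that the tensor law for \<open>K f\<close> and the bundle law for
  \<open>\<nabla>\<^sub>X \<tau>\<close> imply each other, and third derivatives of the transition maps never appear.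

  The Christoffel symbols of \<open>K\<close> in a chart are obtained by evaluating \<open>K\<close> on functions whose germs are
  coordinates and products of two coordinates. A general \<open>f\<close> is, near a given point, a combination of
  these and constants plus a remainder with vanishing two-jet; Hadamard's lemma puts the remainder in
  \<open>F\<^sub>m\<^sup>3\<close>, where \<open>K\<close> is prescribed.\<close>

section \<open>Smooth maps between normed spaces\<close>

text \<open>The term \<open>- x \<triangle> v\<close> in a special connection is what lowers the
  order. Differentiating \<open>Dg v + D2g s\<close> along \<open>x\<close> gives
  \<open>D3g(x, s)\<close>, the action of the derivative of \<open>v \<oplus> s\<close>, and a cross
  term \<open>D2g(x, v)\<close>, which is the action of \<open>0 \<oplus> x \<triangle> v\<close>.
  Subtracting \<open>K g(x, s)\<close> removes the third derivative, and what is left is an operator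
  of order two without constant term, hence again an element of the bundle. Two choices are not
  canonical: the global functions and sections that realise prescribed local data, and the
  Christoffel symbols, whose values off the chart image are free. The first is harmless because
  \<open>K\<close> depends on germs only, a consequence of its prescribed values on functions with
  vanishing two-jet; the second because symbols are unique on the chart image. Smoothness is tested
  in one fixed direction at a time, so a derivative in a moving direction is first expanded in a
  fixed basis. This is how finite dimension enters the calculus.\<close>

lemma D1_eqI: "(f has_derivative f') (at u) \<Longrightarrow> D1 f u = f'"
  by (rule frechet_derivative_at[symmetric])

lemma has_derivative_D1: "f differentiable (at u) \<Longrightarrow> (f has_derivative D1 f u) (at u)"
  by (rule frechet_derivative_works[THEN iffD1])

section \<open>Dependence of derivatives on the germ\<close>

lemma has_derivative_cong_nhds:
  assumes "eventually (\<lambda>w. f w = g w) (nhds u)"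
  shows "(f has_derivative f') (at u) \<longleftrightarrow> (g has_derivative f') (at u)"
proof -
  have *: "eventually (\<lambda>w. f w = g w) (at u)" "f u = g u"
    using assms by (auto simp: eventually_nhds_conv_at)
  then have "eventually (\<lambda>w. g w = f w) (at u)" by (simp add: eq_commute)
  with * show ?thesis
    using has_derivative_transform_eventually[of f f' u UNIV g]
      has_derivative_transform_eventually[of g f' u UNIV f] by auto
qed

lemma differentiable_cong_nhds:
  assumes "eventually (\<lambda>w. f w = g w) (nhds u)"
  shows "f differentiable (at u) \<longleftrightarrow> g differentiable (at u)"
  unfolding differentiable_def using has_derivative_cong_nhds[OF assms] by blast

lemma D1_cong:
  assumes "eventually (\<lambda>w. f w = g w) (nhds u)"
  shows "D1 f u = D1 g u"
  unfolding frechet_derivative_def using has_derivative_cong_nhds[OF assms] by simp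

text \<open>Agreement near \<open>u\<close> is agreement near every point close to \<open>u\<close>,
  so the first derivatives agree as germs and may be differentiated again.\<close>

lemma D2_cong:
  assumes "eventually (\<lambda>w. f w = g w) (nhds u)"
  shows "D2 f u = D2 g u"
proof -
  have "eventually (\<lambda>w. D1 f w = D1 g w) (nhds u)"
    using eventually_eventually[THEN iffD2, OF assms] by (rule eventually_mono) (rule D1_cong)
  then have "D1 (\<lambda>w. D1 f w y) u = D1 (\<lambda>w. D1 g w y) u" for y
    by (intro D1_cong) (auto elim: eventually_mono)
  then show ?thesis by (auto simp: D2_def fun_eq_iff)
qed

lemma D3_cong:
  assumes "eventually (\<lambda>w. f w = g w) (nhds u)"
  shows "D3 f u = D3 g u"
proof -
  have "eventually (\<lambda>w. D2 f w = D2 g w) (nhds u)"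
    using eventually_eventually[THEN iffD2, OF assms] by (rule eventually_mono) (rule D2_cong)
  then have "D1 (\<lambda>w. D2 f w y z) u = D1 (\<lambda>w. D2 g w y z) u" for y z
    by (intro D1_cong) (auto elim: eventually_mono)
  then show ?thesis by (auto simp: D3_def fun_eq_iff)
qed

lemma eventually_nhds_open: "open S \<Longrightarrow> u \<in> S \<Longrightarrow> (\<And>w. w \<in> S \<Longrightarrow> P w) \<Longrightarrow> eventually P (nhds u)"
  unfolding eventually_nhds by blast

section \<open>Locality and closure properties of differentiability classes\<close>

lemma Ck_on_cong_imp:
  assumes "open S"
  shows "(\<And>x. x \<in> S \<Longrightarrow> f x = g x) \<Longrightarrow> Ck_on k f S \<Longrightarrow> Ck_on k g S"
proof (induction k arbitrary: f g)
  case 0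
  then show ?case using continuous_on_cong[of S S f g] by simp
next
  case (Suc k)
  have ev: "eventually (\<lambda>w. f w = g w) (nhds u)" if "u \<in> S" for u
    using assms that Suc.prems(1) by (rule eventually_nhds_open)
  have "Ck_on k (\<lambda>u. D1 g u v) S" for v
    by (rule Suc.IH[of "\<lambda>u. D1 f u v"]) (use Suc.prems(2) in \<open>simp_all add: D1_cong[OF ev]\<close>)
  moreover have "g differentiable (at u)" if "u \<in> S" for u
    using Suc.prems(2) differentiable_cong_nhds[OF ev[OF that]] that by simp
  ultimately show ?case by simp
qed

lemma Ck_on_cong:
  assumes "open S" "\<And>x. x \<in> S \<Longrightarrow> f x = g x"
  shows "Ck_on k f S \<longleftrightarrow> Ck_on k g S"
  using Ck_on_cong_imp[OF assms(1), of f g] Ck_on_cong_imp[OF assms(1), of g f] assms(2) by metis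

lemma smooth_on_cong:
  assumes "open S" "\<And>x. x \<in> S \<Longrightarrow> f x = g x"
  shows "smooth_on S f \<longleftrightarrow> smooth_on S g"
  unfolding smooth_on_def using Ck_on_cong[of S f g, OF assms] by blast

lemma smooth_on_transform:
  "open S \<Longrightarrow> smooth_on S g \<Longrightarrow> (\<And>x. x \<in> S \<Longrightarrow> f x = g x) \<Longrightarrow> smooth_on S f"
  using smooth_on_cong[of S f g] by blast

lemma Ck_on_SucD: "Ck_on (Suc k) f S \<Longrightarrow> Ck_on k f S"
proof (induction k arbitrary: f)
  case 0
  then show ?case
    by (auto intro!: continuous_at_imp_continuous_on differentiable_imp_continuous_within)
qed auto

lemma Ck_on_subset: "Ck_on k f S \<Longrightarrow> T \<subseteq> S \<Longrightarrow> Ck_on k f T"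
  by (induction k arbitrary: f) (auto intro: continuous_on_subset)

lemma smooth_on_subset: "smooth_on S f \<Longrightarrow> T \<subseteq> S \<Longrightarrow> smooth_on T f"
  unfolding smooth_on_def by (blast intro: Ck_on_subset)

text \<open>The neighbourhood \<open>T\<close> need not lie in \<open>S\<close>: differentiability
  and, through the openness of \<open>T\<close>, continuity are conditions on \<open>f\<close> at
  the point in the full space.\<close>

lemma Ck_on_local:
  "(\<And>x. x \<in> S \<Longrightarrow> \<exists>T. open T \<and> x \<in> T \<and> Ck_on k f T) \<Longrightarrow> Ck_on k f S"
proof (induction k arbitrary: f)
  case 0
  show ?case unfolding Ck_on.simps
  proof (rule continuous_at_imp_continuous_on, rule ballI)
    fix x assume "x \<in> S"
    then obtain T where "open T" "x \<in> T" "continuous_on T f" using 0[of x] by auto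
    then show "isCont f x" by (simp add: continuous_on_eq_continuous_at)
  qed
next
  case (Suc k)
  have "Ck_on k (\<lambda>u. D1 f u v) S" for v
    using Suc.prems by (intro Suc.IH) fastforce
  moreover have "f differentiable at x" if "x \<in> S" for x using Suc.prems[OF that] by auto
  ultimately show ?case by simp
qed

lemma smooth_on_local:
  assumes "\<And>x. x \<in> S \<Longrightarrow> \<exists>T. open T \<and> x \<in> T \<and> smooth_on T f"
  shows "smooth_on S f"
  unfolding smooth_on_def
proof
  show "Ck_on k f S" for k
    by (rule Ck_on_local) (use assms in \<open>auto simp: smooth_on_def\<close>)
qed

lemma smooth_on_differentiable: "smooth_on S f \<Longrightarrow> u \<in> S \<Longrightarrow> f differentiable (at u)"
  unfolding smooth_on_def by (drule spec[of _ "Suc 0"]) simp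

lemma smooth_on_has_derivative: "smooth_on S f \<Longrightarrow> u \<in> S \<Longrightarrow> (f has_derivative D1 f u) (at u)"
  by (simp add: has_derivative_D1 smooth_on_differentiable)

lemma smooth_on_continuous_on: "smooth_on S f \<Longrightarrow> continuous_on S f"
  unfolding smooth_on_def by (drule spec[of _ 0]) simp

lemma smooth_on_D1: "smooth_on S f \<Longrightarrow> smooth_on S (\<lambda>u. D1 f u v)"
  unfolding smooth_on_def
proof
  show "Ck_on k (\<lambda>u. D1 f u v) S" if "\<forall>k. Ck_on k f S" for k
    using that[THEN spec, of "Suc k"] by simp
qed

lemma smooth_on_D2: "smooth_on S f \<Longrightarrow> smooth_on S (\<lambda>u. D2 f u x y)"
  unfolding D2_def by (intro smooth_on_D1)

lemma smooth_on_D3: "smooth_on S f \<Longrightarrow> smooth_on S (\<lambda>u. D3 f u x y z)"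
  unfolding D3_def by (intro smooth_on_D1 smooth_on_D2)

lemma Ck_on_const: "Ck_on k (\<lambda>_. c) S"
  by (induction k arbitrary: c) auto

lemma smooth_on_const: "smooth_on S (\<lambda>_. c)"
  by (simp add: smooth_on_def Ck_on_const)

lemma smooth_on_bounded_linear: "bounded_linear L \<Longrightarrow> smooth_on S L"
proof -
  assume L: "bounded_linear L"
  have "Ck_on k L S" for k
  proof (cases k)
    case 0
    then show ?thesis using L by (simp add: linear_continuous_on)
  next
    case (Suc k)
    have "D1 L u = L" for u by (intro D1_eqI bounded_linear_imp_has_derivative L)
    then show ?thesis using L Suc
      by (auto simp: Ck_on_const intro: bounded_linear_imp_differentiable)
  qed
  then show ?thesis by (simp add: smooth_on_def)
qed

lemma Ck_on_linear_compose:
  assumes "open S" "bounded_linear L"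
  shows "Ck_on k f S \<Longrightarrow> Ck_on k (\<lambda>x. L (f x)) S"
proof (induction k arbitrary: f)
  case 0
  then show ?case using bounded_linear.continuous_on[OF assms(2)] by simp
next
  case (Suc k)
  have der: "((\<lambda>x. L (f x)) has_derivative (\<lambda>v. L (D1 f u v))) (at u)" if "u \<in> S" for u
    using Suc.prems that
    by (intro bounded_linear.has_derivative[OF assms(2)] has_derivative_D1) auto
  have "Ck_on k (\<lambda>u. D1 (\<lambda>x. L (f x)) u v) S" for v
  proof (rule Ck_on_cong_imp[OF assms(1)])
    show "L (D1 f u v) = D1 (\<lambda>x. L (f x)) u v" if "u \<in> S" for u
      using D1_eqI[OF der[OF that]] by simp
    show "Ck_on k (\<lambda>u. L (D1 f u v)) S" using Suc.prems by (intro Suc.IH) auto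
  qed
  with der show ?case unfolding Ck_on.simps by (blast intro: differentiableI)
qed

lemma smooth_on_linear_compose:
  "open S \<Longrightarrow> bounded_linear L \<Longrightarrow> smooth_on S f \<Longrightarrow> smooth_on S (\<lambda>x. L (f x))"
  unfolding smooth_on_def by (blast intro: Ck_on_linear_compose)

lemma Ck_on_add:
  assumes "open S"
  shows "Ck_on k f S \<Longrightarrow> Ck_on k g S \<Longrightarrow> Ck_on k (\<lambda>x. f x + g x) S"
proof (induction k arbitrary: f g)
  case 0
  then show ?case by (simp add: continuous_on_add)
next
  case (Suc k)
  have der: "((\<lambda>x. f x + g x) has_derivative (\<lambda>v. D1 f u v + D1 g u v)) (at u)" if "u \<in> S" for u
    using Suc.prems that by (intro has_derivative_add has_derivative_D1) auto
  have "Ck_on k (\<lambda>u. D1 (\<lambda>x. f x + g x) u v) S" for v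
  proof (rule Ck_on_cong_imp[OF assms(1)])
    show "D1 f u v + D1 g u v = D1 (\<lambda>x. f x + g x) u v" if "u \<in> S" for u
      using D1_eqI[OF der[OF that]] by simp
    show "Ck_on k (\<lambda>u. D1 f u v + D1 g u v) S" using Suc.prems by (intro Suc.IH) auto
  qed
  with der show ?case unfolding Ck_on.simps by (blast intro: differentiableI)
qed

text \<open>Leibniz rule: each summand pairs one factor with the derivative of the other, so the
  induction hypothesis is applied to a factor, weakened to class \<open>k\<close>, and to a
  derivative of class \<open>k\<close>.\<close>

lemma Ck_on_bilinear:
  assumes "open S" "bounded_bilinear B"
  shows "Ck_on k f S \<Longrightarrow> Ck_on k g S \<Longrightarrow> Ck_on k (\<lambda>x. B (f x) (g x)) S"
proof (induction k arbitrary: f g)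
  case 0
  then show ?case using bounded_bilinear.continuous_on[OF assms(2)] by simp
next
  case (Suc k)
  have der: "((\<lambda>x. B (f x) (g x)) has_derivative (\<lambda>v. B (f u) (D1 g u v) + B (D1 f u v) (g u))) (at u)"
    if "u \<in> S" for u
    using Suc.prems that by (intro bounded_bilinear.FDERIV[OF assms(2)] has_derivative_D1) auto
  have "Ck_on k (\<lambda>u. D1 (\<lambda>x. B (f x) (g x)) u v) S" for v
  proof (rule Ck_on_cong_imp[OF assms(1)])
    show "B (f u) (D1 g u v) + B (D1 f u v) (g u) = D1 (\<lambda>x. B (f x) (g x)) u v" if "u \<in> S" for u
      using D1_eqI[OF der[OF that]] by simp
    show "Ck_on k (\<lambda>u. B (f u) (D1 g u v) + B (D1 f u v) (g u)) S"
      using Suc.prems Suc.prems[THEN Ck_on_SucD] by (intro Ck_on_add assms(1) Suc.IH) auto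
  qed
  with der show ?case unfolding Ck_on.simps by (blast intro: differentiableI)
qed

lemma smooth_on_add: "open S \<Longrightarrow> smooth_on S f \<Longrightarrow> smooth_on S g \<Longrightarrow> smooth_on S (\<lambda>x. f x + g x)"
  unfolding smooth_on_def by (blast intro: Ck_on_add)

lemma smooth_on_bilinear:
  "open S \<Longrightarrow> bounded_bilinear B \<Longrightarrow> smooth_on S f \<Longrightarrow> smooth_on S g \<Longrightarrow> smooth_on S (\<lambda>x. B (f x) (g x))"
  unfolding smooth_on_def by (blast intro: Ck_on_bilinear)

lemma smooth_on_scaleR:
  "open S \<Longrightarrow> smooth_on S f \<Longrightarrow> smooth_on S g \<Longrightarrow> smooth_on S (\<lambda>x. f x *\<^sub>R g x)"
  by (rule smooth_on_bilinear[OF _ bounded_bilinear_scaleR])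

lemma smooth_on_mult:
  fixes f g :: "_ \<Rightarrow> real"
  shows "open S \<Longrightarrow> smooth_on S f \<Longrightarrow> smooth_on S g \<Longrightarrow> smooth_on S (\<lambda>x. f x * g x)"
  by (rule smooth_on_bilinear[OF _ bounded_bilinear_mult])

lemma smooth_on_minus: "open S \<Longrightarrow> smooth_on S f \<Longrightarrow> smooth_on S (\<lambda>x. - f x)"
  by (rule smooth_on_linear_compose[OF _ bounded_linear_minus[OF bounded_linear_ident]])

lemma smooth_on_diff: "open S \<Longrightarrow> smooth_on S f \<Longrightarrow> smooth_on S g \<Longrightarrow> smooth_on S (\<lambda>x. f x - g x)"
  using smooth_on_add[of S f "\<lambda>x. - g x"] smooth_on_minus[of S g] by simp

lemma smooth_on_sum:
  "open S \<Longrightarrow> (\<And>i. i \<in> I \<Longrightarrow> smooth_on S (f i)) \<Longrightarrow> smooth_on S (\<lambda>x. \<Sum>i\<in>I. f i x)"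
  by (induction I rule: infinite_finite_induct) (auto intro: smooth_on_const smooth_on_add)

lemma smooth_on_Pair:
  assumes "open S" "smooth_on S f" "smooth_on S g"
  shows "smooth_on S (\<lambda>x. (f x, g x))"
proof -
  have "smooth_on S (\<lambda>x. (f x, 0) + (0, g x))"
    by (intro smooth_on_add assms smooth_on_linear_compose[OF assms(1) _ assms(2)]
        smooth_on_linear_compose[OF assms(1) _ assms(3)] bounded_linear_intros)
  then show ?thesis by simp
qed

lemma smooth_on_fst: "open S \<Longrightarrow> smooth_on S f \<Longrightarrow> smooth_on S (\<lambda>x. fst (f x))"
  by (rule smooth_on_linear_compose[OF _ bounded_linear_fst])

lemma smooth_on_snd: "open S \<Longrightarrow> smooth_on S f \<Longrightarrow> smooth_on S (\<lambda>x. snd (f x))"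
  by (rule smooth_on_linear_compose[OF _ bounded_linear_snd])

lemma smooth_on_ident: "smooth_on S (\<lambda>x. x)"
  by (rule smooth_on_bounded_linear[OF bounded_linear_ident])


section \<open>Coordinates\<close>

definition coord_basis :: "'e::finite_dim_banach set"
  where "coord_basis = (SOME B. finite B \<and> independent B \<and> span B = UNIV)"

text \<open>For \<open>b\<close> outside the basis \<open>representation\<close> is 0, so
  \<open>coord b\<close> is a linear functional for every \<open>b\<close>.\<close>

definition coord :: "'e::finite_dim_banach \<Rightarrow> 'e \<Rightarrow> real"
  where "coord b x = representation coord_basis x b"

lemma coord_basis:
  "finite (coord_basis :: 'e::finite_dim_banach set)"
  "independent (coord_basis :: 'e set)" "span (coord_basis :: 'e set) = UNIV"
  using someI_ex[OF finite_basis_exists[where 'a='e]] unfolding coord_basis_def by blast+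

lemma linear_coord: "linear (coord b)"
  unfolding coord_def
  by (rule linearI) (simp_all add: representation_add coord_basis representation_scale)

lemma bounded_linear_coord: "bounded_linear (coord b)"
  by (rule bounded_linear_finite_dim[OF linear_coord])

lemma coord_expansion: "(\<Sum>b\<in>coord_basis. coord b x *\<^sub>R b) = x"
  unfolding coord_def
  using sum_representation_eq[OF coord_basis(2) _ coord_basis(1) subset_refl, of x]
  by (simp add: coord_basis(3))

lemma coord_of_basis: "b \<in> coord_basis \<Longrightarrow> coord a b = (if a = b then 1 else 0)"
  unfolding coord_def by (simp add: representation_basis coord_basis)

lemma coord_eqI: "(\<And>b. b \<in> coord_basis \<Longrightarrow> coord b x = coord b y) \<Longrightarrow> x = y"
proof -
  assume "\<And>b. b \<in> coord_basis \<Longrightarrow> coord b x = coord b y"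
  then have "(\<Sum>b\<in>coord_basis. coord b x *\<^sub>R b) = (\<Sum>b\<in>coord_basis. coord b y *\<^sub>R b)"
    by (intro sum.cong) auto
  then show ?thesis by (simp only: coord_expansion)
qed

lemma linear_expansion:
  assumes "linear L"
  shows "L x = (\<Sum>b\<in>coord_basis. coord b x *\<^sub>R L b)"
proof -
  have "L x = L (\<Sum>b\<in>coord_basis. coord b x *\<^sub>R b)" by (simp add: coord_expansion)
  then show ?thesis by (simp add: linear_sum[OF assms] linear_cmul[OF assms])
qed

lemma D1_linear: "f differentiable (at u) \<Longrightarrow> linear (D1 f u)"
  by (rule linear_frechet_derivative)

text \<open>Differentiating \<open>g (f x)\<close> gives a derivative of \<open>g\<close> in the
  direction \<open>D1 f u v\<close>, which moves with \<open>u\<close>, while \<open>Ck_on\<close>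
  controls fixed directions only. Expanding the direction in a basis leaves factors
  \<open>D1 g (f u) b\<close>, to which the induction hypothesis applies.\<close>

lemma Ck_on_compose:
  fixes f :: "'a::real_normed_vector \<Rightarrow> 'b::finite_dim_banach" and g :: "'b \<Rightarrow> 'c::real_normed_vector"
  assumes "open S" "open T"
  shows "f ` S \<subseteq> T \<Longrightarrow> Ck_on k f S \<Longrightarrow> Ck_on k g T \<Longrightarrow> Ck_on k (\<lambda>x. g (f x)) S"
proof (induction k arbitrary: g)
  case 0
  then show ?case by (auto intro: continuous_on_compose2)
next
  case (Suc k)
  have fk: "Ck_on k f S" using Suc.prems(2) by (rule Ck_on_SucD)
  have der: "((\<lambda>x. g (f x)) has_derivative (\<lambda>v. D1 g (f u) (D1 f u v))) (at u)" if "u \<in> S" for u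
  proof -
    have "f differentiable (at u)" "g differentiable (at (f u))" using Suc.prems that by auto
    then show ?thesis by (intro has_derivative_compose[of f _ u UNIV g] has_derivative_D1)
  qed
  have "Ck_on k (\<lambda>u. D1 (\<lambda>x. g (f x)) u v) S" for v
  proof (rule Ck_on_cong_imp[OF assms(1)])
    fix u assume u: "u \<in> S"
    have "D1 (\<lambda>x. g (f x)) u v = D1 g (f u) (D1 f u v)" using D1_eqI[OF der[OF u]] by simp
    also have "\<dots> = (\<Sum>b\<in>coord_basis. coord b (D1 f u v) *\<^sub>R D1 g (f u) b)"
      using Suc.prems u by (intro linear_expansion D1_linear) auto
    finally show "(\<Sum>b\<in>coord_basis. coord b (D1 f u v) *\<^sub>R D1 g (f u) b) = D1 (\<lambda>x. g (f x)) u v" by simp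
  next
    have "Ck_on k (\<lambda>u. \<Sum>b\<in>B. coord b (D1 f u v) *\<^sub>R D1 g (f u) b) S" if "finite B" for B
      using that
    proof induction
      case empty
      show ?case by (simp add: Ck_on_const)
    next
      case (insert b B)
      have "Ck_on k (\<lambda>u. coord b (D1 f u v) *\<^sub>R D1 g (f u) b) S"
        using Suc.prems fk
        by (intro Ck_on_bilinear[OF assms(1) bounded_bilinear_scaleR]
            Ck_on_linear_compose[OF assms(1) bounded_linear_coord] Suc.IH) auto
      then show ?case using insert by (auto intro: Ck_on_add[OF assms(1)])
    qed
    then show "Ck_on k (\<lambda>u. \<Sum>b\<in>coord_basis. coord b (D1 f u v) *\<^sub>R D1 g (f u) b) S"
      using coord_basis(1) by blast
  qed
  with der show ?case unfolding Ck_on.simps by (blast intro: differentiableI)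
qed

lemma smooth_on_compose:
  fixes f :: "'a::real_normed_vector \<Rightarrow> 'b::finite_dim_banach"
  assumes "open S" "open T" "smooth_on S f" "smooth_on T g" "f ` S \<subseteq> T"
  shows "smooth_on S (\<lambda>x. g (f x))"
  using assms unfolding smooth_on_def by (blast intro: Ck_on_compose)

lemma smooth_on_coord: "open S \<Longrightarrow> smooth_on S f \<Longrightarrow> smooth_on S (\<lambda>x. coord b (f x))"
  by (rule smooth_on_linear_compose[OF _ bounded_linear_coord])

text \<open>A derivative in a moving direction, reduced to fixed directions by expanding
  \<open>w u\<close> in the basis.\<close>

lemma smooth_on_D1_apply:
  fixes f :: "'a::finite_dim_banach \<Rightarrow> 'b::real_normed_vector"
  assumes "open S" "smooth_on S f" "smooth_on S w"
  shows "smooth_on S (\<lambda>u. D1 f u (w u))"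
proof -
  have "D1 f u (w u) = (\<Sum>b\<in>coord_basis. coord b (w u) *\<^sub>R D1 f u b)" if "u \<in> S" for u
    by (intro linear_expansion D1_linear smooth_on_differentiable[OF assms(2) that])
  then have "smooth_on S (\<lambda>u. D1 f u (w u)) \<longleftrightarrow>
      smooth_on S (\<lambda>u. \<Sum>b\<in>coord_basis. coord b (w u) *\<^sub>R D1 f u b)"
    by (intro smooth_on_cong assms)
  also have "\<dots>" by (intro smooth_on_sum smooth_on_scaleR smooth_on_coord smooth_on_D1 assms)
  finally show ?thesis .
qed

lemma D1_compose:
  assumes "f differentiable (at u)" "g differentiable (at (f u))"
  shows "D1 (\<lambda>x. g (f x)) u v = D1 g (f u) (D1 f u v)"
  using D1_eqI[OF has_derivative_compose[of f _ u UNIV g, OF has_derivative_D1[OF assms(1)]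
      has_derivative_D1[OF assms(2)]]] by simp

lemma D1_linear_compose:
  assumes "bounded_linear L" "f differentiable (at u)"
  shows "D1 (\<lambda>x. L (f x)) u v = L (D1 f u v)"
  using D1_eqI[OF bounded_linear.has_derivative[OF assms(1) has_derivative_D1[OF assms(2)]]] by simp

lemma D1_add:
  assumes "f differentiable (at u)" "g differentiable (at u)"
  shows "D1 (\<lambda>x. f x + g x) u v = D1 f u v + D1 g u v"
  using D1_eqI[OF has_derivative_add[OF assms[THEN has_derivative_D1]]] by simp

lemma D1_bilinear:
  assumes "bounded_bilinear B" "f differentiable (at u)" "g differentiable (at u)"
  shows "D1 (\<lambda>x. B (f x) (g x)) u v = B (f u) (D1 g u v) + B (D1 f u v) (g u)"
  using D1_eqI[OF bounded_bilinear.FDERIV[OF assms(1) assms(2,3)[THEN has_derivative_D1]]] by simp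

lemmas D1_scaleR = D1_bilinear[OF bounded_bilinear_scaleR]
lemmas D1_mult = D1_bilinear[OF bounded_bilinear_mult]

lemma D1_scaleR_const:
  "f differentiable (at u) \<Longrightarrow> D1 (\<lambda>x. c *\<^sub>R f x) u v = c *\<^sub>R D1 f u v"
  by (rule D1_linear_compose[OF bounded_linear_scaleR_right])

lemma D1_sum:
  assumes "\<And>i. i \<in> I \<Longrightarrow> f i differentiable (at u)"
  shows "D1 (\<lambda>x. \<Sum>i\<in>I. f i x) u v = (\<Sum>i\<in>I. D1 (f i) u v)"
proof -
  have "((\<lambda>x. \<Sum>i\<in>I. f i x) has_derivative (\<lambda>v. \<Sum>i\<in>I. D1 (f i) u v)) (at u)"
    by (intro has_derivative_sum has_derivative_D1 assms)
  then show ?thesis by (simp add: D1_eqI)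
qed

lemma D1_Pair:
  assumes "f differentiable (at u)" "g differentiable (at u)"
  shows "D1 (\<lambda>x. (f x, g x)) u v = (D1 f u v, D1 g u v)"
  using D1_eqI[OF has_derivative_Pair[OF assms[THEN has_derivative_D1]]] by simp

text \<open>Differentiating a family of linear maps with respect to its parameter preserves
  linearity in the argument. This gives the linearity of \<open>D2\<close> and \<open>D3\<close> in
  the slots other than the direction of the last differentiation.\<close>

lemma linear_D1_param:
  assumes "eventually (\<lambda>w. linear (G w)) (nhds u)" "\<And>y. (\<lambda>w. G w y) differentiable (at u)"
  shows "linear (\<lambda>y. D1 (\<lambda>w. G w y) u x)"
proof
  fix y z and c :: real
  have "D1 (\<lambda>w. G w (y + z)) u = D1 (\<lambda>w. G w y + G w z) u"
    by (rule D1_cong) (use assms(1) in \<open>auto elim!: eventually_mono simp: linear_add\<close>)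
  then show "D1 (\<lambda>w. G w (y + z)) u x = D1 (\<lambda>w. G w y) u x + D1 (\<lambda>w. G w z) u x"
    by (simp add: D1_add assms(2))
  have "D1 (\<lambda>w. G w (c *\<^sub>R y)) u = D1 (\<lambda>w. c *\<^sub>R G w y) u"
    by (rule D1_cong) (use assms(1) in \<open>auto elim!: eventually_mono simp: linear_cmul\<close>)
  then show "D1 (\<lambda>w. G w (c *\<^sub>R y)) u x = c *\<^sub>R D1 (\<lambda>w. G w y) u x"
    by (simp add: D1_scaleR_const assms(2))
qed

context
  fixes f :: "'a::real_normed_vector \<Rightarrow> 'b::real_normed_vector" and S u
  assumes f: "smooth_on S f" and S: "open S" "u \<in> S"
begin

lemma linear_D2_1: "linear (\<lambda>x. D2 f u x y)"
  unfolding D2_def using D1_linear[OF smooth_on_differentiable[OF smooth_on_D1[OF f] S(2)]] by simp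

lemma linear_D2_2: "linear (D2 f u x)"
proof -
  have "linear (\<lambda>y. D1 (\<lambda>w. D1 f w y) u x)"
    by (intro linear_D1_param eventually_nhds_open[OF S] D1_linear smooth_on_differentiable[OF f]
        smooth_on_differentiable[OF smooth_on_D1[OF f] S(2)])
  then show ?thesis by (simp add: D2_def[abs_def])
qed

lemma linear_D3_1: "linear (\<lambda>x. D3 f u x y z)"
  unfolding D3_def using D1_linear[OF smooth_on_differentiable[OF smooth_on_D2[OF f] S(2)]] by simp

end

lemma linear_D3_2:
  assumes f: "smooth_on S f" and S: "open S" "u \<in> S"
  shows "linear (\<lambda>y. D3 f u x y z)"
  unfolding D3_def
  by (intro linear_D1_param[of "\<lambda>w y. D2 f w y z"] eventually_nhds_open[OF S] linear_D2_1[OF f S(1)]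
      smooth_on_differentiable[OF smooth_on_D2[OF f] S(2)])

lemma linear_D3_3:
  assumes f: "smooth_on S f" and S: "open S" "u \<in> S"
  shows "linear (D3 f u x y)"
proof -
  have "linear (\<lambda>z. D1 (\<lambda>w. D2 f w y z) u x)"
    by (intro linear_D1_param[of "\<lambda>w z. D2 f w y z"] eventually_nhds_open[OF S] linear_D2_2[OF f S(1)]
        smooth_on_differentiable[OF smooth_on_D2[OF f] S(2)])
  then show ?thesis by (simp add: D3_def[abs_def])
qed


subsection \<open>Symmetry of the second derivative\<close>

lemma DERIV_along_line:
  fixes g :: "'a::real_normed_vector \<Rightarrow> real"
  assumes "g differentiable (at (p + a *\<^sub>R y))"
  shows "((\<lambda>a. g (p + a *\<^sub>R y)) has_field_derivative D1 g (p + a *\<^sub>R y) y) (at a)"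
proof -
  have "((\<lambda>a. p + a *\<^sub>R y) has_derivative (\<lambda>h. h *\<^sub>R y)) (at a)"
    by (auto intro!: derivative_eq_intros)
  from has_derivative_compose[OF this has_derivative_D1[OF assms]]
  have "((\<lambda>a. g (p + a *\<^sub>R y)) has_derivative (\<lambda>h. D1 g (p + a *\<^sub>R y) (h *\<^sub>R y))) (at a)" .
  then show ?thesis
    unfolding has_field_derivative_def
    by (simp add: linear_cmul[OF D1_linear[OF assms]] mult.commute[of _ "D1 g (p + a *\<^sub>R y) y"])
qed

text \<open>Mean value theorem twice: for \<open>\<phi> a\<close>, the increment of \<open>f\<close>
  over \<open>t z\<close> as the base point moves along \<open>y\<close>, and then along
  \<open>z\<close> for the resulting derivative in the direction \<open>y\<close>. The second
  difference itself is symmetric in \<open>y\<close> and \<open>z\<close>.\<close>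

lemma second_difference_mvt:
  fixes f :: "'a::real_normed_vector \<Rightarrow> real"
  assumes f: "smooth_on S f" and t: "0 < t"
    and mem: "\<And>a b. 0 \<le> a \<Longrightarrow> a \<le> t \<Longrightarrow> 0 \<le> b \<Longrightarrow> b \<le> t \<Longrightarrow> u + a *\<^sub>R y + b *\<^sub>R z \<in> S"
  obtains \<xi> \<eta> where "0 < \<xi>" "\<xi> < t" "0 < \<eta>" "\<eta> < t"
    "f (u + t *\<^sub>R y + t *\<^sub>R z) - f (u + t *\<^sub>R y) - f (u + t *\<^sub>R z) + f u
      = t * t * D2 f (u + \<xi> *\<^sub>R y + \<eta> *\<^sub>R z) z y"
proof -
  define \<phi> where "\<phi> a = f ((u + t *\<^sub>R z) + a *\<^sub>R y) - f (u + a *\<^sub>R y)" for a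
  have df: "f differentiable (at (u + a *\<^sub>R y + b *\<^sub>R z))" if "0 \<le> a" "a \<le> t" "0 \<le> b" "b \<le> t" for a b
    using mem[OF that] by (rule smooth_on_differentiable[OF f])
  have "(\<phi> has_field_derivative
      D1 f ((u + t *\<^sub>R z) + a *\<^sub>R y) y - D1 f (u + a *\<^sub>R y) y) (at a)" if "0 \<le> a" "a \<le> t" for a
    unfolding \<phi>_def
    using df[of a t] df[of a 0] that t
    by (intro DERIV_diff DERIV_along_line) (simp_all add: algebra_simps)
  from MVT2[OF t this] obtain \<xi> where \<xi>: "0 < \<xi>" "\<xi> < t"
    "\<phi> t - \<phi> 0 = (t - 0) * (D1 f ((u + t *\<^sub>R z) + \<xi> *\<^sub>R y) y - D1 f (u + \<xi> *\<^sub>R y) y)" by auto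
  have "((\<lambda>b. D1 f ((u + \<xi> *\<^sub>R y) + b *\<^sub>R z) y) has_field_derivative
      D1 (\<lambda>w. D1 f w y) ((u + \<xi> *\<^sub>R y) + b *\<^sub>R z) z) (at b)" if "0 \<le> b" "b \<le> t" for b
    using \<xi> that
    by (intro DERIV_along_line[of "\<lambda>w. D1 f w y"] smooth_on_differentiable[OF smooth_on_D1[OF f]] mem) auto
  from MVT2[OF t this] obtain \<eta> where \<eta>: "0 < \<eta>" "\<eta> < t"
    "D1 f ((u + \<xi> *\<^sub>R y) + t *\<^sub>R z) y - D1 f (u + \<xi> *\<^sub>R y) y
      = t * D1 (\<lambda>w. D1 f w y) ((u + \<xi> *\<^sub>R y) + \<eta> *\<^sub>R z) z" by auto
  have "f (u + t *\<^sub>R y + t *\<^sub>R z) - f (u + t *\<^sub>R y) - f (u + t *\<^sub>R z) + f u = \<phi> t - \<phi> 0"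
    by (simp add: \<phi>_def algebra_simps)
  also have "\<dots> = t * t * D2 f (u + \<xi> *\<^sub>R y + \<eta> *\<^sub>R z) z y"
    using \<xi>(3) \<eta>(3) by (simp add: D2_def algebra_simps)
  finally show ?thesis using \<xi> \<eta> that by blast
qed

text \<open>The same second difference is represented once by \<open>D2 f _ z y\<close> and once by
  \<open>D2 f _ y z\<close> at points close to \<open>u\<close>; continuity of both derivatives at
  \<open>u\<close> then excludes a gap between them.\<close>

lemma D2_sym_real:
  fixes f :: "'a::real_normed_vector \<Rightarrow> real"
  assumes f: "smooth_on S f" and S: "open S" "u \<in> S"
  shows "D2 f u y z = D2 f u z y"
proof (rule ccontr)
  assume ne: "D2 f u y z \<noteq> D2 f u z y"
  \<comment> \<open>Half of the gap: numbers at distance less than \<open>e\<close> from the two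
    derivatives cannot coincide.\<close>
  define e where "e = \<bar>D2 f u y z - D2 f u z y\<bar> / 2"
  have e: "e > 0" using ne by (simp add: e_def)
  have cont: "isCont (\<lambda>w. D2 f w x y) u" for x y
    using smooth_on_continuous_on[OF smooth_on_D2[OF f, of x y]] S
    by (simp add: continuous_on_eq_continuous_at)
  have "eventually (\<lambda>w. w \<in> S \<and> dist (D2 f w y z) (D2 f u y z) < e \<and> dist (D2 f w z y) (D2 f u z y) < e)
      (nhds u)"
    using tendstoD[OF isContD[OF cont[of y z]] e] tendstoD[OF isContD[OF cont[of z y]] e] S e
    by (auto simp: eventually_nhds_conv_at intro!: eventually_conj eventually_at_in_open' )
  then obtain d where d: "d > 0" "\<And>w. dist w u < d \<Longrightarrow> w \<in> S"
    "\<And>w. dist w u < d \<Longrightarrow> dist (D2 f w y z) (D2 f u y z) < e"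
    "\<And>w. dist w u < d \<Longrightarrow> dist (D2 f w z y) (D2 f u z y) < e"
    unfolding eventually_nhds_metric by metis
  \<comment> \<open>With \<open>t * L = d / 2\<close> every point of the parallelogram lies within
    \<open>d\<close> of \<open>u\<close>; the summand 1 keeps \<open>L\<close> positive when
    \<open>y\<close> and \<open>z\<close> vanish.\<close>
  define L where "L = norm y + norm z + 1"
  have L: "L > 0" by (simp add: L_def add_nonneg_pos)
  define t where "t = d / (2 * L)"
  have t: "t > 0" using d L by (simp add: t_def)
  \<comment> \<open>Stated for \<open>y'\<close> and \<open>z'\<close> because it is used for both
    orders of the two vectors.\<close>
  have near: "dist (u + a *\<^sub>R y' + b *\<^sub>R z') u < d"
    if "0 \<le> a" "a \<le> t" "0 \<le> b" "b \<le> t" "norm y' + norm z' + 1 = L" for a b y' z'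
  proof -
    have "dist (u + a *\<^sub>R y' + b *\<^sub>R z') u = norm (a *\<^sub>R y' + b *\<^sub>R z')"
      by (simp add: dist_norm algebra_simps)
    also have "\<dots> \<le> a * norm y' + b * norm z'"
      using that by (intro order_trans[OF norm_triangle_ineq]) simp
    also have "\<dots> \<le> t * norm y' + t * norm z'"
      using that by (intro add_mono mult_right_mono) auto
    also have "\<dots> \<le> t * L" using t that(5)[symmetric] by (simp add: algebra_simps)
    also have "\<dots> < d" using L d by (simp add: t_def)
    finally show ?thesis .
  qed
  have nyz: "norm y + norm z + 1 = L" "norm z + norm y + 1 = L" by (simp_all add: L_def)
  obtain \<xi> \<eta> where 1: "0 < \<xi>" "\<xi> < t" "0 < \<eta>" "\<eta> < t"
    "f (u + t *\<^sub>R y + t *\<^sub>R z) - f (u + t *\<^sub>R y) - f (u + t *\<^sub>R z) + f u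
      = t * t * D2 f (u + \<xi> *\<^sub>R y + \<eta> *\<^sub>R z) z y"
    using second_difference_mvt[OF f t, of u y z] d(2) near nyz by blast
  obtain \<xi>' \<eta>' where 2: "0 < \<xi>'" "\<xi>' < t" "0 < \<eta>'" "\<eta>' < t"
    "f (u + t *\<^sub>R z + t *\<^sub>R y) - f (u + t *\<^sub>R z) - f (u + t *\<^sub>R y) + f u
      = t * t * D2 f (u + \<xi>' *\<^sub>R z + \<eta>' *\<^sub>R y) y z"
    using second_difference_mvt[OF f t, of u z y] d(2) near nyz by blast
  have "t * t * D2 f (u + \<xi> *\<^sub>R y + \<eta> *\<^sub>R z) z y = t * t * D2 f (u + \<xi>' *\<^sub>R z + \<eta>' *\<^sub>R y) y z"
    unfolding 1(5)[symmetric] 2(5)[symmetric] by (simp add: algebra_simps)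
  then have "D2 f (u + \<xi> *\<^sub>R y + \<eta> *\<^sub>R z) z y = D2 f (u + \<xi>' *\<^sub>R z + \<eta>' *\<^sub>R y) y z" using t by simp
  moreover have "dist (D2 f (u + \<xi> *\<^sub>R y + \<eta> *\<^sub>R z) z y) (D2 f u z y) < e"
    using 1 nyz by (intro d(4) near) auto
  moreover have "dist (D2 f (u + \<xi>' *\<^sub>R z + \<eta>' *\<^sub>R y) y z) (D2 f u y z) < e"
    using 2 nyz by (intro d(3) near) auto
  ultimately show False by (simp add: e_def dist_real_def abs_if split: if_splits)
qed

lemma D2_linear_compose:
  assumes L: "bounded_linear L" and f: "smooth_on S f" and S: "open S" "u \<in> S"
  shows "D2 (\<lambda>x. L (f x)) u x y = L (D2 f u x y)"
proof -
  have "D1 (\<lambda>w. D1 (\<lambda>x. L (f x)) w y) u = D1 (\<lambda>w. L (D1 f w y)) u"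
    by (intro D1_cong eventually_nhds_open[OF S] D1_linear_compose L smooth_on_differentiable[OF f])
  then show ?thesis
    using D1_linear_compose[OF L smooth_on_differentiable[OF smooth_on_D1[OF f] S(2)]]
    by (simp add: D2_def)
qed

lemma D2_sym:
  fixes f :: "'a::real_normed_vector \<Rightarrow> 'b::finite_dim_banach"
  assumes f: "smooth_on S f" and S: "open S" "u \<in> S"
  shows "D2 f u y z = D2 f u z y"
proof (rule coord_eqI)
  fix b :: 'b
  have "D2 (\<lambda>x. coord b (f x)) u y z = D2 (\<lambda>x. coord b (f x)) u z y"
    by (rule D2_sym_real[OF smooth_on_coord[OF S(1) f] S])
  then show "coord b (D2 f u y z) = coord b (D2 f u z y)"
    by (simp add: D2_linear_compose[OF bounded_linear_coord f S])
qed

lemma D3_sym: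
  fixes f :: "'a::real_normed_vector \<Rightarrow> 'b::finite_dim_banach"
  assumes f: "smooth_on S f" and S: "open S" "u \<in> S"
  shows "D3 f u x y z = D3 f u x z y"
proof -
  have "D1 (\<lambda>w. D2 f w y z) u = D1 (\<lambda>w. D2 f w z y) u"
    by (intro D1_cong eventually_nhds_open[OF S] D2_sym[OF f S(1)])
  then show ?thesis by (simp add: D3_def)
qed


section \<open>The symmetric square in coordinates\<close>

text \<open>Rank-one maps. They depend bounded-linearly on \<open>w\<close> and so turn smooth
  coefficients into smooth maps with values in spaces of bounded linear maps.\<close>

definition tensor :: "('a::real_normed_vector \<Rightarrow>\<^sub>L real) \<Rightarrow> 'b::real_normed_vector \<Rightarrow> 'a \<Rightarrow>\<^sub>L 'b"
  where "tensor \<phi> w = blinfun_scaleR_left w o\<^sub>L \<phi>"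

lemma tensor_apply [simp]: "blinfun_apply (tensor \<phi> w) x = \<phi> x *\<^sub>R w"
  by (simp add: tensor_def)

lemma bounded_linear_tensor: "bounded_linear (tensor \<phi>)"
  unfolding tensor_def
  by (intro bounded_linear_compose[OF bounded_bilinear.bounded_linear_left[OF bounded_bilinear_blinfun_compose]]
      bounded_linear_blinfun_scaleR_left)

definition coordL :: "'e::finite_dim_banach \<Rightarrow> 'e \<Rightarrow>\<^sub>L real"
  where "coordL b = Blinfun (coord b)"

lemma coordL_apply [simp]: "blinfun_apply (coordL b) x = coord b x"
  by (simp add: coordL_def bounded_linear_Blinfun_apply bounded_linear_coord)

text \<open>An element of the symmetric square is a functional on bilinear forms; its coordinates
  are its values on products of two coordinate functionals.\<close>

definition sym_coord :: "'e::finite_dim_banach \<Rightarrow> 'e \<Rightarrow> 'e sym_square \<Rightarrow> real"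
  where "sym_coord i j s = Rep_sym_square s (tensor (coordL i) (coordL j))"

lemma bounded_linear_sym_coord: "bounded_linear (sym_coord i j)"
proof (rule bounded_linear_intro)
  show "norm (sym_coord i j s) \<le> norm s * norm (tensor (coordL i) (coordL j))" for s
    unfolding sym_coord_def norm_sym_square.rep_eq by (rule norm_blinfun)
qed (simp_all add: sym_coord_def plus_sym_square.rep_eq scaleR_sym_square.rep_eq blinfun.bilinear_simps)

lemma linear_sym_coord: "linear (sym_coord i j)"
  by (rule bounded_linear.linear[OF bounded_linear_sym_coord])

lemma sym_coord_prod: "sym_coord i j (y \<triangle> z) = (coord i y * coord j z + coord i z * coord j y) / 2"
  by (simp add: sym_coord_def sym_prod.rep_eq sym_dyad_apply scaleR_blinfun.rep_eq)

lemma linear_sym_prod_right: "linear (\<lambda>z. y \<triangle> z)"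
  using linear_sym_prod[of y] by (simp add: sym_prod_commute[of y])

lemma sym_linear_eqI:
  assumes "linear L" "linear L'" "\<And>y z. L (y \<triangle> z) = L' (y \<triangle> z)"
  shows "L s = L' s"
proof -
  have "s \<in> span {y \<triangle> z | y z. True}" using span_sym_prod by blast
  moreover have "L x = L' x" if "x \<in> {y \<triangle> z | y z. True}" for x using that assms(3) by auto
  ultimately show ?thesis using assms linear_eq_on_span by blast
qed

text \<open>The sum runs over ordered pairs, so every \<open>i \<triangle> j\<close> with distinct
  \<open>i\<close> and \<open>j\<close> occurs twice; the division by 2 in
  \<open>sym_coord_prod\<close> accounts for this.\<close>

lemma sym_linear_expansion:
  fixes L :: "'e::finite_dim_banach sym_square \<Rightarrow> 'b::real_vector"
  assumes "linear L"
  shows "L s = (\<Sum>i\<in>coord_basis. \<Sum>j\<in>coord_basis. sym_coord i j s *\<^sub>R L (i \<triangle> j))"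
proof (rule sym_linear_eqI[OF assms])
  show "linear (\<lambda>s. \<Sum>i\<in>coord_basis. \<Sum>j\<in>coord_basis. sym_coord i j s *\<^sub>R L (i \<triangle> j))"
    by (rule linearI) (simp_all add: linear_add[OF linear_sym_coord] linear_cmul[OF linear_sym_coord]
        scaleR_add_left sum.distrib scaleR_sum_right)
  define T where "T y z = (\<Sum>i\<in>coord_basis. \<Sum>j\<in>coord_basis. (coord i y * coord j z) *\<^sub>R L (i \<triangle> j))"
    for y z :: 'e
  have T: "L (y \<triangle> z) = T y z" for y z
  proof -
    have "L (y \<triangle> z) = (\<Sum>i\<in>coord_basis. coord i y *\<^sub>R L (i \<triangle> z))"
      by (rule linear_expansion[OF linear_compose[OF linear_sym_prod assms, unfolded o_def]])
    also have "\<dots> = (\<Sum>i\<in>coord_basis. coord i y *\<^sub>R (\<Sum>j\<in>coord_basis. coord j z *\<^sub>R L (i \<triangle> j)))"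
      by (subst linear_expansion[OF linear_compose[OF linear_sym_prod_right assms, unfolded o_def]]) simp
    finally show ?thesis by (simp add: T_def scaleR_sum_right)
  qed
  fix y z :: 'e
  \<comment> \<open>The two halves of the symmetrised coefficient give \<open>T y z\<close> and
    \<open>T z y\<close>, which are values of \<open>L\<close> at the same element.\<close>
  have "(\<Sum>i\<in>coord_basis. \<Sum>j\<in>coord_basis. sym_coord i j (y \<triangle> z) *\<^sub>R L (i \<triangle> j))
      = (1/2) *\<^sub>R (T y z + T z y)"
    by (simp add: T_def sym_coord_prod add_divide_distrib scaleR_add_left sum.distrib scaleR_add_right
        scaleR_sum_right)
  also have "\<dots> = L (y \<triangle> z)"
    by (simp add: T[symmetric] sym_prod_commute[of z] flip: scaleR_2)
  finally show "L (y \<triangle> z) = (\<Sum>i\<in>coord_basis. \<Sum>j\<in>coord_basis. sym_coord i j (y \<triangle> z) *\<^sub>R L (i \<triangle> j))" ..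
qed

lemma sym_coord_eqI:
  assumes "\<And>i j. i \<in> coord_basis \<Longrightarrow> j \<in> coord_basis \<Longrightarrow> sym_coord i j s = sym_coord i j t"
  shows "s = t"
proof -
  have "s = (\<Sum>i\<in>coord_basis. \<Sum>j\<in>coord_basis. sym_coord i j s *\<^sub>R (i \<triangle> j))"
    by (rule sym_linear_expansion[OF linear_ident])
  also have "\<dots> = (\<Sum>i\<in>coord_basis. \<Sum>j\<in>coord_basis. sym_coord i j t *\<^sub>R (i \<triangle> j))"
    using assms by (intro sum.cong) auto
  also have "\<dots> = t" by (rule sym_linear_expansion[OF linear_ident, symmetric])
  finally show ?thesis .
qed

lemma bounded_bilinear_sym_prod: "bounded_bilinear (sym_prod :: 'e::real_normed_vector \<Rightarrow> _)"
proof
  fix a a' b b' :: 'e and r :: real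
  show "(a + a') \<triangle> b = a \<triangle> b + a' \<triangle> b" "(r *\<^sub>R a) \<triangle> b = r *\<^sub>R (a \<triangle> b)"
    by (simp_all add: linear_add[OF linear_sym_prod] linear_cmul[OF linear_sym_prod])
  show "a \<triangle> (b + b') = a \<triangle> b + a \<triangle> b'" "a \<triangle> (r *\<^sub>R b) = r *\<^sub>R (a \<triangle> b)"
    by (simp_all add: linear_add[OF linear_sym_prod_right] linear_cmul[OF linear_sym_prod_right])
  have "norm (y \<triangle> z) \<le> norm y * norm z * 1" for y z :: 'e
    unfolding norm_sym_square.rep_eq sym_prod.rep_eq
  proof (rule norm_blinfun_bound)
    fix B :: "'e \<Rightarrow>\<^sub>L 'e \<Rightarrow>\<^sub>L real"
    have *: "\<bar>B y z\<bar> \<le> norm B * norm y * norm z" for y z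
      using norm_blinfun[of "B y" z] norm_blinfun[of B y]
      by (smt (verit) mult_right_mono norm_ge_zero real_norm_def)
    show "norm (sym_dyad y z B) \<le> norm y * norm z * 1 * norm B"
      using *[of y z] *[of z y] by (simp add: sym_dyad_apply algebra_simps)
  qed simp
  then show "\<exists>K. \<forall>y z :: 'e. norm (y \<triangle> z) \<le> norm y * norm z * K" by blast
qed

context
  fixes \<beta> :: "'e::finite_dim_banach \<Rightarrow> 'e \<Rightarrow> 'b::real_vector"
  assumes lin: "\<And>z. linear (\<lambda>y. \<beta> y z)" and sym: "\<And>y z. \<beta> y z = \<beta> z y"
begin

lemma sym_ext_props: "linear (sym_ext \<beta>) \<and> (\<forall>y z. sym_ext \<beta> (y \<triangle> z) = \<beta> y z)"
  unfolding sym_ext_def by (rule theI'[OF sym_ext_unique_existence[OF lin sym]])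

lemma linear_sym_ext: "linear (sym_ext \<beta>)"
  using sym_ext_props by blast

lemma sym_ext_prod: "sym_ext \<beta> (y \<triangle> z) = \<beta> y z"
  using sym_ext_props by blast

lemma sym_ext_expansion:
  "sym_ext \<beta> s = (\<Sum>i\<in>coord_basis. \<Sum>j\<in>coord_basis. sym_coord i j s *\<^sub>R \<beta> i j)"
  by (subst sym_linear_expansion[OF linear_sym_ext]) (simp add: sym_ext_prod)

end


definition symL :: "'e::finite_dim_banach \<Rightarrow> 'e \<Rightarrow> 'e sym_square \<Rightarrow>\<^sub>L real"
  where "symL i j = Blinfun (sym_coord i j)"

lemma symL_apply [simp]: "blinfun_apply (symL i j) s = sym_coord i j s"
  by (simp add: symL_def bounded_linear_Blinfun_apply bounded_linear_sym_coord)

text \<open>Reassembles a trilinear map, symmetric in its last two arguments, from its values on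
  basis triples. Only these finitely many coefficients enter, so smooth dependence on a parameter
  can be checked on them.\<close>

definition mk_sym :: "('e::finite_dim_banach \<Rightarrow> 'e \<Rightarrow> 'e \<Rightarrow> 'b::real_normed_vector) \<Rightarrow> 'e \<Rightarrow>\<^sub>L 'e sym_square \<Rightarrow>\<^sub>L 'b"
  where "mk_sym \<beta> = (\<Sum>i\<in>coord_basis. \<Sum>j\<in>coord_basis. \<Sum>k\<in>coord_basis.
    tensor (coordL i) (tensor (symL j k) (\<beta> i j k)))"

definition mk_tri :: "('e::finite_dim_banach \<Rightarrow> 'e \<Rightarrow> 'e \<Rightarrow> real) \<Rightarrow> 'e \<Rightarrow>\<^sub>L 'e \<Rightarrow>\<^sub>L 'e \<Rightarrow>\<^sub>L real"
  where "mk_tri \<beta> = (\<Sum>i\<in>coord_basis. \<Sum>j\<in>coord_basis. \<Sum>k\<in>coord_basis.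
    tensor (coordL i) (tensor (coordL j) (tensor (coordL k) (\<beta> i j k))))"

lemma mk_sym_apply:
  assumes "\<And>y z. linear (\<lambda>x. \<beta> x y z)" "\<And>x z. linear (\<lambda>y. \<beta> x y z)" "\<And>x y z. \<beta> x y z = \<beta> x z y"
  shows "mk_sym \<beta> x (y \<triangle> z) = \<beta> x y z"
proof -
  have "mk_sym \<beta> x (y \<triangle> z) = (\<Sum>i\<in>coord_basis. coord i x *\<^sub>R sym_ext (\<beta> i) (y \<triangle> z))"
    by (simp add: mk_sym_def blinfun.sum_left blinfun.scaleR_left sym_ext_expansion[OF assms(2,3)]
        scaleR_sum_right)
  also have "\<dots> = \<beta> x y z"
    by (simp only: sym_ext_prod[OF assms(2,3)] linear_expansion[OF assms(1), symmetric])
  finally show ?thesis .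
qed

lemma mk_tri_apply:
  assumes "\<And>y z. linear (\<lambda>x. \<beta> x y z)" "\<And>x z. linear (\<lambda>y. \<beta> x y z)" "\<And>x y. linear (\<lambda>z. \<beta> x y z)"
  shows "mk_tri \<beta> x y z = \<beta> x y z"
proof -
  have "mk_tri \<beta> x y z = (\<Sum>i\<in>coord_basis. coord i x *\<^sub>R (\<Sum>j\<in>coord_basis. coord j y *\<^sub>R
      (\<Sum>k\<in>coord_basis. coord k z *\<^sub>R \<beta> i j k)))"
    by (simp add: mk_tri_def blinfun.sum_left blinfun.scaleR_left sum_distrib_left mult.assoc)
  then show ?thesis
    by (simp only: linear_expansion[OF assms(3), symmetric] linear_expansion[OF assms(2), symmetric]
        linear_expansion[OF assms(1), symmetric])
qed

lemma smooth_on_mk_sym: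
  assumes "open S" "\<And>i j k. smooth_on S (\<lambda>u. \<beta> u i j k)"
  shows "smooth_on S (\<lambda>u. mk_sym (\<beta> u))"
  unfolding mk_sym_def
  by (intro smooth_on_sum smooth_on_linear_compose[OF assms(1) bounded_linear_tensor] assms)

lemma smooth_on_mk_tri:
  assumes "open S" "\<And>i j k. smooth_on S (\<lambda>u. \<beta> u i j k)"
  shows "smooth_on S (\<lambda>u. mk_tri (\<beta> u))"
  unfolding mk_tri_def
  by (intro smooth_on_sum smooth_on_linear_compose[OF assms(1) bounded_linear_tensor] assms)

lemma smooth_on_blinfun_apply:
  "open S \<Longrightarrow> smooth_on S f \<Longrightarrow> smooth_on S g \<Longrightarrow> smooth_on S (\<lambda>u. blinfun_apply (f u) (g u))"
  by (rule smooth_on_bilinear[OF _ bounded_bilinear_blinfun_apply])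


section \<open>Second-order operators\<close>

definition op2 :: "('e::real_normed_vector \<Rightarrow> real) \<Rightarrow> 'e \<Rightarrow> 'e \<times> 'e sym_square \<Rightarrow> real"
  where "op2 g u a = D1 g u (fst a) + sym_ext (D2 g u) (snd a)"

text \<open>The second-order push-forward: \<open>t2_law\<close> says that representatives
  correspond under it, for \<open>F\<close> a transition map.\<close>

definition push2 :: "('e::real_normed_vector \<Rightarrow> 'e) \<Rightarrow> 'e \<Rightarrow> 'e \<times> 'e sym_square \<Rightarrow> 'e \<times> 'e sym_square"
  where "push2 F u a = (D1 F u (fst a) + sym_ext (D2 F u) (snd a),
    sym_ext (\<lambda>y z. D1 F u y \<triangle> D1 F u z) (snd a))"

lemma op2_cong: "eventually (\<lambda>w. f w = g w) (nhds u) \<Longrightarrow> op2 f u a = op2 g u a"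
  by (simp add: op2_def D1_cong[of f g u] D2_cong[of f g u])

context
  fixes f :: "'e::finite_dim_banach \<Rightarrow> 'b::finite_dim_banach" and S u
  assumes f: "smooth_on S f" and S: "open S" "u \<in> S"
begin

lemmas linear_sym_ext_D2 = linear_sym_ext[OF linear_D2_1[OF f S] D2_sym[OF f S]]
lemmas sym_ext_D2_prod = sym_ext_prod[OF linear_D2_1[OF f S] D2_sym[OF f S]]
lemmas sym_ext_D2_expansion = sym_ext_expansion[OF linear_D2_1[OF f S] D2_sym[OF f S]]
lemmas linear_sym_ext_D3 = linear_sym_ext[OF linear_D3_2[OF f S] D3_sym[OF f S]]
lemmas sym_ext_D3_prod = sym_ext_prod[OF linear_D3_2[OF f S] D3_sym[OF f S]]
lemmas sym_ext_D3_expansion = sym_ext_expansion[OF linear_D3_2[OF f S] D3_sym[OF f S]]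
lemmas linear_D1_smooth = D1_linear[OF smooth_on_differentiable[OF f S(2)]]

end

lemma smooth_on_sym_ext_D2:
  fixes f :: "'e::finite_dim_banach \<Rightarrow> 'b::finite_dim_banach"
  assumes f: "smooth_on S f" and S: "open S" and s: "smooth_on S s"
  shows "smooth_on S (\<lambda>u. sym_ext (D2 f u) (s u))"
proof -
  have "smooth_on S (\<lambda>u. \<Sum>i\<in>coord_basis. \<Sum>j\<in>coord_basis. sym_coord i j (s u) *\<^sub>R D2 f u i j)"
    by (intro smooth_on_sum smooth_on_scaleR smooth_on_D2 f S
        smooth_on_linear_compose[OF S bounded_linear_sym_coord] s)
  from S this show ?thesis by (rule smooth_on_transform) (rule sym_ext_D2_expansion[OF f S])
qed

lemma linear_push_sym: "linear A \<Longrightarrow> linear (\<lambda>y. A y \<triangle> A z)"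
  using linear_compose[OF _ linear_sym_prod, of A] by (simp add: o_def)

lemma sym_ext_push_prod:
  fixes A :: "'e::finite_dim_banach \<Rightarrow> 'd::real_normed_vector"
  shows "linear A \<Longrightarrow> sym_ext (\<lambda>y z. A y \<triangle> A z) (y \<triangle> z) = A y \<triangle> A z"
  by (rule sym_ext_prod) (auto intro: linear_push_sym sym_prod_commute)

lemma linear_sym_ext_push:
  fixes A :: "'e::finite_dim_banach \<Rightarrow> 'd::real_normed_vector"
  shows "linear A \<Longrightarrow> linear (sym_ext (\<lambda>y z. A y \<triangle> A z))"
  by (rule linear_sym_ext) (auto intro: linear_push_sym sym_prod_commute)

lemma smooth_on_push2:
  fixes F :: "'e::finite_dim_banach \<Rightarrow> 'e"
  assumes F: "smooth_on S F" and S: "open S" and a: "smooth_on S a"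
  shows "smooth_on S (\<lambda>u. push2 F u (a u))"
proof -
  have lin: "linear (D1 F u)" if "u \<in> S" for u by (rule linear_D1_smooth[OF F S that])
  have eq: "sym_ext (\<lambda>y z. D1 F u y \<triangle> D1 F u z) (snd (a u)) =
      (\<Sum>i\<in>coord_basis. \<Sum>j\<in>coord_basis. sym_coord i j (snd (a u)) *\<^sub>R (D1 F u i \<triangle> D1 F u j))"
    if "u \<in> S" for u
    by (rule sym_ext_expansion) (auto intro: linear_push_sym lin that sym_prod_commute)
  have "smooth_on S (\<lambda>u. \<Sum>i\<in>coord_basis. \<Sum>j\<in>coord_basis.
      sym_coord i j (snd (a u)) *\<^sub>R (D1 F u i \<triangle> D1 F u j))"
    by (intro smooth_on_sum smooth_on_scaleR smooth_on_D1 F S smooth_on_snd a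
        smooth_on_linear_compose[OF S bounded_linear_sym_coord]
        smooth_on_bilinear[OF S bounded_bilinear_sym_prod])
  from S this have "smooth_on S (\<lambda>u. sym_ext (\<lambda>y z. D1 F u y \<triangle> D1 F u z) (snd (a u)))"
    by (rule smooth_on_transform) (rule eq)
  then show ?thesis
    unfolding push2_def
    by (intro smooth_on_Pair smooth_on_add smooth_on_D1_apply smooth_on_sym_ext_D2 S F
        smooth_on_fst smooth_on_snd a)
qed

lemma linear_op2:
  assumes "smooth_on S (f :: 'e::finite_dim_banach \<Rightarrow> real)" "open S" "u \<in> S"
  shows "linear (op2 f u)"
  unfolding op2_def
  by (rule linearI) (simp_all add: linear_add[OF linear_D1_smooth[OF assms]] algebra_simps
      linear_cmul[OF linear_D1_smooth[OF assms]] linear_add[OF linear_sym_ext_D2[OF assms]]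
      linear_cmul[OF linear_sym_ext_D2[OF assms]])

lemma op2_fst_snd:
  assumes "smooth_on S (f :: 'e::finite_dim_banach \<Rightarrow> real)" "open S" "u \<in> S"
  shows "op2 f u (v, 0) = D1 f u v" "op2 f u (0, y \<triangle> z) = D2 f u y z"
  using linear_0[OF linear_D1_smooth[OF assms]] linear_0[OF linear_sym_ext_D2[OF assms]]
  by (simp_all add: op2_def sym_ext_D2_prod[OF assms])

text \<open>Expanding the first derivative as a sum of terms
  \<open>coord b (D1 F w z) *\<^sub>R D1 g (F w) b\<close> freezes the direction in which
  \<open>g\<close> is differentiated. The Leibniz rule then yields one term with \<open>D2 g\<close>
  and one with \<open>D2 F\<close>, and the expansions are collected again.\<close>

lemma D2_compose:
  fixes F :: "'e::finite_dim_banach \<Rightarrow> 'd::finite_dim_banach" and g :: "'d \<Rightarrow> real"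
  assumes F: "smooth_on S F" and S: "open S" "u \<in> S" and g: "smooth_on T g" "open T" "F ` S \<subseteq> T"
  shows "D2 (\<lambda>x. g (F x)) u y z = D2 g (F u) (D1 F u y) (D1 F u z) + D1 g (F u) (D2 F u y z)"
proof -
  have Fu: "F w \<in> T" if "w \<in> S" for w using that g(3) by blast
  have dF: "F differentiable (at w)" if "w \<in> S" for w using smooth_on_differentiable[OF F that] .
  have dDF: "(\<lambda>w. D1 F w z) differentiable (at u)" for z
    using smooth_on_differentiable[OF smooth_on_D1[OF F] S(2)] .
  have dg: "g differentiable (at (F w))" if "w \<in> S" for w
    using smooth_on_differentiable[OF g(1) Fu[OF that]] .
  have dDg: "(\<lambda>w. D1 g w b) differentiable (at (F u))" for b
    using smooth_on_differentiable[OF smooth_on_D1[OF g(1)] Fu[OF S(2)]] .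
  have dc: "(\<lambda>w. coord b (D1 F w z)) differentiable (at u)" for b
    using smooth_on_differentiable[OF smooth_on_coord[OF S(1) smooth_on_D1[OF F]] S(2)] .
  have dDgF: "(\<lambda>w. D1 g (F w) b) differentiable (at u)" for b
    using smooth_on_differentiable[OF smooth_on_compose[OF S(1) g(2) F smooth_on_D1[OF g(1)] g(3)] S(2)] .
  have "D1 (\<lambda>w. D1 (\<lambda>x. g (F x)) w z) u = D1 (\<lambda>w. \<Sum>b\<in>coord_basis. coord b (D1 F w z) *\<^sub>R D1 g (F w) b) u"
  proof (intro D1_cong eventually_nhds_open[OF S])
    fix w assume w: "w \<in> S"
    show "D1 (\<lambda>x. g (F x)) w z = (\<Sum>b\<in>coord_basis. coord b (D1 F w z) *\<^sub>R D1 g (F w) b)"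
      unfolding D1_compose[OF dF[OF w] dg[OF w]]
      by (rule linear_expansion[OF linear_D1_smooth[OF g(1,2) Fu[OF w]]])
  qed
  then have "D2 (\<lambda>x. g (F x)) u y z =
      (\<Sum>b\<in>coord_basis. D1 (\<lambda>w. coord b (D1 F w z) *\<^sub>R D1 g (F w) b) u y)"
    using differentiable_scaleR[OF dc dDgF] by (simp add: D2_def D1_sum)
  also have "\<dots> = (\<Sum>b\<in>coord_basis. coord b (D1 F u z) *\<^sub>R D2 g (F u) (D1 F u y) b
      + coord b (D2 F u y z) *\<^sub>R D1 g (F u) b)"
    unfolding D1_scaleR[OF dc dDgF] D1_linear_compose[OF bounded_linear_coord dDF] D2_def[symmetric]
      D1_compose[OF dF[OF S(2)] dDg] ..
  also have "\<dots> = D2 g (F u) (D1 F u y) (D1 F u z) + D1 g (F u) (D2 F u y z)"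
    unfolding sum.distrib linear_expansion[OF linear_D2_2[OF g(1,2) Fu[OF S(2)]], symmetric]
      linear_expansion[OF linear_D1_smooth[OF g(1,2) Fu[OF S(2)]], symmetric] ..
  finally show ?thesis .
qed

text \<open>The law of the second-order bundle is made for this identity: the two terms of the
  second-order chain rule are \<open>D1 g\<close> on the \<open>D2 F\<close> part of
  \<open>push2\<close> and \<open>D2 g\<close> on its symmetric part. By linearity it is enough to
  compare them on elements \<open>y \<triangle> z\<close>.\<close>

lemma op2_compose:
  fixes F :: "'e::finite_dim_banach \<Rightarrow> 'e" and g :: "'e \<Rightarrow> real"
  assumes F: "smooth_on S F" and S: "open S" "u \<in> S" and g: "smooth_on T g" "open T" "F ` S \<subseteq> T"
  shows "op2 (\<lambda>x. g (F x)) u a = op2 g (F u) (push2 F u a)"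
proof -
  have Fu: "F u \<in> T" using S(2) g(3) by blast
  have gF: "smooth_on S (\<lambda>x. g (F x))" by (rule smooth_on_compose[OF S(1) g(2) F g(1,3)])
  have D1: "D1 (\<lambda>x. g (F x)) u v = D1 g (F u) (D1 F u v)" for v
    by (rule D1_compose[OF smooth_on_differentiable[OF F S(2)] smooth_on_differentiable[OF g(1) Fu]])
  have lin: "linear (D1 F u)" "linear (D1 g (F u))"
    by (rule linear_D1_smooth[OF F S] linear_D1_smooth[OF g(1,2) Fu])+
  have "sym_ext (D2 (\<lambda>x. g (F x)) u) s = D1 g (F u) (sym_ext (D2 F u) s)
      + sym_ext (D2 g (F u)) (sym_ext (\<lambda>y z. D1 F u y \<triangle> D1 F u z) s)" for s
  proof (rule sym_linear_eqI[OF linear_sym_ext_D2[OF gF S]])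
    show "linear (\<lambda>s. D1 g (F u) (sym_ext (D2 F u) s)
      + sym_ext (D2 g (F u)) (sym_ext (\<lambda>y z. D1 F u y \<triangle> D1 F u z) s))"
      by (rule linear_compose_add[OF linear_compose[OF linear_sym_ext_D2[OF F S] lin(2), unfolded o_def]
            linear_compose[OF linear_sym_ext_push[OF lin(1)] linear_sym_ext_D2[OF g(1,2) Fu], unfolded o_def]])
    show "sym_ext (D2 (\<lambda>x. g (F x)) u) (y \<triangle> z) = D1 g (F u) (sym_ext (D2 F u) (y \<triangle> z))
      + sym_ext (D2 g (F u)) (sym_ext (\<lambda>y z. D1 F u y \<triangle> D1 F u z) (y \<triangle> z))" for y z
      unfolding sym_ext_D2_prod[OF gF S] sym_ext_D2_prod[OF F S] sym_ext_push_prod[OF lin(1)]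
        sym_ext_D2_prod[OF g(1,2) Fu] D2_compose[OF F S g] by simp
  qed
  then show ?thesis by (simp add: op2_def push2_def D1 linear_add[OF lin(2)])
qed

lemma op2_expansion:
  fixes g :: "'e::finite_dim_banach \<Rightarrow> real"
  assumes "smooth_on S g" "open S" "w \<in> S"
  shows "op2 g w a = (\<Sum>b\<in>coord_basis. coord b (fst a) *\<^sub>R D1 g w b)
    + (\<Sum>i\<in>coord_basis. \<Sum>j\<in>coord_basis. sym_coord i j (snd a) *\<^sub>R D2 g w i j)"
  unfolding op2_def
  by (rule arg_cong2[of _ _ _ _ "(+)", OF linear_expansion[OF linear_D1_smooth[OF assms]]
        sym_ext_D2_expansion[OF assms]])

lemma smooth_on_op2:
  fixes g :: "'e::finite_dim_banach \<Rightarrow> real"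
  assumes "smooth_on S g" "open S" "smooth_on S \<tau>"
  shows "smooth_on S (\<lambda>w. op2 g w (\<tau> w))"
  unfolding op2_def
  by (intro smooth_on_add smooth_on_D1_apply smooth_on_sym_ext_D2 smooth_on_fst smooth_on_snd assms)

text \<open>The coordinate form of \<open>X \<cdot> (\<tau> \<cdot> g) = Kg(X, \<tau>) + (\<nabla>\<^sub>X \<tau>) \<cdot> g\<close>.\<close>

lemma D1_op2:
  fixes g :: "'e::finite_dim_banach \<Rightarrow> real"
  assumes g: "smooth_on S g" and S: "open S" "u \<in> S" and \<tau>: "smooth_on S \<tau>"
  shows "D1 (\<lambda>w. op2 g w (\<tau> w)) u x =
    sym_ext (D3 g u x) (snd (\<tau> u)) + op2 g u (D1 \<tau> u x + (0, x \<triangle> fst (\<tau> u)))"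
proof -
  have d\<tau>: "\<tau> differentiable (at u)" by (rule smooth_on_differentiable[OF \<tau> S(2)])
  have L1: "bounded_linear (\<lambda>a. coord b (fst a))" for b :: 'e
    by (rule bounded_linear_compose[OF bounded_linear_coord bounded_linear_fst])
  have L2: "bounded_linear (\<lambda>a. sym_coord i j (snd a))" for i j :: 'e
    by (rule bounded_linear_compose[OF bounded_linear_sym_coord bounded_linear_snd])
  have dL: "(\<lambda>w. L (\<tau> w)) differentiable (at u)" if "bounded_linear L" for L :: "_ \<Rightarrow> real"
    by (rule smooth_on_differentiable[OF smooth_on_linear_compose[OF S(1) that \<tau>] S(2)])
  have dD1: "(\<lambda>w. D1 g w b) differentiable (at u)" for b
    by (rule smooth_on_differentiable[OF smooth_on_D1[OF g] S(2)])
  have dD2: "(\<lambda>w. D2 g w i j) differentiable (at u)" for i j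
    by (rule smooth_on_differentiable[OF smooth_on_D2[OF g] S(2)])
  have dA: "(\<lambda>w. coord b (fst (\<tau> w)) *\<^sub>R D1 g w b) differentiable (at u)" for b
    by (intro differentiable_scaleR dL L1 dD1)
  have dB: "(\<lambda>w. sym_coord i j (snd (\<tau> w)) *\<^sub>R D2 g w i j) differentiable (at u)" for i j
    by (intro differentiable_scaleR dL L2 dD2)
  \<comment> \<open>In this expansion \<open>\<tau>\<close> enters through scalar coefficients only,
    and the other factors are partial derivatives of \<open>g\<close>, so the product rule applies
    termwise.\<close>
  have "D1 (\<lambda>w. op2 g w (\<tau> w)) u = D1 (\<lambda>w. (\<Sum>b\<in>coord_basis. coord b (fst (\<tau> w)) *\<^sub>R D1 g w b)
    + (\<Sum>i\<in>coord_basis. \<Sum>j\<in>coord_basis. sym_coord i j (snd (\<tau> w)) *\<^sub>R D2 g w i j)) u"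
    by (intro D1_cong eventually_nhds_open[OF S] op2_expansion[OF g S(1)])
  then have "D1 (\<lambda>w. op2 g w (\<tau> w)) u x =
      (\<Sum>b\<in>coord_basis. D1 (\<lambda>w. coord b (fst (\<tau> w)) *\<^sub>R D1 g w b) u x) +
      (\<Sum>i\<in>coord_basis. \<Sum>j\<in>coord_basis. D1 (\<lambda>w. sym_coord i j (snd (\<tau> w)) *\<^sub>R D2 g w i j) u x)"
    using dA dB by (simp add: D1_add D1_sum coord_basis(1))
  also have "\<dots> =
      (\<Sum>b\<in>coord_basis. coord b (fst (\<tau> u)) *\<^sub>R D2 g u x b + coord b (fst (D1 \<tau> u x)) *\<^sub>R D1 g u b) +
      (\<Sum>i\<in>coord_basis. \<Sum>j\<in>coord_basis. sym_coord i j (snd (\<tau> u)) *\<^sub>R D3 g u x i j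
        + sym_coord i j (snd (D1 \<tau> u x)) *\<^sub>R D2 g u i j)"
    unfolding D1_scaleR[OF dL[OF L1] dD1] D1_scaleR[OF dL[OF L2] dD2] D1_linear_compose[OF L1 d\<tau>]
      D1_linear_compose[OF L2 d\<tau>] D2_def[symmetric] D3_def[symmetric] ..
  also have "\<dots> = D2 g u x (fst (\<tau> u)) + sym_ext (D3 g u x) (snd (\<tau> u)) + op2 g u (D1 \<tau> u x)"
    unfolding sum.distrib op2_expansion[OF g S] linear_expansion[OF linear_D2_2[OF g S], symmetric]
      sym_ext_D3_expansion[OF g S] by simp
  also have "D2 g u x (fst (\<tau> u)) = op2 g u (0, x \<triangle> fst (\<tau> u))"
    using op2_fst_snd(2)[OF g S] by simp
  finally show ?thesis by (simp add: linear_add[OF linear_op2[OF g S]])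
qed


subsection \<open>Linearity in the function\<close>

lemma D2_add:
  assumes f: "smooth_on S f" "smooth_on S g" and S: "open S" "u \<in> S"
  shows "D2 (\<lambda>x. f x + g x) u y z = D2 f u y z + D2 g u y z"
proof -
  have "D1 (\<lambda>w. D1 (\<lambda>x. f x + g x) w z) u = D1 (\<lambda>w. D1 f w z + D1 g w z) u"
    by (intro D1_cong eventually_nhds_open[OF S] D1_add f[THEN smooth_on_differentiable])
  then show ?thesis
    by (simp add: D2_def D1_add smooth_on_differentiable[OF _ S(2)] smooth_on_D1 f)
qed

lemma D3_add:
  assumes f: "smooth_on S f" "smooth_on S g" and S: "open S" "u \<in> S"
  shows "D3 (\<lambda>x. f x + g x) u x y z = D3 f u x y z + D3 g u x y z"
proof -
  have "D1 (\<lambda>w. D2 (\<lambda>x. f x + g x) w y z) u = D1 (\<lambda>w. D2 f w y z + D2 g w y z) u"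
    by (intro D1_cong eventually_nhds_open[OF S] D2_add[OF f S(1)])
  then show ?thesis
    by (simp add: D3_def D1_add smooth_on_differentiable[OF _ S(2)] smooth_on_D2 f)
qed

lemma D3_linear_compose:
  assumes L: "bounded_linear L" and f: "smooth_on S f" and S: "open S" "u \<in> S"
  shows "D3 (\<lambda>x. L (f x)) u x y z = L (D3 f u x y z)"
proof -
  have "D1 (\<lambda>w. D2 (\<lambda>x. L (f x)) w y z) u = D1 (\<lambda>w. L (D2 f w y z)) u"
    by (intro D1_cong eventually_nhds_open[OF S] D2_linear_compose[OF L f S(1)])
  then show ?thesis
    using D1_linear_compose[OF L smooth_on_differentiable[OF smooth_on_D2[OF f] S(2)]]
    by (simp add: D3_def)
qed

text \<open>The asserted value of \<open>K g(x, y, z)\<close>, with \<open>a = R \<oplus> C\<close>.\<close>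

definition op3 :: "('e::real_normed_vector \<Rightarrow> real) \<Rightarrow> 'e \<Rightarrow> 'e \<Rightarrow> 'e \<Rightarrow> 'e \<Rightarrow> 'e \<times> 'e sym_square \<Rightarrow> real"
  where "op3 g u x y z a = D3 g u x y z + op2 g u a"

lemma op3_cong: "eventually (\<lambda>w. f w = g w) (nhds u) \<Longrightarrow> op3 f u x y z a = op3 g u x y z a"
  by (simp add: op3_def D3_cong[of f g u] op2_cong[of f g u])

context
  fixes S :: "'e::finite_dim_banach set" and u
  assumes S: "open S" "u \<in> S"
begin

lemma op3_add:
  assumes f: "smooth_on S f" "smooth_on S g"
  shows "op3 (\<lambda>x. f x + g x) u x y z a = op3 f u x y z a + op3 g u x y z a"
  using D1_add[OF f[THEN smooth_on_differentiable, OF S(2)]] D2_add[OF f S] D3_add[OF f S]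
  by (simp add: op3_def op2_expansion[OF _ S] f smooth_on_add[OF S(1)] scaleR_add_right sum.distrib
      distrib_left)

lemma op3_scale:
  assumes f: "smooth_on S f"
  shows "op3 (\<lambda>x. c * f x) u x y z a = c * op3 f u x y z a"
proof -
  have L: "bounded_linear ((*) c)" by (rule bounded_linear_mult_right)
  show ?thesis
    using D1_linear_compose[OF L smooth_on_differentiable[OF f S(2)]] D2_linear_compose[OF L f S]
      D3_linear_compose[OF L f S]
    by (simp add: op3_def op2_expansion[OF _ S] f smooth_on_linear_compose[OF S(1) L] sum_distrib_left
        algebra_simps)
qed

lemma op3_const: "op3 (\<lambda>_. c) u x y z a = 0"
proof -
  have "D2 (\<lambda>_::'e. c) w y z = 0" for w y z by (simp add: D2_def)
  then show ?thesis
    by (simp add: op3_def op2_expansion[OF smooth_on_const S] D3_def)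
qed

lemma op3_sum:
  assumes "finite I" "\<And>i. i \<in> I \<Longrightarrow> smooth_on S (f i)"
  shows "op3 (\<lambda>x. \<Sum>i\<in>I. f i x) u x y z a = (\<Sum>i\<in>I. op3 (f i) u x y z a)"
  using assms by (induction I rule: finite_induct) (auto simp: op3_const op3_add smooth_on_sum S)

end

lemma D1_coord_affine: "D1 (\<lambda>w. coord b w - c) u = coord b"
  by (rule D1_eqI) (auto intro!: derivative_eq_intros bounded_linear_imp_has_derivative bounded_linear_coord)

lemma D3_coord: "D3 (\<lambda>w. coord b w - c) u x y z = 0"
  by (simp add: D3_def D2_def D1_coord_affine)

lemma op2_coord: "op2 (\<lambda>w. coord b w - c) u a = coord b (fst a)"
proof -
  have s: "smooth_on UNIV (\<lambda>w. coord b w - c)"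
    by (intro smooth_on_diff smooth_on_const smooth_on_bounded_linear bounded_linear_coord open_UNIV)
  have D2: "D2 (\<lambda>w. coord b w - c) u y z = 0" for u y z by (simp add: D2_def D1_coord_affine)
  show ?thesis
    unfolding op2_expansion[OF s open_UNIV UNIV_I] D2 D1_coord_affine
    using linear_expansion[OF linear_coord, of b "fst a"] by simp
qed

context
  fixes i j :: "'e::finite_dim_banach" and c d :: real
begin

lemma smooth_on_coord_affine: "smooth_on S (\<lambda>w. coord i w - c)"
  by (rule smooth_on_subset[OF smooth_on_diff[OF open_UNIV smooth_on_bounded_linear[OF bounded_linear_coord]
      smooth_on_const]]) simp

lemma D1_coord_mult:
  "D1 (\<lambda>w. (coord i w - c) * (coord j w - d)) w v
    = (coord i w - c) * coord j v + (coord j w - d) * coord i v"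
proof -
  have d: "(\<lambda>w. coord b w - c) differentiable (at u)" for b u :: 'e and c
    by (intro differentiable_diff differentiable_const bounded_linear_imp_differentiable
        bounded_linear_coord)
  show ?thesis unfolding D1_mult[OF d d] D1_coord_affine by simp
qed

lemma D2_coord_mult:
  "D2 (\<lambda>w. (coord i w - c) * (coord j w - d)) w y z = coord i y * coord j z + coord j y * coord i z"
proof -
  have "D1 (\<lambda>w. (coord i w - c) * coord j z + (coord j w - d) * coord i z) w
      = (\<lambda>y. coord i y * coord j z + coord j y * coord i z)"
    by (rule D1_eqI)
      (auto intro!: derivative_eq_intros bounded_linear_imp_has_derivative bounded_linear_coord)
  then show ?thesis by (simp add: D2_def D1_coord_mult)
qed

lemma D3_coord_mult: "D3 (\<lambda>w. (coord i w - c) * (coord j w - d)) u x y z = 0"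
  by (simp add: D3_def D2_coord_mult)

end

text \<open>The second derivative of the product is twice the average that gives
  \<open>sym_coord i j (y \<triangle> z)\<close>. This factor 2 is the reason for the divisions by 2
  in Taylor polynomials and in the coefficients of \<open>C\<close>.\<close>

lemma op2_coord_mult:
  "op2 (\<lambda>w. (coord i w - c) * (coord j w - d)) u a
    = (coord i u - c) * coord j (fst a) + (coord j u - d) * coord i (fst a) + 2 * sym_coord i j (snd a)"
proof -
  have sq: "smooth_on UNIV (\<lambda>w. (coord i w - c) * (coord j w - d))"
    by (intro smooth_on_mult smooth_on_coord_affine open_UNIV)
  have "sym_ext (D2 (\<lambda>w. (coord i w - c) * (coord j w - d)) u) s = 2 * sym_coord i j s" for s
  proof (rule sym_linear_eqI[OF linear_sym_ext_D2[OF sq open_UNIV UNIV_I]])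
    show "linear (\<lambda>s. 2 * sym_coord i j s)"
      by (rule linearI)
        (simp_all add: linear_add[OF linear_sym_coord] linear_cmul[OF linear_sym_coord] algebra_simps)
    show "sym_ext (D2 (\<lambda>w. (coord i w - c) * (coord j w - d)) u) (y \<triangle> z) = 2 * sym_coord i j (y \<triangle> z)"
      for y z
      unfolding sym_ext_D2_prod[OF sq open_UNIV UNIV_I] D2_coord_mult sym_coord_prod
      by (simp add: algebra_simps)
  qed
  then show ?thesis by (simp add: op2_def D1_coord_mult)
qed

text \<open>Coordinates see only the tangent part. Products of coordinates centred at
  \<open>u\<close> have vanishing differential there, so they see only the symmetric part.\<close>

lemma op2_separates:
  assumes "\<And>b. op2 (\<lambda>w. coord b w - coord b u) u a = op2 (\<lambda>w. coord b w - coord b u) u a'"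
    "\<And>i j. op2 (\<lambda>w. (coord i w - coord i u) * (coord j w - coord j u)) u a
      = op2 (\<lambda>w. (coord i w - coord i u) * (coord j w - coord j u)) u a'"
  shows "a = a'"
proof -
  have "fst a = fst a'" by (rule coord_eqI) (use assms(1) in \<open>simp add: op2_coord\<close>)
  moreover have "snd a = snd a'" by (rule sym_coord_eqI) (use assms(2) in \<open>simp add: op2_coord_mult\<close>)
  ultimately show ?thesis by (simp add: prod_eq_iff)
qed


subsection \<open>Functions with vanishing two-jet\<close>

definition flat2 :: "('e::real_normed_vector \<Rightarrow> real) \<Rightarrow> 'e \<Rightarrow> bool"
  where "flat2 f u \<longleftrightarrow> f u = 0 \<and> (\<forall>v. D1 f u v = 0) \<and> (\<forall>y z. D2 f u y z = 0)"

lemma flat2_cong: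
  assumes "eventually (\<lambda>w. f w = g w) (nhds u)"
  shows "flat2 f u \<longleftrightarrow> flat2 g u"
  using D1_cong[OF assms] D2_cong[OF assms] eventually_nhds_x_imp_x[OF assms] by (simp add: flat2_def)

lemma flat2_op2:
  assumes "smooth_on S (f :: 'e::finite_dim_banach \<Rightarrow> real)" "open S" "u \<in> S" "flat2 f u"
  shows "op2 f u a = 0"
  using assms(4) by (simp add: op2_expansion[OF assms(1-3)] flat2_def)

lemma flat2I:
  assumes "smooth_on S (f :: 'e::finite_dim_banach \<Rightarrow> real)" "open S" "u \<in> S" "f u = 0" "\<And>a. op2 f u a = 0"
  shows "flat2 f u"
  using op2_fst_snd[OF assms(1-3)] assms(4,5) by (simp add: flat2_def)

lemma flat2_sum:
  assumes "\<And>i. i \<in> I \<Longrightarrow> smooth_on S (f i)" "\<And>i. i \<in> I \<Longrightarrow> flat2 (f i) u" "finite I"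
    and S: "open S" "u \<in> S"
  shows "flat2 (\<lambda>x. \<Sum>i\<in>I. f i x) u"
  using assms(3,1,2)
proof (induction I rule: finite_induct)
  case empty
  show ?case by (simp add: flat2_def D2_def)
next
  case (insert i I)
  have s: "smooth_on S (f i)" "smooth_on S (\<lambda>x. \<Sum>i\<in>I. f i x)"
    using insert.prems by (auto intro!: smooth_on_sum S)
  have fl: "flat2 (f i) u" "flat2 (\<lambda>x. \<Sum>i\<in>I. f i x) u" using insert by auto
  have "(\<lambda>x. \<Sum>i\<in>insert i I. f i x) = (\<lambda>x. f i x + (\<Sum>i\<in>I. f i x))"
    using insert.hyps by simp
  then show ?case
    using fl D1_add[OF s[THEN smooth_on_differentiable, OF S(2)]] D2_add[OF s S]
    by (simp add: flat2_def)
qed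

text \<open>With the product grouped as \<open>p * g\<close>, every term of the Leibniz expansion up
  to order two contains \<open>p\<close>, \<open>g\<close> or \<open>D1 g\<close> at
  \<open>u\<close>. All three vanish, the last because both factors of \<open>g\<close> do.\<close>

lemma flat2_product:
  fixes p q r :: "'e::finite_dim_banach \<Rightarrow> real"
  assumes s: "smooth_on S p" "smooth_on S q" "smooth_on S r" and S: "open S" "u \<in> S"
    and z: "p u = 0" "q u = 0" "r u = 0"
  shows "flat2 (\<lambda>x. p x * q x * r x) u"
proof -
  define g where "g = (\<lambda>x. q x * r x)"
  have sg: "smooth_on S g" unfolding g_def by (intro smooth_on_mult s S)
  have d: "f differentiable (at w)" if "smooth_on S f" "w \<in> S" for f :: "'e \<Rightarrow> real" and w
    using that by (rule smooth_on_differentiable)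
  have D1g: "D1 g u v = 0" for v
    unfolding g_def D1_mult[OF d[OF s(2) S(2)] d[OF s(3) S(2)]] z by simp
  have D1: "D1 (\<lambda>x. p x * g x) w v = p w * D1 g w v + D1 p w v * g w" if "w \<in> S" for w v
    by (rule D1_mult[OF d[OF s(1) that] d[OF sg that]])
  have "D1 (\<lambda>w. D1 (\<lambda>x. p x * g x) w v) u = D1 (\<lambda>w. p w * D1 g w v + D1 p w v * g w) u" for v
    by (intro D1_cong eventually_nhds_open[OF S] D1)
  then have "D2 (\<lambda>x. p x * g x) u y v =
      p u * D2 g u y v + D1 p u y * D1 g u v + (D1 p u v * D1 g u y + D2 p u y v * g u)" for y v
    by (simp add: D2_def D1_add D1_mult d[OF _ S(2)] smooth_on_D1 smooth_on_mult s sg S)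
  then have "flat2 (\<lambda>x. p x * g x) u"
    using D1[OF S(2)] D1g z by (simp add: flat2_def g_def)
  then show ?thesis by (simp add: g_def mult.assoc)
qed


section \<open>Hadamard's lemma\<close>

lemma ray_mem_ball:
  fixes u x :: "'a::real_normed_vector"
  assumes "x \<in> ball u r" "t \<in> {0..1}"
  shows "u + t *\<^sub>R (x - u) \<in> ball u r"
proof -
  have "t * norm (x - u) \<le> 1 * norm (x - u)" using assms(2) by (intro mult_right_mono) auto
  then show ?thesis using assms by (simp add: dist_norm norm_minus_commute)
qed

text \<open>Differentiation under the integral sign. The inner derivative along the ray contributes
  a factor \<open>t\<close>, so the exponent of the weight goes up by one while \<open>f\<close> is
  replaced by a directional derivative.\<close>

lemma ray_integral_has_derivative:
  fixes f :: "'e::finite_dim_banach \<Rightarrow> real"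
  assumes f: "smooth_on (ball u r) f" and x: "x \<in> ball u r"
  shows "((\<lambda>x. integral {0..1} (\<lambda>t. t ^ n * f (u + t *\<^sub>R (x - u)))) has_derivative
    (\<lambda>v. integral {0..1} (\<lambda>t. t ^ Suc n * D1 f (u + t *\<^sub>R (x - u)) v))) (at x)"
proof -
  define G where "G x t = t ^ n * f (u + t *\<^sub>R (x - u))" for x and t :: real
  \<comment> \<open>The derivative in \<open>x\<close>, packaged through basis coefficients as a
    bounded linear map, since the Leibniz rule for integrals asks for joint continuity in that
    space.\<close>
  define G' :: "'e \<Rightarrow> real \<Rightarrow> 'e \<Rightarrow>\<^sub>L real" where
    "G' x t = (\<Sum>b\<in>coord_basis. tensor (coordL b) (t ^ Suc n * D1 f (u + t *\<^sub>R (x - u)) b))" for x t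
  have lin: "linear (D1 f (u + t *\<^sub>R (x - u)))" if "x \<in> ball u r" "t \<in> {0..1}" for x t
    by (rule linear_D1_smooth[OF f open_ball ray_mem_ball[OF that]])
  have G': "blinfun_apply (G' x t) v = t ^ Suc n * D1 f (u + t *\<^sub>R (x - u)) v"
    if "x \<in> ball u r" "t \<in> {0..1}" for x t v
  proof -
    have "blinfun_apply (G' x t) v =
        t ^ Suc n * (\<Sum>b\<in>coord_basis. coord b v *\<^sub>R D1 f (u + t *\<^sub>R (x - u)) b)"
      by (simp add: G'_def blinfun.sum_left sum_distrib_left mult_ac)
    then show ?thesis by (simp only: linear_expansion[OF lin[OF that], symmetric])
  qed
  have ray: "continuous_on T (\<lambda>p. u + snd p *\<^sub>R (fst p - u))" for T :: "('e \<times> real) set"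
    by (intro continuous_intros)
  have comp: "continuous_on (ball u r \<times> {0..1}) (\<lambda>p. g (u + snd p *\<^sub>R (fst p - u)))"
    if "continuous_on (ball u r) g" for g :: "'e \<Rightarrow> real"
    by (rule continuous_on_compose2[OF that ray]) (auto simp del: mem_ball atLeastAtMost_iff intro!: ray_mem_ball)
  have contG': "continuous_on (ball u r \<times> {0..1}) (\<lambda>(x, t). G' x t)"
    unfolding split_beta G'_def
    by (intro continuous_on_sum bounded_linear.continuous_on[OF bounded_linear_tensor]
        continuous_on_mult continuous_on_power continuous_on_snd continuous_on_id
        comp smooth_on_continuous_on smooth_on_D1 f)
  have sl: "continuous_on {0..1} (H y)" if "continuous_on (ball u r \<times> {0..1}) (\<lambda>(x, t). H x t)" "y \<in> ball u r"
    for H :: "'e \<Rightarrow> real \<Rightarrow> 'c::real_normed_vector" and y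
  proof -
    have "continuous_on {0..1} (Pair y)" "Pair y ` {0..1} \<subseteq> ball u r \<times> {0..1}"
      using that(2) by (auto intro: continuous_on_Pair continuous_on_const continuous_on_id)
    from continuous_on_compose2[OF that(1) this] show ?thesis by simp
  qed
  have contG: "continuous_on (ball u r \<times> {0..1}) (\<lambda>(x, t). G x t)"
    unfolding split_beta G_def
    by (intro continuous_on_mult continuous_on_power continuous_on_snd continuous_on_id
        comp smooth_on_continuous_on f)
  have der: "((\<lambda>x. G x t) has_derivative blinfun_apply (G' x t)) (at x within ball u r)"
    if "x \<in> ball u r" "t \<in> {0..1}" for x t
  proof -
    have "((\<lambda>x. u + t *\<^sub>R (x - u)) has_derivative (\<lambda>v. t *\<^sub>R v)) (at x)"
      by (auto intro!: derivative_eq_intros)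
    from has_derivative_compose[OF this smooth_on_has_derivative[OF f ray_mem_ball[OF that]]]
    have "((\<lambda>x. G x t) has_derivative (\<lambda>v. t ^ n * D1 f (u + t *\<^sub>R (x - u)) (t *\<^sub>R v))) (at x)"
      unfolding G_def by (rule has_derivative_mult_right)
    moreover have "(\<lambda>v. t ^ n * D1 f (u + t *\<^sub>R (x - u)) (t *\<^sub>R v)) = blinfun_apply (G' x t)"
      by (simp add: fun_eq_iff G'[OF that] linear_cmul[OF lin[OF that]])
    ultimately show ?thesis by (simp add: has_derivative_at_withinI)
  qed
  have "((\<lambda>x. integral (cbox 0 1) (G x)) has_derivative integral (cbox 0 1) (G' x)) (at x within ball u r)"
    by (rule leibniz_rule[where fx = G'])
      (use der contG' sl[OF contG] x in \<open>auto intro!: integrable_continuous_real\<close>)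
  moreover have "blinfun_apply (integral {0..1} (G' x))
      = (\<lambda>v. integral {0..1} (\<lambda>t. t ^ Suc n * D1 f (u + t *\<^sub>R (x - u)) v))"
  proof
    fix v
    have "integral {0..1} ((\<lambda>A. blinfun_apply A v) \<circ> G' x) = blinfun_apply (integral {0..1} (G' x)) v"
      by (intro integral_linear integrable_continuous_real sl contG' x blinfun.bounded_linear_left)
    moreover have "integral {0..1} ((\<lambda>A. blinfun_apply A v) \<circ> G' x)
        = integral {0..1} (\<lambda>t. t ^ Suc n * D1 f (u + t *\<^sub>R (x - u)) v)"
      by (rule integral_cong) (simp add: G'[OF x])
    ultimately show "blinfun_apply (integral {0..1} (G' x)) v
      = integral {0..1} (\<lambda>t. t ^ Suc n * D1 f (u + t *\<^sub>R (x - u)) v)" by simp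
  qed
  ultimately show ?thesis
    using x by (simp add: at_within_open[OF x open_ball] G_def[abs_def])
qed

text \<open>The weight \<open>t ^ n\<close> is carried along because the derivative of such an
  integral is an integral of the same kind, with a higher exponent and a derivative of
  \<open>f\<close>; this closes the induction on the order.\<close>

lemma smooth_on_ray_integral:
  fixes f :: "'e::finite_dim_banach \<Rightarrow> real"
  assumes "smooth_on (ball u r) f"
  shows "smooth_on (ball u r) (\<lambda>x. integral {0..1} (\<lambda>t. t ^ n * f (u + t *\<^sub>R (x - u))))"
  unfolding smooth_on_def
proof
  fix k
  show "Ck_on k (\<lambda>x. integral {0..1} (\<lambda>t. t ^ n * f (u + t *\<^sub>R (x - u)))) (ball u r)"
    using assms
  proof (induction k arbitrary: f n)
    case 0
    show ?case unfolding Ck_on.simps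
      by (intro continuous_at_imp_continuous_on ballI)
        (rule has_derivative_continuous[OF ray_integral_has_derivative[OF 0]])
  next
    case (Suc k)
    let ?I = "\<lambda>x. integral {0..1} (\<lambda>t. t ^ n * f (u + t *\<^sub>R (x - u)))"
    have "Ck_on k (\<lambda>x. D1 ?I x v) (ball u r)" for v
    proof (rule Ck_on_cong_imp[OF open_ball])
      show "Ck_on k (\<lambda>x. integral {0..1} (\<lambda>t. t ^ Suc n * D1 f (u + t *\<^sub>R (x - u)) v)) (ball u r)"
        by (rule Suc.IH[OF smooth_on_D1[OF Suc.prems]])
      show "integral {0..1} (\<lambda>t. t ^ Suc n * D1 f (u + t *\<^sub>R (x - u)) v) = D1 ?I x v"
        if "x \<in> ball u r" for x
        by (rule fun_cong[OF D1_eqI[OF ray_integral_has_derivative[OF Suc.prems that]], symmetric])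
    qed
    then show ?case unfolding Ck_on.simps
      by (intro conjI ballI allI differentiableI[OF ray_integral_has_derivative[OF Suc.prems]])
  qed
qed

text \<open>Integrate the derivative of \<open>f\<close> along the segment from \<open>u\<close> to
  \<open>x\<close> and expand \<open>x - u\<close> in the basis. The derivative of
  \<open>h b\<close> at \<open>u\<close> is half of \<open>D2 f u v b\<close>; for iterating the
  step it matters only when it vanishes.\<close>

lemma hadamard_step:
  fixes f :: "'e::finite_dim_banach \<Rightarrow> real"
  assumes f: "smooth_on (ball u r) f" and r: "r > 0" and z: "f u = 0"
  obtains h where "\<And>b. smooth_on (ball u r) (h b)"
    "\<And>x. x \<in> ball u r \<Longrightarrow> f x = (\<Sum>b\<in>coord_basis. (coord b x - coord b u) * h b x)"
    "\<And>b. h b u = D1 f u b" "\<And>b v. D2 f u v b = 0 \<Longrightarrow> D1 (h b) u v = 0"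
proof
  define h where "h b x = integral {0..1} (\<lambda>t. t ^ 0 * D1 f (u + t *\<^sub>R (x - u)) b)" for b x
  have u: "u \<in> ball u r" using r by simp
  show "smooth_on (ball u r) (h b)" for b
    unfolding h_def by (rule smooth_on_ray_integral[OF smooth_on_D1[OF f]])
  show "h b u = D1 f u b" for b by (simp add: h_def)
  show "D1 (h b) u v = 0" if "D2 f u v b = 0" for b v
    using fun_cong[OF D1_eqI[OF ray_integral_has_derivative[OF smooth_on_D1[OF f] u, of 0 b]], of v] that
    by (simp add: h_def[abs_def] D2_def)
  fix x assume x: "x \<in> ball u r"
  have mem: "u + t *\<^sub>R (x - u) \<in> ball u r" if "t \<in> {0..1}" for t by (rule ray_mem_ball[OF x that])
  have "((\<lambda>t. f (u + t *\<^sub>R (x - u))) has_vector_derivative D1 f (u + t *\<^sub>R (x - u)) (x - u))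
      (at t within {0..1})" if "t \<in> {0..1}" for t
    using DERIV_along_line[OF smooth_on_differentiable[OF f mem[OF that]]]
    by (simp add: has_real_derivative_iff_has_vector_derivative has_vector_derivative_at_within)
  from fundamental_theorem_of_calculus[OF _ this]
  have "((\<lambda>t. D1 f (u + t *\<^sub>R (x - u)) (x - u)) has_integral f x - f u) {0..1}" by simp
  then have "f x = integral {0..1} (\<lambda>t. D1 f (u + t *\<^sub>R (x - u)) (x - u))" using z by (simp add: integral_unique)
  also have "\<dots> = integral {0..1} (\<lambda>t. \<Sum>b\<in>coord_basis. coord b (x - u) * D1 f (u + t *\<^sub>R (x - u)) b)"
  proof (rule integral_cong)
    fix t :: real assume t: "t \<in> {0..1}"
    show "D1 f (u + t *\<^sub>R (x - u)) (x - u) = (\<Sum>b\<in>coord_basis. coord b (x - u) * D1 f (u + t *\<^sub>R (x - u)) b)"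
      using linear_expansion[OF linear_D1_smooth[OF f open_ball mem[OF t]], of "x - u"]
      unfolding real_scaleR_def .
  qed
  also have "\<dots> = (\<Sum>b\<in>coord_basis. coord b (x - u) * h b x)"
  proof -
    have "continuous_on {0..1} (\<lambda>t. D1 f (u + t *\<^sub>R (x - u)) b)" for b
      by (rule continuous_on_compose2[OF smooth_on_continuous_on[OF smooth_on_D1[OF f]]])
        (auto simp del: mem_ball atLeastAtMost_iff intro!: continuous_intros mem)
    then show ?thesis
      by (subst integral_sum)
        (auto simp: h_def coord_basis(1) intro!: integrable_continuous_real continuous_intros)
  qed
  finally show "f x = (\<Sum>b\<in>coord_basis. (coord b x - coord b u) * h b x)"
    by (simp add: linear_diff[OF linear_coord])
qed

text \<open>The value and the differential of \<open>h1 b\<close> at \<open>u\<close> come from the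
  first and second derivative of \<open>f\<close> and vanish. Hence \<open>h1 b\<close> can be
  expanded once more with coefficients \<open>h2 b c\<close> that vanish at \<open>u\<close>, and
  these can be expanded a last time.\<close>

lemma hadamard_flat2:
  fixes f :: "'e::finite_dim_banach \<Rightarrow> real"
  assumes f: "smooth_on (ball u r) f" and r: "r > 0" and fl: "flat2 f u"
  obtains h where "\<And>b c d. smooth_on (ball u r) (h b c d)"
    "\<And>x. x \<in> ball u r \<Longrightarrow> f x = (\<Sum>b\<in>coord_basis. \<Sum>c\<in>coord_basis. \<Sum>d\<in>coord_basis.
      (coord b x - coord b u) * (coord c x - coord c u) * ((coord d x - coord d u) * h b c d x))"
proof -
  have z: "f u = 0" "\<And>v. D1 f u v = 0" "\<And>v w. D2 f u v w = 0" using fl by (auto simp: flat2_def)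
  obtain h1 where h1: "\<And>b. smooth_on (ball u r) (h1 b)"
    "\<And>x. x \<in> ball u r \<Longrightarrow> f x = (\<Sum>b\<in>coord_basis. (coord b x - coord b u) * h1 b x)"
    "\<And>b. h1 b u = D1 f u b" "\<And>b v. D2 f u v b = 0 \<Longrightarrow> D1 (h1 b) u v = 0"
    by (rule hadamard_step[OF f r z(1)]) (rule that)
  have z1: "h1 b u = 0" "D1 (h1 b) u v = 0" for b v using h1(3,4) z by auto
  have "\<exists>h. (\<forall>c. smooth_on (ball u r) (h c)) \<and>
    (\<forall>x\<in>ball u r. h1 b x = (\<Sum>c\<in>coord_basis. (coord c x - coord c u) * h c x)) \<and> (\<forall>c. h c u = 0)" for b
  proof -
    obtain h where "\<And>c. smooth_on (ball u r) (h c)"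
      "\<And>x. x \<in> ball u r \<Longrightarrow> h1 b x = (\<Sum>c\<in>coord_basis. (coord c x - coord c u) * h c x)"
      "\<And>c. h c u = D1 (h1 b) u c" "\<And>c v. D2 (h1 b) u v c = 0 \<Longrightarrow> D1 (h c) u v = 0"
      by (rule hadamard_step[OF h1(1) r z1(1)]) (rule that)
    then show ?thesis by (intro exI[of _ h]) (simp add: z1)
  qed
  then obtain h2 where h2: "\<And>b c. smooth_on (ball u r) (h2 b c)"
    "\<And>b x. x \<in> ball u r \<Longrightarrow> h1 b x = (\<Sum>c\<in>coord_basis. (coord c x - coord c u) * h2 b c x)"
    "\<And>b c. h2 b c u = 0" by metis
  have "\<exists>h. (\<forall>d. smooth_on (ball u r) (h d)) \<and>
    (\<forall>x\<in>ball u r. h2 b c x = (\<Sum>d\<in>coord_basis. (coord d x - coord d u) * h d x))" for b c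
  proof -
    obtain h where "\<And>d. smooth_on (ball u r) (h d)"
      "\<And>x. x \<in> ball u r \<Longrightarrow> h2 b c x = (\<Sum>d\<in>coord_basis. (coord d x - coord d u) * h d x)"
      "\<And>d. h d u = D1 (h2 b c) u d" "\<And>d v. D2 (h2 b c) u v d = 0 \<Longrightarrow> D1 (h d) u v = 0"
      by (rule hadamard_step[OF h2(1) r h2(3)]) (rule that)
    then show ?thesis by (intro exI[of _ h]) simp
  qed
  then obtain h3 where h3: "\<And>b c d. smooth_on (ball u r) (h3 b c d)"
    "\<And>b c x. x \<in> ball u r \<Longrightarrow> h2 b c x = (\<Sum>d\<in>coord_basis. (coord d x - coord d u) * h3 b c d x)"
    by metis
  show ?thesis
    by (rule that[of h3]) (use h1(2) h2(2) h3 in \<open>simp_all add: sum_distrib_left mult.assoc\<close>)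
qed


section \<open>Bump functions\<close>

text \<open>The functions \<open>exp(-1/x) / x^n\<close> continued by 0: a family closed under
  differentiation up to linear combinations. The exponent \<open>n\<close> serves that closure; the
  cutoff itself uses \<open>n = 0\<close>.\<close>

definition flat_exp :: "nat \<Rightarrow> real \<Rightarrow> real"
  where "flat_exp n x = (if x > 0 then exp (- inverse x) * inverse x ^ n else 0)"

text \<open>From the right, with \<open>y = 1/x\<close>, this is the growth of \<open>exp y\<close>
  against \<open>y ^ n\<close>; from the left the function is 0.\<close>

lemma flat_exp_tendsto_0: "(flat_exp n \<longlongrightarrow> 0) (at 0)"
proof -
  have "((\<lambda>y. y ^ n / exp y) \<longlongrightarrow> (0::real)) at_top" by (rule tendsto_power_div_exp_0)
  from filterlim_compose[OF this filterlim_inverse_at_top_right]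
  have "((\<lambda>x. inverse x ^ n / exp (inverse x)) \<longlongrightarrow> (0::real)) (at_right 0)" by (simp add: o_def)
  moreover have "eventually (\<lambda>x. inverse x ^ n / exp (inverse x) = flat_exp n x) (at_right 0)"
    by (auto simp: eventually_at_filter flat_exp_def exp_minus field_simps)
  ultimately have "(flat_exp n \<longlongrightarrow> 0) (at_right 0)" by (rule Lim_transform_eventually)
  moreover have "(flat_exp n \<longlongrightarrow> 0) (at_left 0)"
    by (rule Lim_transform_eventually[OF tendsto_const])
      (auto simp: eventually_at_filter flat_exp_def)
  ultimately show ?thesis by (simp add: filterlim_split_at)
qed

lemma DERIV_flat_exp:
  "(flat_exp n has_field_derivative flat_exp (Suc (Suc n)) x - real n * flat_exp (Suc n) x) (at x)"
proof -
  consider "x > 0" | "x = 0" | "x < 0" by linarith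
  then show ?thesis
  proof cases
    case 1
    have i: "(inverse has_field_derivative - (inverse x ^ Suc (Suc 0))) (at x)"
      using 1 by (intro DERIV_inverse) simp
    have "((\<lambda>x. exp (- inverse x) * inverse x ^ n) has_field_derivative
        exp (- inverse x) * (- (- (inverse x ^ Suc (Suc 0)))) * inverse x ^ n +
        real n * (- (inverse x ^ Suc (Suc 0)) * inverse x ^ (n - Suc 0)) * exp (- inverse x)) (at x)"
      by (rule DERIV_mult[OF DERIV_fun_exp[OF DERIV_minus[OF i]] DERIV_power[OF i]])
    \<comment> \<open>For \<open>n = 0\<close> the truncated exponent \<open>n - Suc 0\<close> is
      multiplied by \<open>real n = 0\<close>; hence the case distinction on
      \<open>n\<close>.\<close>
    also have "exp (- inverse x) * (- (- (inverse x ^ Suc (Suc 0)))) * inverse x ^ n +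
        real n * (- (inverse x ^ Suc (Suc 0)) * inverse x ^ (n - Suc 0)) * exp (- inverse x)
        = flat_exp (Suc (Suc n)) x - real n * flat_exp (Suc n) x"
      using 1 by (cases n) (simp_all add: flat_exp_def)
    finally have "((\<lambda>x. exp (- inverse x) * inverse x ^ n) has_field_derivative
        flat_exp (Suc (Suc n)) x - real n * flat_exp (Suc n) x) (at x)" .
    then show ?thesis
      by (rule has_field_derivative_transform_within_open[of _ _ _ "{0<..}"])
        (use 1 in \<open>auto simp: flat_exp_def\<close>)
  next
    case 2
    \<comment> \<open>The difference quotient at 0 is the next member of the family and tends to 0,
      which is also the value at 0 of the claimed derivative.\<close>
    have "flat_exp n h / h = flat_exp (Suc n) h" if "h \<noteq> 0" for h
      using that by (auto simp: flat_exp_def field_simps)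
    then have "((\<lambda>h. flat_exp n h / h) \<longlongrightarrow> 0) (at 0)"
      using flat_exp_tendsto_0[of "Suc n"]
      by (elim Lim_transform_eventually) (auto simp: eventually_at_filter)
    then show ?thesis using 2 by (simp add: DERIV_def flat_exp_def)
  next
    case 3
    have "((\<lambda>x. 0::real) has_field_derivative flat_exp (Suc (Suc n)) x - real n * flat_exp (Suc n) x) (at x)"
      using 3 by (simp add: flat_exp_def)
    then show ?thesis
      by (rule has_field_derivative_transform_within_open[of _ _ _ "{..<0}"])
        (use 3 in \<open>auto simp: flat_exp_def\<close>)
  qed
qed

lemma smooth_on_flat_exp: "smooth_on S (flat_exp n)"
proof -
  have "Ck_on k (flat_exp n) UNIV" for k
  proof (induction k arbitrary: n)
    case 0
    show ?case unfolding Ck_on.simps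
      by (intro continuous_at_imp_continuous_on ballI DERIV_isCont[OF DERIV_flat_exp])
  next
    case (Suc k)
    have der: "(flat_exp n has_derivative
        (\<lambda>v. (flat_exp (Suc (Suc n)) x - real n * flat_exp (Suc n) x) * v)) (at x)" for x
      using DERIV_flat_exp[of n x] by (simp add: has_field_derivative_def)
    have "Ck_on k (\<lambda>x. (flat_exp (Suc (Suc n)) x + (- real n) *\<^sub>R flat_exp (Suc n) x) * v) UNIV" for v
      by (intro Ck_on_linear_compose[OF open_UNIV bounded_linear_mult_left] Ck_on_add[OF open_UNIV]
          Ck_on_linear_compose[OF open_UNIV bounded_linear_scaleR_right] Suc.IH)
    then show ?case unfolding Ck_on.simps D1_eqI[OF der]
      by (auto intro: differentiableI[OF der])
  qed
  then have "smooth_on UNIV (flat_exp n)" by (simp add: smooth_on_def)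
  then show ?thesis by (rule smooth_on_subset) simp
qed

text \<open>The derivative of \<open>inverse\<close> is, up to a constant factor, the square of
  \<open>inverse\<close>, so the induction on the order feeds on itself.\<close>

lemma smooth_on_inverse: "smooth_on {0<..} (inverse :: real \<Rightarrow> real)"
proof -
  have "Ck_on k inverse {0::real<..}" for k
  proof (induction k)
    case 0
    show ?case by (auto intro!: continuous_intros)
  next
    case (Suc k)
    have der: "(inverse has_derivative (\<lambda>v. - (inverse x * v * inverse x))) (at x)" if "x \<in> {0<..}" for x :: real
      by (rule has_derivative_inverse') (use that in auto)
    have "Ck_on k (\<lambda>x. D1 inverse x v) {0::real<..}" for v
    proof (rule Ck_on_cong_imp[OF open_greaterThan])
      show "- v * (inverse x * inverse x) = D1 inverse x v" if "x \<in> {0<..}" for x :: real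
        using D1_eqI[OF der[OF that]] by simp
      show "Ck_on k (\<lambda>x. - v * (inverse x * inverse x)) {0::real<..}"
        by (intro Ck_on_linear_compose[OF open_greaterThan bounded_linear_mult_right]
            Ck_on_bilinear[OF open_greaterThan bounded_bilinear_mult] Suc.IH)
    qed
    then show ?case unfolding Ck_on.simps by (blast intro: differentiableI[OF der])
  qed
  then show ?thesis by (simp add: smooth_on_def)
qed

text \<open>A smooth step from 1 to 0 between 1 and 2. The denominator is positive everywhere
  because \<open>2 - s\<close> and \<open>s - 1\<close> are never both nonpositive.\<close>

definition cutoff :: "real \<Rightarrow> real"
  where "cutoff s = flat_exp 0 (2 - s) * inverse (flat_exp 0 (2 - s) + flat_exp 0 (s - 1))"

lemma cutoff_eq_1: "s \<le> 1 \<Longrightarrow> cutoff s = 1"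
  by (simp add: cutoff_def flat_exp_def)

lemma cutoff_eq_0: "s \<ge> 2 \<Longrightarrow> cutoff s = 0"
  by (simp add: cutoff_def flat_exp_def)

lemma smooth_on_cutoff: "smooth_on UNIV cutoff"
proof -
  have a: "smooth_on UNIV (\<lambda>s. flat_exp 0 (2 - s))" "smooth_on UNIV (\<lambda>s. flat_exp 0 (s - 1))"
    by (rule smooth_on_compose[OF open_UNIV open_UNIV _ smooth_on_flat_exp];
        intro smooth_on_diff open_UNIV smooth_on_const smooth_on_ident subset_UNIV)+
  have "flat_exp 0 (2 - s) + flat_exp 0 (s - 1) > 0" for s
    by (auto simp: flat_exp_def add_pos_pos)
  then show ?thesis
    unfolding cutoff_def[abs_def]
    by (intro smooth_on_mult open_UNIV a smooth_on_compose[OF open_UNIV open_greaterThan _ smooth_on_inverse]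
        smooth_on_add) auto
qed

text \<open>The norm of a Banach space need not be smooth, so the cutoff is composed with the
  quadratic form \<open>q\<close>, the sum of squared coordinates relative to \<open>u\<close>,
  which controls the norm.\<close>

lemma bump_in_ball:
  fixes u :: "'e::finite_dim_banach"
  assumes r: "r > 0"
  obtains \<psi> :: "'e \<Rightarrow> real" where "smooth_on UNIV \<psi>" "eventually (\<lambda>w. \<psi> w = 1) (nhds u)"
    "\<And>w. w \<notin> ball u r \<Longrightarrow> \<psi> w = 0"
proof -
  define q where "q w = (\<Sum>b\<in>coord_basis. (coord b w - coord b u) * (coord b w - coord b u))" for w
  \<comment> \<open>The triangle inequality in the basis gives
    \<open>norm (w - u) \<le> sqrt (q w) * L\<close>; the summand 1 keeps \<open>L\<close> positive
    when the basis is empty.\<close>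
  define L where "L = (\<Sum>b\<in>coord_basis. norm (b::'e)) + 1"
  have L: "L > 0" unfolding L_def by (intro add_nonneg_pos sum_nonneg) auto
  \<comment> \<open>Scaled so that \<open>norm (w - u) \<ge> r\<close> forces
    \<open>N * q w \<ge> 2\<close>, where the cutoff is 0.\<close>
  define N where "N = 2 * L\<^sup>2 / r\<^sup>2"
  have N: "N > 0" using L r by (simp add: N_def)
  have sq: "smooth_on UNIV q" unfolding q_def
    by (intro smooth_on_sum smooth_on_mult smooth_on_coord_affine open_UNIV)
  have q0: "q w \<ge> 0" for w unfolding q_def by (intro sum_nonneg) simp
  have qbound: "norm (w - u) \<le> sqrt (q w) * L" for w
  proof -
    have c: "\<bar>coord b (w - u)\<bar> \<le> sqrt (q w)" if "b \<in> coord_basis" for b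
    proof (rule real_le_rsqrt)
      have "(coord b w - coord b u) * (coord b w - coord b u) \<le> q w"
        unfolding q_def using that coord_basis(1) by (intro member_le_sum) auto
      then show "\<bar>coord b (w - u)\<bar>\<^sup>2 \<le> q w"
        by (simp add: linear_diff[OF linear_coord] power2_eq_square)
    qed
    have "norm (w - u) = norm (\<Sum>b\<in>coord_basis. coord b (w - u) *\<^sub>R b)" by (simp only: coord_expansion)
    also have "\<dots> \<le> (\<Sum>b\<in>coord_basis. \<bar>coord b (w - u)\<bar> * norm b)"
      by (rule order_trans[OF norm_sum]) simp
    also have "\<dots> \<le> (\<Sum>b\<in>coord_basis. sqrt (q w) * norm (b::'e))"
    proof (rule sum_mono)
      show "\<bar>coord b (w - u)\<bar> * norm b \<le> sqrt (q w) * norm b" if "b \<in> coord_basis" for b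
        using c[OF that] by (rule mult_right_mono) simp
    qed
    also have "\<dots> \<le> sqrt (q w) * L" using q0[of w] by (simp add: L_def distrib_left flip: sum_distrib_left)
    finally show ?thesis .
  qed
  show ?thesis
  proof
    have "smooth_on UNIV (\<lambda>w. N * q w)"
      by (intro smooth_on_linear_compose[OF open_UNIV bounded_linear_mult_right] sq)
    from smooth_on_compose[OF open_UNIV open_UNIV this smooth_on_cutoff]
    show "smooth_on UNIV (\<lambda>w. cutoff (N * q w))" by simp
    have "isCont (\<lambda>w. N * q w) u"
      using smooth_on_continuous_on[OF sq] by (auto simp: continuous_on_eq_continuous_at intro!: continuous_intros)
    moreover have "N * q u < 1" by (simp add: q_def)
    ultimately have "eventually (\<lambda>w. N * q w < 1) (at u)" by (auto simp: isCont_def intro: order_tendstoD)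
    then have "eventually (\<lambda>w. N * q w < 1) (nhds u)" using \<open>N * q u < 1\<close> by (simp add: eventually_nhds_conv_at)
    then show "eventually (\<lambda>w. cutoff (N * q w) = 1) (nhds u)"
      by (rule eventually_mono) (simp add: cutoff_eq_1)
    fix w assume "w \<notin> ball u r"
    then have "r \<le> sqrt (q w) * L" using qbound[of w] by (simp add: dist_norm norm_minus_commute)
    then have "r\<^sup>2 \<le> (sqrt (q w) * L)\<^sup>2" using r by (intro power_mono) auto
    then have "r\<^sup>2 \<le> q w * L\<^sup>2" using q0[of w] by (simp add: power_mult_distrib)
    then have "2 \<le> N * q w" using r by (simp add: N_def field_simps)
    then show "cutoff (N * q w) = 0" by (rule cutoff_eq_0)
  qed
qed


section \<open>Compactness of closed balls in finite dimension\<close>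

lemma compact_coord_box:
  fixes s :: "'e::finite_dim_banach \<Rightarrow> real"
  assumes "finite B"
  shows "compact {\<Sum>b\<in>B. a b *\<^sub>R b | a. \<forall>b\<in>B. \<bar>a b\<bar> \<le> s b}"
  using assms
proof (induction B rule: finite_induct)
  case empty
  then show ?case by simp
next
  case (insert c B)
  let ?Q = "\<lambda>B. {\<Sum>b\<in>B. a b *\<^sub>R b | a. \<forall>b\<in>B. \<bar>a b\<bar> \<le> s b}"
  have eq: "?Q (insert c B) = (\<lambda>(t, x). t *\<^sub>R c + x) ` ({- s c..s c} \<times> ?Q B)"
  proof (intro subset_antisym subsetI)
    fix x assume "x \<in> ?Q (insert c B)"
    then obtain a where a: "x = (\<Sum>b\<in>insert c B. a b *\<^sub>R b)" "\<forall>b\<in>insert c B. \<bar>a b\<bar> \<le> s b" by blast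
    then have "x = (\<lambda>(t, x). t *\<^sub>R c + x) (a c, \<Sum>b\<in>B. a b *\<^sub>R b)" using insert.hyps by simp
    moreover have "(a c, \<Sum>b\<in>B. a b *\<^sub>R b) \<in> {- s c..s c} \<times> ?Q B" using a(2) by (auto simp: abs_le_iff)
    ultimately show "x \<in> (\<lambda>(t, x). t *\<^sub>R c + x) ` ({- s c..s c} \<times> ?Q B)" by (rule image_eqI)
  next
    fix x assume "x \<in> (\<lambda>(t, x). t *\<^sub>R c + x) ` ({- s c..s c} \<times> ?Q B)"
    then obtain t a where ta: "t \<in> {- s c..s c}" "\<forall>b\<in>B. \<bar>a b\<bar> \<le> s b" "x = t *\<^sub>R c + (\<Sum>b\<in>B. a b *\<^sub>R b)"
      by auto
    define a' where "a' = a(c := t)"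
    have "(\<Sum>b\<in>B. a' b *\<^sub>R b) = (\<Sum>b\<in>B. a b *\<^sub>R b)"
      using insert.hyps by (intro sum.cong) (auto simp: a'_def)
    then have "x = (\<Sum>b\<in>insert c B. a' b *\<^sub>R b)" using ta insert.hyps by (simp add: a'_def)
    moreover have "\<forall>b\<in>insert c B. \<bar>a' b\<bar> \<le> s b" using ta insert.hyps by (auto simp: a'_def)
    ultimately show "x \<in> ?Q (insert c B)" by blast
  qed
  have "continuous_on T (\<lambda>(t, x). t *\<^sub>R c + x)" for T :: "(real \<times> 'e) set"
    unfolding split_beta by (intro continuous_intros)
  then show ?case
    unfolding eq by (rule compact_continuous_image) (intro compact_Times compact_Icc insert.IH)
qed

text \<open>A closed ball is a closed subset of a translated coordinate box, whose half-widths come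
  from the boundedness of the coordinate functionals.\<close>

lemma compact_cball_finite_dim: "compact (cball u r :: 'e::finite_dim_banach set)"
proof -
  have "\<exists>K. \<forall>x. norm (coord b x) \<le> norm x * K" for b :: 'e
    by (rule bounded_linear.bounded[OF bounded_linear_coord])
  then obtain K where K: "\<And>(b::'e) x. norm (coord b x) \<le> norm x * K b" by metis
  define Q where "Q = {\<Sum>b\<in>coord_basis. a b *\<^sub>R b | a. \<forall>b\<in>coord_basis. \<bar>a b\<bar> \<le> r * \<bar>K (b::'e)\<bar>}"
  have "compact ((+) u ` Q)"
    unfolding Q_def
    by (intro compact_continuous_image continuous_intros compact_coord_box coord_basis(1))
  moreover have "cball u r \<subseteq> (+) u ` Q"
  proof
    fix x assume x: "x \<in> cball u r"
    have "\<bar>coord b (x - u)\<bar> \<le> r * \<bar>K b\<bar>" for b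
    proof -
      have "\<bar>coord b (x - u)\<bar> \<le> norm (x - u) * \<bar>K b\<bar>"
        using K[of b "x - u"] mult_left_mono[OF abs_ge_self[of "K b"] norm_ge_zero[of "x - u"]] by simp
      also have "\<dots> \<le> r * \<bar>K b\<bar>"
        using x by (intro mult_right_mono) (auto simp: dist_norm norm_minus_commute)
      finally show ?thesis .
    qed
    then have "(\<Sum>b\<in>coord_basis. coord b (x - u) *\<^sub>R b) \<in> Q"
      unfolding Q_def by (intro CollectI exI[of _ "\<lambda>b. coord b (x - u)"]) simp
    then show "x \<in> (+) u ` Q" by (auto simp: coord_expansion intro: image_eqI[of _ _ "x - u"])
  qed
  ultimately have "compact ((+) u ` Q \<inter> cball u r)" by (intro compact_Int_closed closed_cball)
  then show ?thesis using \<open>cball u r \<subseteq> (+) u ` Q\<close> by (simp add: inf.absorb2)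
qed


section \<open>Charts and smooth functions\<close>

locale smooth_manifold =
  fixes A :: "('m::t2_space, 'e::finite_dim_banach) chart set"
  assumes smooth_structure: "smooth_structure A"
begin

lemma
  assumes "c \<in> A"
  shows topological_chart: "topological_chart c"
    and open_cdom: "open (cdom c)"
    and open_chart_image: "open (cmap c ` cdom c)"
    and cinv_cmap: "m \<in> cdom c \<Longrightarrow> cinv c (cmap c m) = m"
    and cmap_cinv: "u \<in> cmap c ` cdom c \<Longrightarrow> cmap c (cinv c u) = u"
    and cinv_in: "u \<in> cmap c ` cdom c \<Longrightarrow> cinv c u \<in> cdom c"
    and continuous_on_cmap: "continuous_on (cdom c) (cmap c)"
    and continuous_on_cinv: "continuous_on (cmap c ` cdom c) (cinv c)"
proof -
  show t: "topological_chart c" using smooth_structure assms by (simp add: smooth_structure_def)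
  have h: "homeomorphism (cdom c) (cmap c ` cdom c) (cmap c) (cinv c)"
    using t by (simp add: topological_chart_def)
  show "open (cdom c)" "open (cmap c ` cdom c)" using t by (simp_all add: topological_chart_def)
  show "m \<in> cdom c \<Longrightarrow> cinv c (cmap c m) = m" by (rule homeomorphism_apply1[OF h])
  show "u \<in> cmap c ` cdom c \<Longrightarrow> cmap c (cinv c u) = u" by (rule homeomorphism_apply2[OF h])
  show "u \<in> cmap c ` cdom c \<Longrightarrow> cinv c u \<in> cdom c" using homeomorphism_image2[OF h] by blast
  show "continuous_on (cdom c) (cmap c)" "continuous_on (cmap c ` cdom c) (cinv c)"
    by (rule homeomorphism_cont1[OF h] homeomorphism_cont2[OF h])+
qed

lemma charts_atD: "c \<in> charts_at A m \<Longrightarrow> c \<in> A" "c \<in> charts_at A m \<Longrightarrow> m \<in> cdom c"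
  by (simp_all add: charts_at_def)

lemma charts_atI: "c \<in> A \<Longrightarrow> m \<in> cdom c \<Longrightarrow> c \<in> charts_at A m"
  by (simp add: charts_at_def)

lemma chart_exists: obtains c where "c \<in> charts_at A m"
proof -
  have "m \<in> (\<Union>c\<in>A. cdom c)" using smooth_structure by (simp add: smooth_structure_def)
  then show ?thesis using that by (auto simp: charts_at_def)
qed

lemma open_image:
  assumes "c \<in> A" "open W"
  shows "open (cmap c ` (cdom c \<inter> W))"
proof -
  have "cmap c ` (cdom c \<inter> W) = cmap c ` cdom c \<inter> cinv c -` W"
    using cinv_cmap[OF assms(1)] by auto
  then show ?thesis
    by (simp add: continuous_open_preimage continuous_on_cinv open_chart_image assms)
qed

lemma open_image_subset:
  assumes "c \<in> A" "open W" "W \<subseteq> cdom c"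
  shows "open (cmap c ` W)"
  using open_image[OF assms(1,2)] assms(3) by (simp add: inf.absorb2)

text \<open>Both directions restrict to the open chart domain or its open image, between which
  \<open>cinv c\<close> is the inverse homeomorphism. Statements about germs are moved into a chart
  in this way.\<close>

lemma eventually_chart:
  assumes "c \<in> charts_at A m"
  shows "eventually P (nhds m) \<longleftrightarrow> eventually (\<lambda>u. P (cinv c u)) (nhds (cmap c m))"
proof
  note c = charts_atD[OF assms]
  assume "eventually P (nhds m)"
  then obtain W where W: "open W" "m \<in> W" "\<And>x. x \<in> W \<Longrightarrow> P x" unfolding eventually_nhds by blast
  show "eventually (\<lambda>u. P (cinv c u)) (nhds (cmap c m))"
    by (rule eventually_nhds_open[OF open_image[OF c(1) W(1)]])
      (use c W cinv_cmap[OF c(1)] in auto)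
next
  note c = charts_atD[OF assms]
  assume "eventually (\<lambda>u. P (cinv c u)) (nhds (cmap c m))"
  then obtain V where V: "open V" "cmap c m \<in> V" "\<And>u. u \<in> V \<Longrightarrow> P (cinv c u)"
    unfolding eventually_nhds by blast
  have "open (cdom c \<inter> cmap c -` V)"
    by (intro continuous_open_preimage continuous_on_cmap open_cdom c V)
  then show "eventually P (nhds m)"
    by (rule eventually_nhds_open) (use c V in \<open>auto dest: V(3) simp: cinv_cmap\<close>)
qed

lemma eventually_cdom: "c \<in> charts_at A m \<Longrightarrow> eventually (\<lambda>x. c \<in> charts_at A x) (nhds m)"
  by (rule eventually_nhds_open[OF open_cdom]) (auto simp: charts_at_def)

lemma smooth_transition:
  "c \<in> A \<Longrightarrow> d \<in> A \<Longrightarrow> smooth_on (cmap c ` (cdom c \<inter> cdom d)) (transition c d)"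
  using smooth_structure by (auto simp: smooth_structure_def compatible_def)

lemma transition_cmap: "c \<in> A \<Longrightarrow> m \<in> cdom c \<Longrightarrow> transition c d (cmap c m) = cmap d m"
  by (simp add: transition_def cinv_cmap)

lemma smooth_on_chart:
  "f \<in> smooth_funs A W \<Longrightarrow> c \<in> A \<Longrightarrow> smooth_on (cmap c ` (cdom c \<inter> W)) (f \<circ> cinv c)"
  by (simp add: smooth_funs_def)

lemma smooth_on_chart_UNIV:
  "f \<in> smooth_funs A UNIV \<Longrightarrow> c \<in> A \<Longrightarrow> smooth_on (cmap c ` cdom c) (f \<circ> cinv c)"
  using smooth_on_chart[of f UNIV c] by simp

text \<open>One chart near each point suffices: in any other chart the function is its
  representative in the first, composed with a smooth transition map.\<close>

lemma smooth_funsI: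
  assumes "\<And>x. x \<in> W \<Longrightarrow> \<exists>c\<in>A. \<exists>V. open V \<and> x \<in> V \<and> V \<subseteq> cdom c \<and> smooth_on (cmap c ` V) (f \<circ> cinv c)"
  shows "f \<in> smooth_funs A W"
  unfolding smooth_funs_def
proof (intro CollectI ballI smooth_on_local)
  fix d w assume d: "d \<in> A" and "w \<in> cmap d ` (cdom d \<inter> W)"
  then obtain x where x: "w = cmap d x" "x \<in> cdom d" "x \<in> W" by auto
  obtain c V where c: "c \<in> A" and V: "open V" "x \<in> V" "V \<subseteq> cdom c" and s: "smooth_on (cmap c ` V) (f \<circ> cinv c)"
    using assms[OF x(3)] by blast
  let ?T = "cmap d ` (cdom d \<inter> V)"
  have T: "open ?T" by (rule open_image[OF d V(1)])
  have "smooth_on ?T (\<lambda>w. (f \<circ> cinv c) (transition d c w))"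
  proof (rule smooth_on_compose[OF T open_image_subset[OF c V(1,3)] _ s])
    show "smooth_on ?T (transition d c)"
      by (rule smooth_on_subset[OF smooth_transition[OF d c]]) (use V in auto)
    show "transition d c ` ?T \<subseteq> cmap c ` V" using d by (auto simp: transition_cmap)
  qed
  then have "smooth_on ?T (f \<circ> cinv d)"
    by (rule smooth_on_transform[OF T])
      (use V c d in \<open>auto simp: transition_cmap cinv_cmap subset_iff\<close>)
  then show "\<exists>T. open T \<and> w \<in> T \<and> smooth_on T (f \<circ> cinv d)" using T x V by blast
qed

text \<open>Extension by zero: \<open>W\<close> and the complement of \<open>K\<close> form an open
  cover, and on the latter the function vanishes. It is essential that \<open>K\<close> is closed in
  the whole manifold and not merely in \<open>W\<close>.\<close>

lemma smooth_funsI_support: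
  assumes c: "c \<in> A" and W: "open W" "W \<subseteq> cdom c" and K: "closed K" "K \<subseteq> W"
    and f0: "\<And>x. x \<notin> K \<Longrightarrow> f x = 0" and s: "smooth_on (cmap c ` W) (f \<circ> cinv c)"
  shows "f \<in> smooth_funs A UNIV"
proof (rule smooth_funsI)
  fix x
  show "\<exists>d\<in>A. \<exists>V. open V \<and> x \<in> V \<and> V \<subseteq> cdom d \<and> smooth_on (cmap d ` V) (f \<circ> cinv d)"
  proof (cases "x \<in> W")
    case True
    then show ?thesis using c W s by blast
  next
    case False
    obtain d where d: "d \<in> charts_at A x" by (rule chart_exists)
    note dA = charts_atD(1)[OF d]
    have V: "open (cdom d \<inter> - K)" using K open_cdom[OF dA] by auto
    have "smooth_on (cmap d ` (cdom d \<inter> - K)) (f \<circ> cinv d)"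
      by (rule smooth_on_transform[OF open_image[OF dA] smooth_on_const[of _ 0]])
        (use K f0 cinv_cmap[OF dA] in auto)
    moreover have "x \<in> cdom d \<inter> - K" using False K charts_atD(2)[OF d] by auto
    ultimately show ?thesis using dA V by blast
  qed
qed

lemma smooth_funs_const: "(\<lambda>_. a) \<in> smooth_funs A W"
  by (simp add: smooth_funs_def o_def smooth_on_const)

lemma smooth_funs_add:
  "open W \<Longrightarrow> f \<in> smooth_funs A W \<Longrightarrow> g \<in> smooth_funs A W \<Longrightarrow> (\<lambda>x. f x + g x) \<in> smooth_funs A W"
  by (simp add: smooth_funs_def o_def smooth_on_add open_image)

lemma smooth_funs_mult:
  "open W \<Longrightarrow> f \<in> smooth_funs A W \<Longrightarrow> g \<in> smooth_funs A W \<Longrightarrow> (\<lambda>x. f x * g x) \<in> smooth_funs A W"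
  by (simp add: smooth_funs_def o_def smooth_on_mult open_image)

lemma smooth_funs_lincomb:
  assumes "f \<in> smooth_funs A UNIV" "g \<in> smooth_funs A UNIV"
  shows "(\<lambda>x. a * f x + b * g x) \<in> smooth_funs A UNIV"
  by (intro smooth_funs_add smooth_funs_mult smooth_funs_const open_UNIV assms)

text \<open>The support lies in the image under \<open>cinv c\<close> of a closed ball. That image
  is compact, hence closed in the Hausdorff manifold, which makes the extension by zero
  smooth.\<close>

lemma bump_function:
  assumes c: "c \<in> charts_at A m" and W: "open W" "m \<in> W"
  obtains \<rho> K where "\<rho> \<in> smooth_funs A UNIV" "closed K" "K \<subseteq> cdom c \<inter> W" "\<And>x. x \<notin> K \<Longrightarrow> \<rho> x = 0"
    "eventually (\<lambda>x. \<rho> x = (1::real)) (nhds m)"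
proof -
  note cA = charts_atD(1)[OF c] and mc = charts_atD(2)[OF c]
  have "cmap c m \<in> cmap c ` (cdom c \<inter> W)" using mc W(2) by blast
  then obtain r where r: "r > 0" "cball (cmap c m) r \<subseteq> cmap c ` (cdom c \<inter> W)"
    using open_contains_cball_eq[OF open_image[OF cA W(1)]] by blast
  obtain \<psi> :: "'e \<Rightarrow> real" where \<psi>: "smooth_on UNIV \<psi>" "eventually (\<lambda>w. \<psi> w = 1) (nhds (cmap c m))"
    "\<And>w. w \<notin> ball (cmap c m) r \<Longrightarrow> \<psi> w = 0"
    by (rule bump_in_ball[OF r(1), of "cmap c m"]) (rule that)
  define K where "K = cinv c ` cball (cmap c m) r"
  define \<rho> where "\<rho> x = (if x \<in> cdom c then \<psi> (cmap c x) else 0)" for x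
  have "continuous_on (cball (cmap c m) r) (cinv c)"
    by (rule continuous_on_subset[OF continuous_on_cinv[OF cA]]) (use r in auto)
  then have K: "closed K"
    unfolding K_def by (intro compact_imp_closed compact_continuous_image compact_cball_finite_dim)
  have KW: "K \<subseteq> cdom c \<inter> W"
    unfolding K_def using r(2) cinv_cmap[OF cA] by fastforce
  have \<rho>0: "\<rho> x = 0" if "x \<notin> K" for x
  proof (cases "x \<in> cdom c")
    case True
    then have "cmap c x \<notin> ball (cmap c m) r"
      using that cinv_cmap[OF cA True] unfolding K_def by (metis ball_subset_cball imageI subsetD)
    then show ?thesis using \<psi>(3) by (simp add: \<rho>_def)
  qed (simp add: \<rho>_def)
  have "smooth_on (cmap c ` cdom c) (\<rho> \<circ> cinv c)"
    by (rule smooth_on_transform[OF open_chart_image[OF cA] smooth_on_subset[OF \<psi>(1)]])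
      (use cinv_in[OF cA] cmap_cinv[OF cA] in \<open>auto simp: \<rho>_def\<close>)
  then have "\<rho> \<in> smooth_funs A UNIV"
    using KW by (intro smooth_funsI_support[OF cA open_cdom[OF cA] subset_refl K _ \<rho>0]) auto
  moreover have "eventually (\<lambda>x. \<rho> x = 1) (nhds m)"
    unfolding eventually_chart[OF c]
  proof (rule eventually_mono[OF eventually_conj[OF \<psi>(2)]])
    show "eventually (\<lambda>u. u \<in> cmap c ` cdom c) (nhds (cmap c m))"
      using mc by (intro eventually_nhds_open[OF open_chart_image[OF cA]]) auto
    show "\<rho> (cinv c u) = 1" if "\<psi> u = 1 \<and> u \<in> cmap c ` cdom c" for u
      using that cinv_in[OF cA] cmap_cinv[OF cA] by (simp add: \<rho>_def)
  qed
  ultimately show ?thesis using that K KW \<rho>0 by blast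
qed

text \<open>Multiply \<open>g\<close> by a bump function. Outside \<open>cdom c\<close> the values
  \<open>g (cmap c x)\<close> are arbitrary, but there the bump function is 0.\<close>

lemma extend_function:
  assumes c: "c \<in> charts_at A m" and W: "open W" "m \<in> W"
    and g: "smooth_on (cmap c ` (cdom c \<inter> W)) g"
  obtains f where "f \<in> smooth_funs A UNIV" "eventually (\<lambda>x. f x = g (cmap c x)) (nhds m)"
proof -
  note cA = charts_atD(1)[OF c] and mc = charts_atD(2)[OF c]
  obtain \<rho> K where \<rho>: "\<rho> \<in> smooth_funs A UNIV" and K: "closed K" "K \<subseteq> cdom c \<inter> W"
    and \<rho>0: "\<And>x. x \<notin> K \<Longrightarrow> \<rho> x = 0" and \<rho>1: "eventually (\<lambda>x. \<rho> x = (1::real)) (nhds m)"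
    by (rule bump_function[OF c W]) (rule that)
  define f where "f x = \<rho> x * g (cmap c x)" for x
  have op: "open (cmap c ` (cdom c \<inter> W))" by (rule open_image[OF cA W(1)])
  have "smooth_on (cmap c ` (cdom c \<inter> W)) (\<lambda>u. (\<rho> \<circ> cinv c) u * g u)"
    by (intro smooth_on_mult op g smooth_on_subset[OF smooth_on_chart[OF \<rho> cA]]) auto
  then have "smooth_on (cmap c ` (cdom c \<inter> W)) (f \<circ> cinv c)"
    by (rule smooth_on_transform[OF op]) (use cmap_cinv[OF cA] in \<open>auto simp: f_def\<close>)
  then have "f \<in> smooth_funs A UNIV"
    by (intro smooth_funsI_support[OF cA open_Int[OF open_cdom[OF cA] W(1)] Int_lower1 K])
      (simp_all add: f_def \<rho>0)
  moreover have "eventually (\<lambda>x. f x = g (cmap c x)) (nhds m)"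
    using \<rho>1 by (rule eventually_mono) (simp add: f_def)
  ultimately show ?thesis using that by blast
qed

lemma extend_germ:
  assumes c: "c \<in> charts_at A m" and W: "open W" "m \<in> W" and f: "f \<in> smooth_funs A W"
  obtains g where "g \<in> smooth_funs A UNIV" "eventually (\<lambda>x. g x = f x) (nhds m)"
proof -
  note cA = charts_atD(1)[OF c]
  obtain g where g: "g \<in> smooth_funs A UNIV" "eventually (\<lambda>x. g x = (f \<circ> cinv c) (cmap c x)) (nhds m)"
    by (rule extend_function[OF c W smooth_on_chart[OF f cA]]) (rule that)
  have "eventually (\<lambda>x. g x = f x) (nhds m)"
    by (rule eventually_elim2[OF g(2) eventually_cdom[OF c]])
      (auto simp: cinv_cmap[OF cA] dest: charts_atD)
  then show ?thesis using that g(1) by blast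
qed

lemma chart_germ_eq:
  assumes "c \<in> charts_at A m" "eventually (\<lambda>x. f x = g x) (nhds m)"
  shows "eventually (\<lambda>w. (f \<circ> cinv c) w = (g \<circ> cinv c) w) (nhds (cmap c m))"
  using assms(2) unfolding eventually_chart[OF assms(1)] by simp


section \<open>Second-order tangent vectors as operators on functions\<close>


definition act :: "('m \<Rightarrow> real) \<Rightarrow> ('m, 'e) chart \<Rightarrow> 'm \<Rightarrow> 'e \<times> 'e sym_square \<Rightarrow> real"
  where "act f c m = op2 (f \<circ> cinv c) (cmap c m)"

lemma linear_act:
  assumes "f \<in> smooth_funs A UNIV" "c \<in> charts_at A m"
  shows "linear (act f c m)"
  unfolding act_def
  by (rule linear_op2[OF smooth_on_chart_UNIV[OF assms(1)] open_chart_image])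
    (use assms(2) in \<open>auto dest: charts_atD\<close>)

lemma act_push:
  assumes c: "c \<in> charts_at A m" and d: "d \<in> charts_at A m" and f: "f \<in> smooth_funs A UNIV"
  shows "act f c m a = act f d m (push2 (transition c d) (cmap c m) a)"
proof -
  note cA = charts_atD[OF c] and dA = charts_atD[OF d]
  let ?S = "cmap c ` (cdom c \<inter> cdom d)"
  have S: "open ?S" "cmap c m \<in> ?S" using cA dA open_image[OF cA(1) open_cdom[OF dA(1)]] by auto
  have "op2 (f \<circ> cinv c) (cmap c m) a = op2 (\<lambda>u. (f \<circ> cinv d) (transition c d u)) (cmap c m) a"
    by (rule op2_cong, rule eventually_nhds_open[OF S])
      (use cA dA in \<open>auto simp: transition_cmap cinv_cmap\<close>)
  also have "\<dots> = op2 (f \<circ> cinv d) (transition c d (cmap c m)) (push2 (transition c d) (cmap c m) a)"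
    by (rule op2_compose[OF smooth_transition[OF cA(1) dA(1)] S smooth_on_chart_UNIV[OF f dA(1)]
          open_chart_image[OF dA(1)]])
      (use cA dA in \<open>auto simp: transition_cmap\<close>)
  finally show ?thesis by (simp add: act_def transition_cmap[OF cA])
qed

text \<open>The coordinates and products of coordinates that separate second-order vectors in a
  chart agree near \<open>m\<close> with globally smooth functions, and the action depends only on
  germs.\<close>

lemma act_separates:
  assumes c: "c \<in> charts_at A m" and eq: "\<And>f. f \<in> smooth_funs A UNIV \<Longrightarrow> act f c m a = act f c m b"
  shows "a = b"
proof -
  note cA = charts_atD[OF c]
  have ext: "op2 g (cmap c m) a = op2 g (cmap c m) b" if g: "smooth_on UNIV g" for g
  proof -
    obtain f where f: "f \<in> smooth_funs A UNIV" "eventually (\<lambda>x. f x = g (cmap c x)) (nhds m)"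
      by (rule extend_function[OF c open_UNIV UNIV_I smooth_on_subset[OF g subset_UNIV]]) (rule that)
    have "eventually (\<lambda>u. f (cinv c u) = g (cmap c (cinv c u))) (nhds (cmap c m))"
      using f(2) unfolding eventually_chart[OF c] .
    moreover have "eventually (\<lambda>u. u \<in> cmap c ` cdom c) (nhds (cmap c m))"
      by (rule eventually_nhds_open[OF open_chart_image[OF cA(1)]]) (use cA in auto)
    ultimately have "eventually (\<lambda>u. (f \<circ> cinv c) u = g u) (nhds (cmap c m))"
      by eventually_elim (simp add: cmap_cinv[OF cA(1)])
    then have "act f c m x = op2 g (cmap c m) x" for x unfolding act_def by (rule op2_cong)
    then show ?thesis using eq[OF f(1)] by simp
  qed
  show ?thesis
    by (rule op2_separates[of "cmap c m"]; rule ext; intro smooth_on_mult smooth_on_coord_affine open_UNIV)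
qed

lemma t2_law_push: "t2_law c d m a b \<longleftrightarrow> b = push2 (transition c d) (cmap c m) a"
  by (auto simp: t2_law_def push2_def Let_def prod_eq_iff)

text \<open>Pushing forward preserves the action, and the action separates. The bundle law can thus
  be verified by comparing numbers instead of differentiating transition maps.\<close>

lemma t2_law_iff:
  assumes c: "c \<in> charts_at A m" and d: "d \<in> charts_at A m"
  shows "t2_law c d m a b \<longleftrightarrow> (\<forall>f\<in>smooth_funs A UNIV. act f c m a = act f d m b)"
proof -
  have "b = push2 (transition c d) (cmap c m) a \<longleftrightarrow>
      (\<forall>f\<in>smooth_funs A UNIV. act f d m (push2 (transition c d) (cmap c m) a) = act f d m b)"
    using act_separates[OF d, of "push2 (transition c d) (cmap c m) a" b] by auto
  then show ?thesis by (simp add: t2_law_push act_push[OF c d])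
qed

lemma linear_D1_transition:
  assumes c: "c \<in> charts_at A m" and d: "d \<in> charts_at A m"
  shows "linear (D1 (transition c d) (cmap c m))"
  by (rule linear_D1_smooth[OF smooth_transition open_image])
    (use charts_atD[OF c] charts_atD[OF d] open_cdom in auto)

text \<open>Tangent vectors sit in the second-order bundle as \<open>v \<oplus> 0\<close>, because
  the push-forward of a vector without symmetric part has none. Facts about vector fields can then
  be taken from second-order sections.\<close>

lemma tangent_law_iff:
  assumes c: "c \<in> charts_at A m" and d: "d \<in> charts_at A m"
  shows "tangent_law c d m v w \<longleftrightarrow> t2_law c d m (v, 0) (w, 0)"
proof -
  note cA = charts_atD[OF c] and dA = charts_atD[OF d]
  have "linear (sym_ext (D2 (transition c d) (cmap c m)))"
    by (rule linear_sym_ext_D2[OF smooth_transition open_image])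
      (use cA dA open_cdom in auto)
  from linear_0[OF this] linear_0[OF linear_sym_ext_push[OF linear_D1_transition[OF c d]]]
  show ?thesis by (simp add: tangent_law_def t2_law_def Let_def)
qed

text \<open>With equal charts \<open>act_push\<close> says that both sides act in the same way, so
  no derivative of \<open>transition c c\<close> has to be computed.\<close>

lemma push2_self:
  assumes c: "c \<in> charts_at A m"
  shows "push2 (transition c c) (cmap c m) a = a"
  by (rule act_separates[OF c]) (simp add: act_push[OF c c, symmetric])


subsection \<open>Sections through a given vector\<close>

lemma smooth_sectionsD:
  assumes "\<sigma> \<in> smooth_sections A law"
  shows "c \<in> charts_at A m \<Longrightarrow> d \<in> charts_at A m \<Longrightarrow> law c d m (\<sigma> m c) (\<sigma> m d)"
    and "c \<notin> charts_at A m \<Longrightarrow> \<sigma> m c = 0"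
    and "c \<in> A \<Longrightarrow> smooth_on (cmap c ` cdom c) (rep \<sigma> c)"
  using assms unfolding smooth_sections_def by blast+

lemma rep_cmap: "c \<in> charts_at A m \<Longrightarrow> rep \<sigma> c (cmap c m) = \<sigma> m c"
  by (simp add: rep_def charts_at_def cinv_cmap)

lemma section_eqI:
  assumes "\<sigma> \<in> smooth_sections A law" "\<tau> \<in> smooth_sections A law'"
    and "\<And>m c. c \<in> charts_at A m \<Longrightarrow> \<sigma> m c = \<tau> m c"
  shows "\<sigma> = \<tau>"
proof (intro ext)
  show "\<sigma> m c = \<tau> m c" for m c
    using assms by (cases "c \<in> charts_at A m") (simp_all add: smooth_sectionsD)
qed

lemma act_section:
  assumes "\<tau> \<in> t2_sections A" "c \<in> charts_at A m" "d \<in> charts_at A m" "f \<in> smooth_funs A UNIV"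
  shows "act f c m (\<tau> m c) = act f d m (\<tau> m d)"
  using smooth_sectionsD(1)[OF assms(1)[unfolded t2_sections_def] assms(2,3)]
  unfolding t2_law_iff[OF assms(2,3)] using assms(4) by blast

text \<open>The constant \<open>a\<close> in the chart \<open>c\<close> is pushed to the other
  charts, multiplied by a bump function and extended by zero. The last conclusion keeps track of
  tangent vectors, so that vector fields with prescribed values can be extracted.\<close>

lemma t2_section_through:
  assumes c: "c \<in> charts_at A m"
  obtains \<sigma> where "\<sigma> \<in> t2_sections A" "eventually (\<lambda>x. \<sigma> x c = a) (nhds m)"
    "snd a = 0 \<Longrightarrow> \<forall>x d. snd (\<sigma> x d) = 0"
proof -
  note cA = charts_atD[OF c]
  obtain \<rho> K where \<rho>: "\<rho> \<in> smooth_funs A UNIV" and K: "closed K" "K \<subseteq> cdom c"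
    and \<rho>0: "\<And>x. x \<notin> K \<Longrightarrow> \<rho> x = 0" and \<rho>1: "eventually (\<lambda>x. \<rho> x = (1::real)) (nhds m)"
    by (rule bump_function[OF c open_UNIV UNIV_I]) (rule that, simp_all)
  define \<sigma> where "\<sigma> x d = (if d \<in> charts_at A x \<and> x \<in> cdom c
    then \<rho> x *\<^sub>R push2 (transition c d) (cmap c x) a else 0)" for x d
  have law: "t2_law d e x (\<sigma> x d) (\<sigma> x e)" if d: "d \<in> charts_at A x" and e: "e \<in> charts_at A x" for d e x
    unfolding t2_law_iff[OF d e]
  proof
    fix f assume f: "f \<in> smooth_funs A UNIV"
    \<comment> \<open>The right-hand side refers only to the fixed chart \<open>c\<close> and is
      therefore the same for \<open>d\<close> and \<open>e\<close>.\<close>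
    have "act f d x (\<sigma> x d) = (if x \<in> cdom c then \<rho> x * act f c x a else 0)"
      if d: "d \<in> charts_at A x" for d
      using act_push[OF charts_atI[OF cA(1), of x] d f] linear_act[OF f d] d
      by (simp add: \<sigma>_def linear_cmul linear_0)
    then show "act f d x (\<sigma> x d) = act f e x (\<sigma> x e)" using d e by simp
  qed
  have smooth: "smooth_on (cmap d ` cdom d) (rep \<sigma> d)" if d: "d \<in> A" for d
  proof (rule smooth_on_local)
    fix w assume "w \<in> cmap d ` cdom d"
    then obtain x where x: "x \<in> cdom d" "w = cmap d x" by blast
    show "\<exists>T. open T \<and> w \<in> T \<and> smooth_on T (rep \<sigma> d)"
    proof (cases "x \<in> cdom c")
      case True
      let ?T = "cmap d ` (cdom d \<inter> cdom c)" and ?S = "cmap c ` (cdom c \<inter> cdom d)"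
      have T: "open ?T" and S: "open ?S" using open_image d cA open_cdom by auto
      have "smooth_on ?T (\<lambda>w. (\<rho> \<circ> cinv d) w *\<^sub>R push2 (transition c d) (transition d c w) a)"
      proof (intro smooth_on_scaleR T)
        show "smooth_on ?T (\<rho> \<circ> cinv d)"
          by (rule smooth_on_subset[OF smooth_on_chart_UNIV[OF \<rho> d]]) auto
        show "smooth_on ?T (\<lambda>w. push2 (transition c d) (transition d c w) a)"
          by (rule smooth_on_compose[OF T S smooth_transition[OF d cA(1)]
                smooth_on_push2[OF smooth_transition[OF cA(1) d] S smooth_on_const]])
            (use d in \<open>auto simp: transition_cmap\<close>)
      qed
      then have "smooth_on ?T (rep \<sigma> d)"
        by (rule smooth_on_transform[OF T])
          (use d in \<open>auto simp: rep_def \<sigma>_def cinv_cmap transition_cmap charts_at_def\<close>)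
      then show ?thesis using T True x by blast
    next
      \<comment> \<open>A point outside \<open>cdom c\<close> lies in the complement of the closed
        set \<open>K\<close>, an open set on which the section is 0.\<close>
      case False
      let ?T = "cmap d ` (cdom d \<inter> - K)"
      have T: "open ?T" using open_image[OF d, of "- K"] K by auto
      have "smooth_on ?T (rep \<sigma> d)"
        by (rule smooth_on_transform[OF T smooth_on_const[of _ 0]])
          (use d \<rho>0 in \<open>auto simp: rep_def \<sigma>_def cinv_cmap\<close>)
      then show ?thesis using T False x K by blast
    qed
  qed
  have 1: "\<sigma> \<in> t2_sections A"
    unfolding t2_sections_def smooth_sections_def using law smooth by (auto simp: \<sigma>_def)
  have 2: "eventually (\<lambda>x. \<sigma> x c = a) (nhds m)"
    by (rule eventually_elim2[OF \<rho>1 eventually_cdom[OF c]])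
      (auto simp: \<sigma>_def push2_self dest: charts_atD)
  have 3: "\<forall>x d. snd (\<sigma> x d) = 0" if "snd a = 0"
  proof (intro allI)
    fix x d
    show "snd (\<sigma> x d) = 0"
    proof (cases "d \<in> charts_at A x \<and> x \<in> cdom c")
      case True
      then have "linear (sym_ext (\<lambda>y z. D1 (transition c d) (cmap c x) y \<triangle> D1 (transition c d) (cmap c x) z))"
        using cA by (intro linear_sym_ext_push linear_D1_transition charts_atI) (auto simp: charts_at_def)
      from linear_0[OF this] that show ?thesis by (simp add: \<sigma>_def push2_def)
    qed (auto simp: \<sigma>_def)
  qed
  show ?thesis using that 1 2 3 by blast
qed

lemma vector_field_through:
  assumes c: "c \<in> charts_at A m"
  obtains X where "X \<in> vector_fields A" "eventually (\<lambda>x. X x c = v) (nhds m)"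
proof -
  obtain \<sigma> where \<sigma>: "\<sigma> \<in> t2_sections A" "eventually (\<lambda>x. \<sigma> x c = (v, 0)) (nhds m)"
    "\<forall>x d. snd (\<sigma> x d) = 0"
    by (rule t2_section_through[OF c, of "(v, 0)"]) (rule that, simp_all)
  define X where "X x d = fst (\<sigma> x d)" for x d
  have eq: "\<sigma> x d = (X x d, 0)" for x d using \<sigma>(3)[THEN spec, THEN spec, of x d] by (simp add: X_def prod_eq_iff)
  have "X \<in> vector_fields A"
    unfolding vector_fields_def smooth_sections_def
  proof (intro CollectI conjI allI ballI impI)
    show "tangent_law d e x (X x d) (X x e)" if "d \<in> charts_at A x" "e \<in> charts_at A x" for x d e
      using smooth_sectionsD(1)[OF \<sigma>(1)[unfolded t2_sections_def] that]
      by (simp add: tangent_law_iff[OF that] eq)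
    show "X x d = 0" if "d \<notin> charts_at A x" for x d
      using smooth_sectionsD(2)[OF \<sigma>(1)[unfolded t2_sections_def] that] by (simp add: X_def)
    show "smooth_on (cmap d ` cdom d) (rep X d)" if "d \<in> A" for d
      using smooth_on_fst[OF open_chart_image[OF that]
          smooth_sectionsD(3)[OF \<sigma>(1)[unfolded t2_sections_def] that]]
      by (simp add: X_def rep_def[abs_def])
  qed
  moreover have "eventually (\<lambda>x. X x c = v) (nhds m)"
    using \<sigma>(2) by (rule eventually_mono) (simp add: eq)
  ultimately show ?thesis using that by blast
qed

lemma vector_field_t2_law:
  assumes X: "X \<in> vector_fields A" and c: "c \<in> charts_at A m" and d: "d \<in> charts_at A m"
  shows "t2_law c d m (X m c, 0) (X m d, 0)"
  using smooth_sectionsD(1)[OF X[unfolded vector_fields_def] c d] tangent_law_iff[OF c d] by blast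

text \<open>The chart selected in \<open>vf_apply\<close> may be replaced by any other because
  \<open>X\<close> acts as \<open>X \<oplus> 0\<close>, and that action is chart
  independent.\<close>

lemma vf_apply_chart:
  assumes X: "X \<in> vector_fields A" and f: "f \<in> smooth_funs A UNIV" and c: "c \<in> charts_at A m"
  shows "vf_apply A X f m = D1 (f \<circ> cinv c) (cmap c m) (X m c)"
proof -
  define d where "d = (SOME c. c \<in> charts_at A m)"
  have d: "d \<in> charts_at A m" unfolding d_def using c by (rule someI)
  have *: "act f e m (X m e, 0) = D1 (f \<circ> cinv e) (cmap e m) (X m e)" if "e \<in> charts_at A m" for e
    unfolding act_def
    by (rule op2_fst_snd(1)[OF smooth_on_chart_UNIV[OF f] open_chart_image]) (use charts_atD[OF that] in auto)
  have "vf_apply A X f m = D1 (f \<circ> cinv d) (cmap d m) (X m d)" by (simp add: vf_apply_def d_def Let_def)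
  also have "\<dots> = act f d m (X m d, 0)" by (simp only: *[OF d])
  also have "\<dots> = act f c m (X m c, 0)"
    using vector_field_t2_law[OF X d c] f unfolding t2_law_iff[OF d c] by blast
  finally show ?thesis by (simp only: *[OF c])
qed

lemma smooth_funsI_chart:
  assumes "\<And>c. c \<in> A \<Longrightarrow> smooth_on (cmap c ` cdom c) (f \<circ> cinv c)"
  shows "f \<in> smooth_funs A UNIV"
  using assms by (simp add: smooth_funs_def)

lemma vf_apply_cinv:
  assumes X: "X \<in> vector_fields A" and f: "f \<in> smooth_funs A UNIV" and c: "c \<in> A" and u: "u \<in> cmap c ` cdom c"
  shows "(vf_apply A X f \<circ> cinv c) u = D1 (f \<circ> cinv c) u (rep X c u)"
  using vf_apply_chart[OF X f charts_atI[OF c cinv_in[OF c u]]] by (simp add: cmap_cinv[OF c u] rep_def)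

lemma vf_apply_smooth:
  assumes X: "X \<in> vector_fields A" and f: "f \<in> smooth_funs A UNIV"
  shows "vf_apply A X f \<in> smooth_funs A UNIV"
proof (rule smooth_funsI_chart)
  fix c assume c: "c \<in> A"
  have "smooth_on (cmap c ` cdom c) (\<lambda>u. D1 (f \<circ> cinv c) u (rep X c u))"
    by (intro smooth_on_D1_apply open_chart_image c smooth_on_chart_UNIV f
        smooth_sectionsD(3)[OF X[unfolded vector_fields_def]])
  then show "smooth_on (cmap c ` cdom c) (vf_apply A X f \<circ> cinv c)"
    by (rule smooth_on_transform[OF open_chart_image[OF c]]) (rule vf_apply_cinv[OF X f c])
qed


subsection \<open>The functions in \<open>F\<^sub>m\<^sup>3\<close>\<close>

text \<open>Iterating \<open>D1_op2\<close>: \<open>Z \<cdot> f\<close> is the action of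
  \<open>Z \<oplus> 0\<close>, \<open>Y \<cdot> Z \<cdot> f\<close> is that of a map with symmetric
  part \<open>Y \<triangle> Z\<close>, and one more derivative gives \<open>D3\<close> on
  \<open>X\<close>, \<open>Y\<close>, \<open>Z\<close> plus a second-order term, which vanishes with
  the two-jet.\<close>

lemma third_derivative_flat2:
  assumes X: "X \<in> vector_fields A" and Y: "Y \<in> vector_fields A" and Z: "Z \<in> vector_fields A"
    and f: "f \<in> smooth_funs A UNIV" and c: "c \<in> charts_at A m" and fl: "flat2 (f \<circ> cinv c) (cmap c m)"
  shows "vf_apply A X (vf_apply A Y (vf_apply A Z f)) m =
    D3 (f \<circ> cinv c) (cmap c m) (X m c) (Y m c) (Z m c)"
proof -
  note cA = charts_atD[OF c]
  let ?U = "cmap c ` cdom c" and ?u = "cmap c m"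
  define g where "g = f \<circ> cinv c"
  define \<tau> where "\<tau> u = (rep Z c u, 0 :: 'e sym_square)" for u
  \<comment> \<open>What \<open>D1_op2\<close> yields when \<open>\<tau>\<close> is differentiated
    along \<open>Y\<close>; no third derivative of \<open>f\<close> appears because
    \<open>\<tau>\<close> has symmetric part 0.\<close>
  define \<tau>' where "\<tau>' u = D1 \<tau> u (rep Y c u) + (0, rep Y c u \<triangle> rep Z c u)" for u
  have U: "open ?U" "?u \<in> ?U" using open_chart_image[OF cA(1)] cA(2) by auto
  have g: "smooth_on ?U g" unfolding g_def by (rule smooth_on_chart_UNIV[OF f cA(1)])
  have sY: "smooth_on ?U (rep Y c)" and sZ: "smooth_on ?U (rep Z c)"
    using smooth_sectionsD(3)[OF _ cA(1)] Y Z by (auto simp: vector_fields_def)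
  have s\<tau>: "smooth_on ?U \<tau>" unfolding \<tau>_def by (intro smooth_on_Pair U sZ smooth_on_const)
  have s\<tau>': "smooth_on ?U \<tau>'" unfolding \<tau>'_def
    by (intro smooth_on_add smooth_on_D1_apply smooth_on_Pair smooth_on_const U s\<tau> sY
        smooth_on_bilinear[OF _ bounded_bilinear_sym_prod] sZ)
  have snd\<tau>': "snd (\<tau>' ?u) = Y m c \<triangle> Z m c"
    unfolding \<tau>'_def \<tau>_def
    by (simp add: rep_cmap[OF c] D1_Pair[OF smooth_on_differentiable[OF sZ U(2)] differentiable_const])
  have Zf: "vf_apply A Z f \<in> smooth_funs A UNIV" by (rule vf_apply_smooth[OF Z f])
  have YZf: "vf_apply A Y (vf_apply A Z f) \<in> smooth_funs A UNIV" by (rule vf_apply_smooth[OF Y Zf])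
  have h1: "(vf_apply A Z f \<circ> cinv c) w = op2 g w (\<tau> w)" if "w \<in> ?U" for w
    using vf_apply_cinv[OF Z f cA(1) that] op2_fst_snd(1)[OF g U(1) that] by (simp add: g_def \<tau>_def)
  have h2: "(vf_apply A Y (vf_apply A Z f) \<circ> cinv c) w = op2 g w (\<tau>' w)" if w: "w \<in> ?U" for w
  proof -
    have "(vf_apply A Y (vf_apply A Z f) \<circ> cinv c) w = D1 (vf_apply A Z f \<circ> cinv c) w (rep Y c w)"
      by (rule vf_apply_cinv[OF Y Zf cA(1) w])
    also have "\<dots> = D1 (\<lambda>w. op2 g w (\<tau> w)) w (rep Y c w)"
      by (rule fun_cong[OF D1_cong[OF eventually_nhds_open[OF U(1) w h1]]])
    also have "\<dots> = op2 g w (\<tau>' w)"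
      unfolding D1_op2[OF g U(1) w s\<tau>] using linear_0[OF linear_sym_ext_D3[OF g U(1) w]]
      by (simp add: \<tau>'_def \<tau>_def)
    finally show ?thesis .
  qed
  have "vf_apply A X (vf_apply A Y (vf_apply A Z f)) m
      = D1 (vf_apply A Y (vf_apply A Z f) \<circ> cinv c) ?u (X m c)"
    by (rule vf_apply_chart[OF X YZf c])
  also have "\<dots> = D1 (\<lambda>w. op2 g w (\<tau>' w)) ?u (X m c)"
    by (rule fun_cong[OF D1_cong[OF eventually_nhds_open[OF U h2]]])
  also have "\<dots> = D3 g ?u (X m c) (Y m c) (Z m c)"
    unfolding D1_op2[OF g U s\<tau>'] snd\<tau>' sym_ext_D3_prod[OF g U]
    using flat2_op2[OF g U] fl by (simp add: g_def)
  finally show ?thesis by (simp add: g_def)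
qed

text \<open>A product of three functions vanishing at \<open>m\<close> has vanishing two-jet;
  conversely the triple Hadamard expansion is a sum of such products.\<close>

lemma F3_iff_flat2:
  assumes f: "f \<in> smooth_funs A UNIV" and c: "c \<in> charts_at A m"
  shows "f \<in> F3 A m \<longleftrightarrow> flat2 (f \<circ> cinv c) (cmap c m)"
proof
  note cA = charts_atD[OF c]
  assume "f \<in> F3 A m"
  then obtain W and n :: nat and p q r where W: "open W" "m \<in> W"
    and s: "\<And>i. i < n \<Longrightarrow> p i \<in> smooth_funs A W" "\<And>i. i < n \<Longrightarrow> q i \<in> smooth_funs A W"
      "\<And>i. i < n \<Longrightarrow> r i \<in> smooth_funs A W"
    and z: "\<And>i. i < n \<Longrightarrow> p i m = 0" "\<And>i. i < n \<Longrightarrow> q i m = 0" "\<And>i. i < n \<Longrightarrow> r i m = 0"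
    and eq: "\<And>x. x \<in> W \<Longrightarrow> f x = (\<Sum>i<n. p i x * q i x * r i x)"
    unfolding F3_def by blast
  let ?S = "cmap c ` (cdom c \<inter> W)"
  have S: "open ?S" "cmap c m \<in> ?S" using open_image[OF cA(1) W(1)] cA W by auto
  note s' = s[THEN smooth_on_chart[OF _ cA(1)]]
  have "flat2 (\<lambda>u. \<Sum>i<n. (p i \<circ> cinv c) u * (q i \<circ> cinv c) u * (r i \<circ> cinv c) u) (cmap c m)"
  proof (rule flat2_sum[OF _ _ _ S])
    show "smooth_on ?S (\<lambda>u. (p i \<circ> cinv c) u * (q i \<circ> cinv c) u * (r i \<circ> cinv c) u)" if "i \<in> {..<n}" for i
      using that by (intro smooth_on_mult S s') auto
    show "flat2 (\<lambda>u. (p i \<circ> cinv c) u * (q i \<circ> cinv c) u * (r i \<circ> cinv c) u) (cmap c m)" if "i \<in> {..<n}" for i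
      using that z by (intro flat2_product[OF s' S]) (auto simp: cinv_cmap[OF cA])
  qed simp
  then show "flat2 (f \<circ> cinv c) (cmap c m)"
    by (subst flat2_cong, intro eventually_nhds_open[OF S])
      (use eq in \<open>auto simp: cinv_cmap[OF cA(1)]\<close>)
next
  note cA = charts_atD[OF c]
  assume fl: "flat2 (f \<circ> cinv c) (cmap c m)"
  let ?u = "cmap c m"
  obtain \<epsilon> where \<epsilon>: "\<epsilon> > 0" "ball ?u \<epsilon> \<subseteq> cmap c ` cdom c"
    using open_chart_image[OF cA(1)] cA(2) by (metis imageI openE)
  obtain h where h: "\<And>b a d. smooth_on (ball ?u \<epsilon>) (h b a d)"
    "\<And>x. x \<in> ball ?u \<epsilon> \<Longrightarrow> (f \<circ> cinv c) x = (\<Sum>b\<in>coord_basis. \<Sum>a\<in>coord_basis. \<Sum>d\<in>coord_basis.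
      (coord b x - coord b ?u) * (coord a x - coord a ?u) * ((coord d x - coord d ?u) * h b a d x))"
    by (rule hadamard_flat2[OF smooth_on_subset[OF smooth_on_chart_UNIV[OF f cA(1)] \<epsilon>(2)] \<epsilon>(1) fl]) (rule that)
  \<comment> \<open>The points mapped into the ball, where the expansion is valid and the
    coefficient functions \<open>h\<close> are smooth.\<close>
  define W where "W = cdom c \<inter> cmap c -` ball ?u \<epsilon>"
  have W: "open W" "m \<in> W" "W \<subseteq> cdom c"
    unfolding W_def using cA \<epsilon> by (auto intro!: continuous_open_preimage continuous_on_cmap open_cdom)
  have WB: "cmap c ` W \<subseteq> ball ?u \<epsilon>" by (auto simp: W_def)
  have pull: "(\<lambda>x. g (cmap c x)) \<in> smooth_funs A W" if "smooth_on (ball ?u \<epsilon>) g" for g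
  proof (rule smooth_funsI)
    have "smooth_on (cmap c ` W) ((\<lambda>x. g (cmap c x)) \<circ> cinv c)"
      by (rule smooth_on_transform[OF open_image_subset[OF cA(1) W(1,3)] smooth_on_subset[OF that WB]])
        (use W(3) cmap_cinv[OF cA(1)] in auto)
    then show "\<exists>d\<in>A. \<exists>V. open V \<and> x \<in> V \<and> V \<subseteq> cdom d \<and> smooth_on (cmap d ` V) ((\<lambda>x. g (cmap c x)) \<circ> cinv d)"
      if "x \<in> W" for x using that W cA by blast
  qed
  \<comment> \<open>\<open>F3\<close> is phrased with a single index below a natural number, so the
    triples of basis elements are enumerated.\<close>
  let ?I = "coord_basis \<times> coord_basis \<times> coord_basis :: ('e \<times> 'e \<times> 'e) set"
  have "finite ?I" by (simp add: coord_basis(1))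
  then obtain e where e: "bij_betw e {0..<card ?I} ?I" using ex_bij_betw_nat_finite by blast
  define q where "q b x = coord b (cmap c x) - coord b ?u" for b x
  \<comment> \<open>The third factor absorbs the coefficient \<open>h\<close> together with the last
    coordinate difference, and so still vanishes at \<open>m\<close>.\<close>
  define k where "k t x = q (snd (snd t)) x * h (fst t) (fst (snd t)) (snd (snd t)) (cmap c x)" for t x
  have "f x = (\<Sum>i<card ?I. q (fst (e i)) x * q (fst (snd (e i))) x * k (e i) x)" if x: "x \<in> W" for x
  proof -
    have "f x = (\<Sum>t\<in>?I. q (fst t) x * q (fst (snd t)) x * k t x)"
    proof -
      have "cmap c x \<in> ball ?u \<epsilon>" using WB x by blast
      from h(2)[OF this] show ?thesis
        using x W(3) by (simp add: sum.cartesian_product' q_def k_def cinv_cmap[OF cA(1)] subset_iff)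
    qed
    also have "\<dots> = (\<Sum>i\<in>{0..<card ?I}. q (fst (e i)) x * q (fst (snd (e i))) x * k (e i) x)"
      by (rule sum.reindex_bij_betw[OF e, symmetric])
    finally show ?thesis by (simp add: lessThan_atLeast0)
  qed
  moreover have "q b \<in> smooth_funs A W" for b
    unfolding q_def by (rule pull[OF smooth_on_coord_affine])
  moreover have "k t \<in> smooth_funs A W" for t
    unfolding k_def q_def
    by (rule pull[OF smooth_on_mult[OF open_ball smooth_on_coord_affine h(1)]])
  ultimately show "f \<in> F3 A m"
    unfolding F3_def using W(1,2)
    by (intro CollectI exI[of _ W] exI[of _ "card ?I"] exI[of _ "\<lambda>i. q (fst (e i))"]
        exI[of _ "\<lambda>i. q (fst (snd (e i)))"] exI[of _ "\<lambda>i. k (e i)"])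
      (auto simp: q_def k_def)
qed

end


section \<open>Second-order Taylor polynomials\<close>

definition taylor2 :: "('e::finite_dim_banach \<Rightarrow> real) \<Rightarrow> 'e \<Rightarrow> 'e \<Rightarrow> real"
  where "taylor2 g u w = g u + ((\<Sum>b\<in>coord_basis. D1 g u b * (coord b w - coord b u)) +
    (\<Sum>i\<in>coord_basis. \<Sum>j\<in>coord_basis. (D2 g u i j / 2) * ((coord i w - coord i u) * (coord j w - coord j u))))"

lemma smooth_on_scale: "open S \<Longrightarrow> smooth_on S f \<Longrightarrow> smooth_on S (\<lambda>x. c * f x :: real)"
  by (rule smooth_on_linear_compose[OF _ bounded_linear_mult_right])

lemma smooth_on_taylor2: "smooth_on UNIV (taylor2 g u)"
  unfolding taylor2_def
  by (intro smooth_on_add smooth_on_sum smooth_on_scale smooth_on_mult smooth_on_coord_affine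
      smooth_on_const open_UNIV)

text \<open>A polynomial of degree two has no third derivative, so only the second-order part
  remains; the 1/2 in \<open>taylor2\<close> cancels the factor 2 of
  \<open>op2_coord_mult\<close>.\<close>

lemma op3_taylor2:
  assumes g: "smooth_on S g" "open S" "u \<in> S"
  shows "op3 (taylor2 g u) u x y z a = op2 g u a"
proof -
  note U = open_UNIV UNIV_I
  have s1: "smooth_on UNIV (\<lambda>w. D1 g u b * (coord b w - coord b u))" for b
    by (intro smooth_on_scale smooth_on_coord_affine open_UNIV)
  have s2: "smooth_on UNIV (\<lambda>w. (D2 g u i j / 2) * ((coord i w - coord i u) * (coord j w - coord j u)))" for i j
    by (intro smooth_on_scale smooth_on_mult smooth_on_coord_affine open_UNIV)
  have 1: "op3 (\<lambda>w. D1 g u b * (coord b w - coord b u)) u x y z a = D1 g u b * coord b (fst a)" for b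
    unfolding op3_scale[OF U smooth_on_coord_affine] by (simp add: op3_def D3_coord op2_coord)
  have 2: "op3 (\<lambda>w. (D2 g u i j / 2) * ((coord i w - coord i u) * (coord j w - coord j u))) u x y z a
      = D2 g u i j * sym_coord i j (snd a)" for i j
    unfolding op3_scale[OF U smooth_on_mult[OF open_UNIV smooth_on_coord_affine smooth_on_coord_affine]]
    by (simp add: op3_def D3_coord_mult op2_coord_mult)
  have t1: "smooth_on UNIV (\<lambda>w. \<Sum>b\<in>coord_basis. D1 g u b * (coord b w - coord b u))"
    by (intro smooth_on_sum s1 open_UNIV)
  have t3: "smooth_on UNIV (\<lambda>w. \<Sum>j\<in>coord_basis.
      (D2 g u i j / 2) * ((coord i w - coord i u) * (coord j w - coord j u)))" for i
    by (intro smooth_on_sum s2 open_UNIV)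
  have t2: "smooth_on UNIV (\<lambda>w. \<Sum>i\<in>coord_basis. \<Sum>j\<in>coord_basis.
      (D2 g u i j / 2) * ((coord i w - coord i u) * (coord j w - coord j u)))"
    by (intro smooth_on_sum t3 open_UNIV)
  have "op3 (taylor2 g u) u x y z a = (\<Sum>b\<in>coord_basis. D1 g u b * coord b (fst a)) +
      (\<Sum>i\<in>coord_basis. \<Sum>j\<in>coord_basis. D2 g u i j * sym_coord i j (snd a))"
    unfolding taylor2_def[abs_def] op3_add[OF U smooth_on_const smooth_on_add[OF open_UNIV t1 t2]]
      op3_add[OF U t1 t2] op3_const[OF U] op3_sum[OF U coord_basis(1) s1]
      op3_sum[OF U coord_basis(1) t3] op3_sum[OF U coord_basis(1) s2] 1 2 by simp
  then show ?thesis by (simp add: op2_expansion[OF g] mult.commute)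
qed

text \<open>Reading \<open>op2\<close> as a degenerate \<open>op3\<close> makes the linearity of
  \<open>op3\<close> in the function available for \<open>op2\<close>.\<close>

lemma op2_eq_op3:
  assumes "smooth_on S g" "open S" "u \<in> S"
  shows "op2 g u a = op3 g u 0 0 0 a"
  using linear_0[OF linear_D3_1[OF assms]] by (simp add: op3_def)

text \<open>The explicit factors 1 and -1 give the remainder the shape of the linear combinations in
  the definition of a Hessian structure.\<close>

lemma flat2_taylor2:
  assumes g: "smooth_on S g" "open S" "u \<in> S"
  shows "flat2 (\<lambda>w. 1 * g w + (-1) * taylor2 g u w) u"
proof -
  have t: "smooth_on S (taylor2 g u)" by (rule smooth_on_subset[OF smooth_on_taylor2]) simp
  have s: "smooth_on S (\<lambda>w. 1 * g w)" "smooth_on S (\<lambda>w. (-1) * taylor2 g u w)"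
    by (intro smooth_on_scale g t)+
  note s' = smooth_on_add[OF g(2) s]
  have "op2 (\<lambda>w. 1 * g w + (-1) * taylor2 g u w) u a = 0" for a
    unfolding op2_eq_op3[OF s' g(2,3)] op3_add[OF g(2,3) s] op3_scale[OF g(2,3) g(1)]
      op3_scale[OF g(2,3) t] op3_taylor2[OF g] op2_eq_op3[OF g] by simp
  then show ?thesis by (intro flat2I[OF s' g(2,3)]) (simp_all add: taylor2_def)
qed

lemma sum_coord_delta: "i \<in> coord_basis \<Longrightarrow> (\<Sum>k\<in>coord_basis. coord i k * h k) = h i"
proof -
  assume i: "i \<in> coord_basis"
  have "(\<Sum>k\<in>coord_basis. coord i k * h k) = (\<Sum>k\<in>coord_basis. if i = k then h k else 0)"
    by (intro sum.cong) (auto simp: coord_of_basis)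
  also have "\<dots> = h i" using i by (simp add: coord_basis(1))
  finally show ?thesis .
qed

lemma coord_sum_basis:
  "i \<in> coord_basis \<Longrightarrow> coord i (\<Sum>b\<in>coord_basis. h b *\<^sub>R b) = h i"
  using sum_coord_delta[of i h]
  by (simp add: linear_sum[OF linear_coord] linear_cmul[OF linear_coord] mult.commute)

text \<open>\<open>sym_coord i j\<close> averages the coefficients \<open>h i j\<close> and
  \<open>h j i\<close>; they are recovered because \<open>h\<close> is symmetric.\<close>

lemma sym_coord_sum_basis:
  assumes i: "i \<in> coord_basis" and j: "j \<in> coord_basis" and sym: "\<And>i j. h i j = h j i"
  shows "sym_coord i j (\<Sum>a\<in>coord_basis. \<Sum>b\<in>coord_basis. h a b *\<^sub>R (a \<triangle> b)) = h i j"
proof -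
  have "sym_coord i j (\<Sum>a\<in>coord_basis. \<Sum>b\<in>coord_basis. h a b *\<^sub>R (a \<triangle> b))
      = ((\<Sum>a\<in>coord_basis. coord i a * (\<Sum>b\<in>coord_basis. coord j b * h a b)) +
        (\<Sum>a\<in>coord_basis. coord j a * (\<Sum>b\<in>coord_basis. coord i b * h a b))) / 2"
    by (simp add: linear_sum[OF linear_sym_coord] linear_cmul[OF linear_sym_coord] sym_coord_prod
        sum_distrib_left sum_divide_distrib sum.distrib[symmetric] algebra_simps)
  also have "\<dots> = h i j" using i j sym[of i j] by (simp add: sum_coord_delta)
  finally show ?thesis .
qed


section \<open>Christoffel symbols of a Hessian structure\<close>

type_synonym 'e chr1 = "'e \<Rightarrow> 'e \<Rightarrow>\<^sub>L 'e sym_square \<Rightarrow>\<^sub>L 'e"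
type_synonym 'e chr2 = "'e \<Rightarrow> 'e \<Rightarrow>\<^sub>L 'e sym_square \<Rightarrow>\<^sub>L 'e sym_square"
type_synonym ('m, 'e) hess = "('m \<Rightarrow> real) \<Rightarrow> ('m, 'e, 'e \<Rightarrow>\<^sub>L 'e \<Rightarrow>\<^sub>L 'e \<Rightarrow>\<^sub>L real) family"

context smooth_manifold
begin

text \<open>The asserted formula for global functions and arbitrary vectors at a point. The values
  of \<open>R\<close> and \<open>C\<close> off the chart image stay unconstrained.\<close>

definition hess_form :: "('m, 'e) hess \<Rightarrow> ('m, 'e) chart \<Rightarrow> 'e chr1 \<Rightarrow> 'e chr2 \<Rightarrow> bool"
  where "hess_form K c R C \<longleftrightarrow>
    smooth_on (cmap c ` cdom c) R \<and> smooth_on (cmap c ` cdom c) C \<and>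
    (\<forall>f\<in>smooth_funs A UNIV. \<forall>m\<in>cdom c. \<forall>x y z. K f m c x y z =
      op3 (f \<circ> cinv c) (cmap c m) x y z (R (cmap c m) x (y \<triangle> z), C (cmap c m) x (y \<triangle> z)))"

text \<open>The third-derivative terms cancel, so for all \<open>x\<close>, \<open>y\<close>,
  \<open>z\<close> the two values of \<open>R \<oplus> C\<close> act equally on functions and
  coincide. Linear maps on the symmetric square are determined by elements
  \<open>y \<triangle> z\<close>.\<close>

lemma hess_form_unique:
  assumes "hess_form K c R C" "hess_form K c R' C'" and c: "c \<in> A" and u: "u \<in> cmap c ` cdom c"
  shows "R u = R' u \<and> C u = C' u"
proof -
  define m where "m = cinv c u"
  have m: "m \<in> cdom c" "cmap c m = u" using cinv_in[OF c u] cmap_cinv[OF c u] by (simp_all add: m_def)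
  have eq: "(R u x (y \<triangle> z), C u x (y \<triangle> z)) = (R' u x (y \<triangle> z), C' u x (y \<triangle> z))" for x y z
  proof (rule act_separates[OF charts_atI[OF c m(1)]])
    fix f assume f: "f \<in> smooth_funs A UNIV"
    have "op3 (f \<circ> cinv c) u x y z (R u x (y \<triangle> z), C u x (y \<triangle> z))
        = op3 (f \<circ> cinv c) u x y z (R' u x (y \<triangle> z), C' u x (y \<triangle> z))"
      using assms(1,2) f m unfolding hess_form_def by metis
    then show "act f c m (R u x (y \<triangle> z), C u x (y \<triangle> z)) = act f c m (R' u x (y \<triangle> z), C' u x (y \<triangle> z))"
      by (simp add: act_def m op3_def)
  qed
  have lin: "linear (\<lambda>s. blinfun_apply B s)" for B :: "'e sym_square \<Rightarrow>\<^sub>L 'b::real_normed_vector"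
    by (rule bounded_linear.linear[OF blinfun.bounded_linear_right])
  have RC: "R u x (y \<triangle> z) = R' u x (y \<triangle> z)" "C u x (y \<triangle> z) = C' u x (y \<triangle> z)" for x y z
    using eq[of x y z] by simp_all
  have "R u x s = R' u x s" "C u x s = C' u x s" for x s
    by (rule sym_linear_eqI[OF lin lin], rule RC)+
  then show ?thesis by (intro conjI blinfun_eqI)
qed

context
  fixes K :: "('m, 'e) hess"
  assumes K: "third_order_hessian A K"
begin

lemma hess_cov3: "f \<in> smooth_funs A UNIV \<Longrightarrow> K f \<in> cov3_fields A"
  using K by (auto simp: third_order_hessian_def)

lemma hess_lincomb:
  assumes "f \<in> smooth_funs A UNIV" "g \<in> smooth_funs A UNIV"
  shows "K (\<lambda>x. a * f x + b * g x) m c x y z = a * K f m c x y z + b * K g m c x y z"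
proof -
  have "K (\<lambda>x. a * f x + b * g x) = add_field (scale_field (\<lambda>_. a) (K f)) (scale_field (\<lambda>_. b) (K g))"
    using K assms unfolding third_order_hessian_def by blast
  then show ?thesis by (simp add: add_field_def scale_field_def blinfun.bilinear_simps)
qed

text \<open>The defining condition speaks of vector fields; the given vectors are extended to
  fields, whose iterated derivative on a function with vanishing two-jet is the third derivative in
  the chart.\<close>

lemma hess_flat2:
  assumes f: "f \<in> smooth_funs A UNIV" and c: "c \<in> charts_at A m" and fl: "flat2 (f \<circ> cinv c) (cmap c m)"
  shows "K f m c x y z = D3 (f \<circ> cinv c) (cmap c m) x y z"
proof -
  obtain X where X: "X \<in> vector_fields A" "eventually (\<lambda>p. X p c = x) (nhds m)"
    by (rule vector_field_through[OF c]) (rule that)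
  obtain Y where Y: "Y \<in> vector_fields A" "eventually (\<lambda>p. Y p c = y) (nhds m)"
    by (rule vector_field_through[OF c]) (rule that)
  obtain Z where Z: "Z \<in> vector_fields A" "eventually (\<lambda>p. Z p c = z) (nhds m)"
    by (rule vector_field_through[OF c]) (rule that)
  have eq: "X m c = x" "Y m c = y" "Z m c = z"
    using eventually_nhds_x_imp_x[OF X(2)] eventually_nhds_x_imp_x[OF Y(2)] eventually_nhds_x_imp_x[OF Z(2)]
    by auto
  have "f \<in> smooth_funs A UNIV \<inter> F3 A m" using f fl F3_iff_flat2[OF f c] by blast
  then have "K f m c (X m c) (Y m c) (Z m c) = vf_apply A X (vf_apply A Y (vf_apply A Z f)) m"
    using K X Y Z c unfolding third_order_hessian_def by blast
  then show ?thesis using third_derivative_flat2[OF X(1) Y(1) Z(1) f c fl] by (simp add: eq)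
qed

text \<open>The difference has zero germ, hence vanishing two-jet, so its value under
  \<open>K\<close> at \<open>m\<close> is a third derivative, namely 0.\<close>

lemma hess_local:
  assumes f: "f \<in> smooth_funs A UNIV" and g: "g \<in> smooth_funs A UNIV"
    and c: "c \<in> charts_at A m" and ev: "eventually (\<lambda>x. f x = g x) (nhds m)"
  shows "K f m c = K g m c"
proof -
  define h where "h x = 1 * f x + (-1) * g x" for x
  have h: "h \<in> smooth_funs A UNIV" unfolding h_def by (rule smooth_funs_lincomb[OF f g])
  have "eventually (\<lambda>x. h x = 0) (nhds m)" using ev by (rule eventually_mono) (simp add: h_def)
  then have ev0: "eventually (\<lambda>u. (h \<circ> cinv c) u = 0) (nhds (cmap c m))"
    unfolding eventually_chart[OF c] by simp
  have fl: "flat2 (h \<circ> cinv c) (cmap c m)"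
    unfolding flat2_cong[OF ev0] by (simp add: flat2_def D2_def)
  have "K h m c x y z = 0" for x y z
    unfolding hess_flat2[OF h c fl] D3_cong[OF ev0] by (simp add: D3_def D2_def)
  then have "K f m c x y z = K g m c x y z" for x y z
    unfolding h_def hess_lincomb[OF f g] by simp
  then show ?thesis by (intro blinfun_eqI) simp
qed

text \<open>The functions \<open>g m\<close> are chosen point by point and need not vary regularly.
  Near a given point \<open>m\<close>, however, each \<open>g p\<close> has at \<open>p\<close> the
  germ of the one function \<open>g m\<close>, so by locality the map agrees there with the smooth
  section \<open>K (g m)\<close>.\<close>

lemma hess_germ_smooth:
  assumes c: "c \<in> A" and g: "\<And>m. m \<in> cdom c \<Longrightarrow> g m \<in> smooth_funs A UNIV"
    and \<phi>: "\<And>m. m \<in> cdom c \<Longrightarrow> eventually (\<lambda>x. g m x = \<phi> x) (nhds m)"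
  shows "smooth_on (cmap c ` cdom c) (\<lambda>u. K (g (cinv c u)) (cinv c u) c)"
proof (rule smooth_on_local)
  fix u assume u: "u \<in> cmap c ` cdom c"
  define m where "m = cinv c u"
  have m: "m \<in> cdom c" "cmap c m = u" using cinv_in[OF c u] cmap_cinv[OF c u] by (simp_all add: m_def)
  obtain W where W: "open W" "m \<in> W" "\<And>x. x \<in> W \<Longrightarrow> g m x = \<phi> x"
    using \<phi>[OF m(1)] unfolding eventually_nhds by blast
  let ?T = "cmap c ` (cdom c \<inter> W)"
  have T: "open ?T" "u \<in> ?T" using open_image[OF c W(1)] m W by auto
  have "smooth_on ?T (rep (K (g m)) c)"
    by (rule smooth_on_subset[OF smooth_sectionsD(3)[OF hess_cov3[OF g[OF m(1)], unfolded cov3_fields_def] c]]) auto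
  then have "smooth_on ?T (\<lambda>u. K (g (cinv c u)) (cinv c u) c)"
  proof (rule smooth_on_transform[OF T(1)])
    fix w assume "w \<in> ?T"
    then obtain p where p: "p \<in> cdom c" "p \<in> W" "w = cmap c p" by blast
    have "eventually (\<lambda>x. g p x = g m x) (nhds p)"
      using \<phi>[OF p(1)] eventually_nhds_open[OF W(1) p(2), of "\<lambda>x. g m x = \<phi> x"] W(3)
      by (auto elim: eventually_elim2)
    from hess_local[OF g[OF p(1)] g[OF m(1)] charts_atI[OF c p(1)] this]
    show "K (g (cinv c w)) (cinv c w) c = rep (K (g m)) c w"
      by (simp add: p(3) cinv_cmap[OF c p(1)] rep_def)
  qed
  then show "\<exists>T. open T \<and> u \<in> T \<and> smooth_on T (\<lambda>u. K (g (cinv c u)) (cinv c u) c)" using T by blast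
qed

text \<open>The formula leaves no choice: on a coordinate, whose higher derivatives vanish, it
  determines \<open>R\<close>; on a product of two coordinates centred at the point, whose
  differential vanishes there, it determines twice a coordinate of \<open>C\<close>.\<close>

lemma hess_form_exists:
  assumes kc: "kills_constants K" and sym: "symmetric_in_last_two A K" and c: "c \<in> A"
  shows "\<exists>R C. hess_form K c R C"
proof -
  let ?U = "cmap c ` cdom c"
  have U: "open ?U" by (rule open_chart_image[OF c])
  have "\<exists>g. g \<in> smooth_funs A UNIV \<and> eventually (\<lambda>x. g x = coord b (cmap c x)) (nhds m)"
    if m: "m \<in> cdom c" for b m
  proof -
    have "smooth_on (cmap c ` (cdom c \<inter> UNIV)) (coord b)"
      by (rule smooth_on_bounded_linear[OF bounded_linear_coord])
    then obtain g where "g \<in> smooth_funs A UNIV" "eventually (\<lambda>x. g x = coord b (cmap c x)) (nhds m)"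
      by (rule extend_function[OF charts_atI[OF c m] open_UNIV UNIV_I]) (rule that)
    then show ?thesis by blast
  qed
  note ex = someI_ex[OF this]
  \<comment> \<open>A globally smooth function with the germ of a coordinate at \<open>m\<close>;
    the choice depends on \<open>m\<close>.\<close>
  define G where "G b m = (SOME g. g \<in> smooth_funs A UNIV \<and> eventually (\<lambda>x. g x = coord b (cmap c x)) (nhds m))"
    for b m
  have G: "G b m \<in> smooth_funs A UNIV" "eventually (\<lambda>x. G b m x = coord b (cmap c x)) (nhds m)"
    if "m \<in> cdom c" for b m
    using ex[OF that, of b] unfolding G_def by blast+
  define G2 where "G2 i j m x = G i m x * G j m x" for i j m x
  have G2: "G2 i j m \<in> smooth_funs A UNIV"
    "eventually (\<lambda>x. G2 i j m x = coord i (cmap c x) * coord j (cmap c x)) (nhds m)"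
    if "m \<in> cdom c" for i j m
    unfolding G2_def
    by (intro smooth_funs_mult open_UNIV G that)
      (rule eventually_elim2[OF G(2)[OF that, of i] G(2)[OF that, of j]], simp)
  define P where "P b u = K (G b (cinv c u)) (cinv c u) c" for b u
  define P2 where "P2 i j u = K (G2 i j (cinv c u)) (cinv c u) c" for i j u
  have sP: "smooth_on ?U (P b)" for b
    unfolding P_def by (rule hess_germ_smooth[OF c G])
  have sP2: "smooth_on ?U (P2 i j)" for i j
    unfolding P2_def by (rule hess_germ_smooth[OF c G2])
  \<comment> \<open>half the value of \<open>K\<close> on the product of the two coordinates centred at \<open>u\<close>\<close>
  define q where "q u x y z i j = (P2 i j u x y z - coord i u * P j u x y z - coord j u * P i u x y z) / 2"
    for u x y z i j
  define \<beta>1 where "\<beta>1 u x y z = (\<Sum>b\<in>coord_basis. P b u x y z *\<^sub>R b)" for u x y z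
  define \<beta>2 where "\<beta>2 u x y z = (\<Sum>i\<in>coord_basis. \<Sum>j\<in>coord_basis. q u x y z i j *\<^sub>R (i \<triangle> j))" for u x y z
  define R where "R u = mk_sym (\<beta>1 u)" for u
  define C where "C u = mk_sym (\<beta>2 u)" for u
  have sapp: "smooth_on ?U (\<lambda>u. B u x y z)" if "smooth_on ?U B" for B :: "'e \<Rightarrow> 'e \<Rightarrow>\<^sub>L 'e \<Rightarrow>\<^sub>L 'e \<Rightarrow>\<^sub>L real" and x y z
    by (intro smooth_on_blinfun_apply U that smooth_on_const)
  have sR: "smooth_on ?U R"
    unfolding R_def \<beta>1_def
    by (intro smooth_on_mk_sym smooth_on_sum smooth_on_scaleR smooth_on_const U sapp sP)
  have sC: "smooth_on ?U C"
  proof -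
    have "smooth_on ?U (\<lambda>u. (1/2) * (P2 i j u x y z - coord i u * P j u x y z - coord j u * P i u x y z))"
      for x y z i j
      by (intro smooth_on_scale smooth_on_diff smooth_on_mult smooth_on_bounded_linear[OF bounded_linear_coord]
          U sapp sP sP2)
    then have "smooth_on ?U (\<lambda>u. q u x y z i j)" for x y z i j by (simp add: q_def)
    then show ?thesis unfolding C_def \<beta>2_def
      by (intro smooth_on_mk_sym smooth_on_sum smooth_on_scaleR smooth_on_const U)
  qed
  have "K f m c x y z = op3 (f \<circ> cinv c) (cmap c m) x y z (R (cmap c m) x (y \<triangle> z), C (cmap c m) x (y \<triangle> z))"
    if f: "f \<in> smooth_funs A UNIV" and m: "m \<in> cdom c" for f m x y z
  proof -
    define u where "u = cmap c m"
    have u: "u \<in> ?U" "cinv c u = m" using m by (simp_all add: u_def cinv_cmap[OF c])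
    have cm: "c \<in> charts_at A m" by (rule charts_atI[OF c m])
    \<comment> \<open>Symmetry in the last two arguments is what lets \<open>\<beta>1\<close> and
      \<open>\<beta>2\<close> factor through the symmetric square.\<close>
    have symK: "K g m c x y z = K g m c x z y" if "g \<in> smooth_funs A UNIV" for g x y z
      using sym that cm unfolding symmetric_in_last_two_def by blast
    have symP: "P b u x y z = P b u x z y" "P2 i j u x y z = P2 i j u x z y" for b i j x y z
      unfolding P_def P2_def u by (intro symK G G2 m)+
    have R: "R u x (y \<triangle> z) = \<beta>1 u x y z"
      unfolding R_def
    proof (rule mk_sym_apply)
      show "linear (\<lambda>x. \<beta>1 u x y z)" "linear (\<lambda>y. \<beta>1 u x y z)" for x y z
        by (rule linearI; simp add: \<beta>1_def blinfun.bilinear_simps scaleR_add_left sum.distrib scaleR_sum_right)+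
      show "\<beta>1 u x y z = \<beta>1 u x z y" for x y z unfolding \<beta>1_def by (simp only: symP(1)[of _ x y z])
    qed
    have C: "C u x (y \<triangle> z) = \<beta>2 u x y z"
      unfolding C_def
    proof (rule mk_sym_apply)
      have q_add: "q u (x + x') y z i j = q u x y z i j + q u x' y z i j"
        "q u x (y + y') z i j = q u x y z i j + q u x y' z i j" for x x' y y' z i j
        by (simp_all add: q_def blinfun.bilinear_simps field_simps)
      have q_scale: "q u (r *\<^sub>R x) y z i j = r * q u x y z i j" "q u x (r *\<^sub>R y) z i j = r * q u x y z i j"
        for r x y z i j
        by (simp_all add: q_def blinfun.bilinear_simps field_simps)
      show "linear (\<lambda>x. \<beta>2 u x y z)" "linear (\<lambda>y. \<beta>2 u x y z)" for x y z
        by (rule linearI; simp add: \<beta>2_def q_add q_scale scaleR_add_left sum.distrib scaleR_sum_right)+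
      have q_sym: "q u x y z i j = q u x z y i j" for x y z i j
        by (simp only: q_def symP(1)[of _ x y z] symP(2)[of _ _ x y z])
      show "\<beta>2 u x y z = \<beta>2 u x z y" for x y z
        unfolding \<beta>2_def by (simp only: q_sym[of x y z])
    qed
    define a where "a = (R u x (y \<triangle> z), C u x (y \<triangle> z))"
    have a1: "coord b (fst a) = P b u x y z" if "b \<in> coord_basis" for b
      by (simp add: a_def R \<beta>1_def coord_sum_basis[OF that])
    have a2: "sym_coord i j (snd a) = q u x y z i j" if "i \<in> coord_basis" "j \<in> coord_basis" for i j
    proof -
      \<comment> \<open>Products commute, so the coefficients \<open>q\<close> are symmetric in
        \<open>i\<close> and \<open>j\<close>, as is required for reading them off again.\<close>
      have "G2 i j = G2 j i" for i j by (simp add: G2_def fun_eq_iff mult.commute)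
      then have "q u x y z i j = q u x y z j i" for i j by (simp add: q_def P2_def)
      then show ?thesis by (simp add: a_def C \<beta>2_def sym_coord_sum_basis[OF that])
    qed
    \<comment> \<open>the subspace of functions on which the formula holds at \<open>m\<close>\<close>
    define Z where "Z = {g \<in> smooth_funs A UNIV. K g m c x y z = op3 (g \<circ> cinv c) u x y z a}"
    have sm: "smooth_on ?U (g \<circ> cinv c)" if "g \<in> smooth_funs A UNIV" for g
      by (rule smooth_on_chart_UNIV[OF that c])
    have Z_lin: "(\<lambda>x. \<alpha> * g x + \<gamma> * h x) \<in> Z" if "g \<in> Z" "h \<in> Z" for g h \<alpha> \<gamma>
    proof -
      have g: "g \<in> smooth_funs A UNIV" and h: "h \<in> smooth_funs A UNIV" using that by (auto simp: Z_def)
      have "op3 ((\<lambda>x. \<alpha> * g x + \<gamma> * h x) \<circ> cinv c) u x y z a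
          = op3 (\<lambda>w. \<alpha> * (g \<circ> cinv c) w + \<gamma> * (h \<circ> cinv c) w) u x y z a"
        by (simp add: o_def)
      also have "\<dots> = \<alpha> * op3 (g \<circ> cinv c) u x y z a + \<gamma> * op3 (h \<circ> cinv c) u x y z a"
        unfolding op3_add[OF U u(1) smooth_on_scale[OF U sm[OF g]] smooth_on_scale[OF U sm[OF h]]]
          op3_scale[OF U u(1) sm[OF g]] op3_scale[OF U u(1) sm[OF h]] ..
      finally show ?thesis
        using that smooth_funs_lincomb[OF g h] by (simp add: Z_def hess_lincomb[OF g h])
    qed
    \<comment> \<open>Here \<open>K\<close> has to annihilate constants, as the right-hand side of
      the formula does.\<close>
    have Z_const: "(\<lambda>_. \<alpha>) \<in> Z" for \<alpha>
      using kc by (simp add: Z_def smooth_funs_const kills_constants_def zero_field_def o_def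
          op3_const[OF U u(1)])
    have Z_scale: "(\<lambda>x. \<alpha> * g x) \<in> Z" if "g \<in> Z" for g \<alpha>
      using Z_lin[OF that that, of \<alpha> 0] by simp
    have Z_add: "(\<lambda>x. g x + h x) \<in> Z" if "g \<in> Z" "h \<in> Z" for g h
      using Z_lin[OF that, of 1 1] by simp
    have Z_sum: "(\<lambda>x. \<Sum>i\<in>I. g i x) \<in> Z" if "finite I" "\<And>i. i \<in> I \<Longrightarrow> g i \<in> Z" for I :: "'e set" and g
      using that by (induction I rule: finite_induct) (auto intro: Z_const Z_add)
    have Z_G: "G b m \<in> Z" if b: "b \<in> coord_basis" for b
    proof -
      have ev: "eventually (\<lambda>w. (G b m \<circ> cinv c) w = coord b w - 0) (nhds u)"
        using G(2)[OF m, of b] eventually_nhds_open[OF U u(1), of "\<lambda>w. cmap c (cinv c w) = w"] cmap_cinv[OF c]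
        unfolding eventually_chart[OF cm] u_def[symmetric] by (auto elim: eventually_elim2)
      have "op3 (G b m \<circ> cinv c) u x y z a = coord b (fst a)"
        unfolding op3_cong[OF ev] by (simp only: op3_def D3_coord op2_coord add_0)
      then show ?thesis using G(1)[OF m] a1[OF b] by (simp add: Z_def P_def u)
    qed
    have Z_G2: "G2 i j m \<in> Z" if i: "i \<in> coord_basis" and j: "j \<in> coord_basis" for i j
    proof -
      have ev: "eventually (\<lambda>w. (G2 i j m \<circ> cinv c) w = (coord i w - 0) * (coord j w - 0)) (nhds u)"
        using G2(2)[OF m, of i j] eventually_nhds_open[OF U u(1), of "\<lambda>w. cmap c (cinv c w) = w"] cmap_cinv[OF c]
        unfolding eventually_chart[OF cm] u_def[symmetric] by (auto elim: eventually_elim2)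
      have "op3 (G2 i j m \<circ> cinv c) u x y z a
          = coord i u * coord j (fst a) + coord j u * coord i (fst a) + 2 * sym_coord i j (snd a)"
        unfolding op3_cong[OF ev] unfolding op3_def D3_coord_mult op2_coord_mult by simp
      also have "\<dots> = P2 i j u x y z" unfolding a1[OF i] a1[OF j] a2[OF i j] q_def by (simp add: field_simps)
      finally show ?thesis using G2(1)[OF m] by (simp add: Z_def P2_def u)
    qed
    define g where "g = f \<circ> cinv c"
    have g: "smooth_on ?U g" unfolding g_def by (rule sm[OF f])
    \<comment> \<open>A global function, built from the functions \<open>G\<close> so that it lies
      in \<open>Z\<close>, whose germ at \<open>m\<close> is that of the Taylor polynomial of
      \<open>f\<close>.\<close>
    define S where "S p = g u + ((\<Sum>b\<in>coord_basis. D1 g u b * (G b m p - coord b u)) +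
      (\<Sum>i\<in>coord_basis. \<Sum>j\<in>coord_basis. (D2 g u i j / 2) * ((G i m p - coord i u) * (G j m p - coord j u))))" for p
    have Zq: "(\<lambda>p. G b m p - coord b u) \<in> Z" if "b \<in> coord_basis" for b
      using Z_add[OF Z_G[OF that] Z_const[of "- coord b u"]] by simp
    have Zq2: "(\<lambda>p. (G i m p - coord i u) * (G j m p - coord j u)) \<in> Z"
      if "i \<in> coord_basis" "j \<in> coord_basis" for i j
    proof -
      have "(\<lambda>p. G2 i j m p + (- coord j u * G i m p + (- coord i u * G j m p + coord i u * coord j u))) \<in> Z"
        by (intro Z_add Z_scale Z_const Z_G Z_G2 that)
      then show ?thesis by (simp add: G2_def algebra_simps)
    qed
    have ZS: "S \<in> Z"
      unfolding S_def by (intro Z_add Z_const Z_sum Z_scale Zq Zq2 coord_basis(1))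
    then have S: "S \<in> smooth_funs A UNIV" by (simp add: Z_def)
    have "eventually (\<lambda>p. \<forall>b\<in>coord_basis. G b m p = coord b (cmap c p)) (nhds m)"
      by (intro eventually_ball_finite coord_basis(1) ballI G(2) m)
    then have "eventually (\<lambda>p. S p = taylor2 g u (cmap c p)) (nhds m)"
      by (rule eventually_mono) (simp add: S_def taylor2_def)
    then have evS: "eventually (\<lambda>w. (S \<circ> cinv c) w = taylor2 g u w) (nhds u)"
      using eventually_nhds_open[OF U u(1), of "\<lambda>w. cmap c (cinv c w) = w"] cmap_cinv[OF c]
      unfolding eventually_chart[OF cm] u_def[symmetric] by (auto elim: eventually_elim2)
    define h where "h p = 1 * f p + (-1) * S p" for p
    have h: "h \<in> smooth_funs A UNIV" unfolding h_def by (rule smooth_funs_lincomb[OF f S])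
    have "eventually (\<lambda>w. (h \<circ> cinv c) w = 1 * g w + (-1) * taylor2 g u w) (nhds u)"
      using evS by (rule eventually_mono) (simp add: h_def g_def)
    from flat2_cong[OF this] have fl: "flat2 (h \<circ> cinv c) u" using flat2_taylor2[OF g U u(1)] by (rule iffD2)
    \<comment> \<open>On the remainder both sides are the third derivative of \<open>h\<close>:
      \<open>K\<close> by the Hessian condition, the formula because its second-order part vanishes
      with the two-jet.\<close>
    have "h \<in> Z"
      using hess_flat2[OF h cm fl[unfolded u_def], folded u_def] flat2_op2[OF sm[OF h] U u(1) fl] h
      by (simp add: Z_def op3_def)
    from Z_add[OF this ZS] have "f \<in> Z" by (simp add: h_def)
    then show ?thesis by (simp add: Z_def a_def u_def)
  qed
  then have "hess_form K c R C" using sR sC by (simp add: hess_form_def)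
  then show ?thesis by blast
qed

end


section \<open>Special second-order connections\<close>


lemma sections_add:
  assumes \<sigma>: "\<sigma> \<in> smooth_sections A law" and \<tau>: "\<tau> \<in> smooth_sections A law"
    and law: "\<And>c d m a b a' b'. c \<in> charts_at A m \<Longrightarrow> d \<in> charts_at A m \<Longrightarrow>
      law c d m a b \<Longrightarrow> law c d m a' b' \<Longrightarrow> law c d m (a + a') (b + b')"
  shows "add_field \<sigma> \<tau> \<in> smooth_sections A law"
  unfolding smooth_sections_def add_field_def
proof (intro CollectI conjI allI ballI impI)
  show "law c d m (\<sigma> m c + \<tau> m c) (\<sigma> m d + \<tau> m d)" if "c \<in> charts_at A m" "d \<in> charts_at A m" for m c d
    by (rule law[OF that smooth_sectionsD(1)[OF \<sigma> that] smooth_sectionsD(1)[OF \<tau> that]])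
  show "\<sigma> m c + \<tau> m c = 0" if "c \<notin> charts_at A m" for m c
    using smooth_sectionsD(2)[OF \<sigma> that] smooth_sectionsD(2)[OF \<tau> that] by simp
  show "smooth_on (cmap c ` cdom c) (rep (\<lambda>m c. \<sigma> m c + \<tau> m c) c)" if "c \<in> A" for c
    using smooth_on_add[OF open_chart_image[OF that] smooth_sectionsD(3)[OF \<sigma> that]
        smooth_sectionsD(3)[OF \<tau> that]]
    by (simp add: rep_def[abs_def])
qed

lemma sections_scale:
  assumes \<sigma>: "\<sigma> \<in> smooth_sections A law" and f: "f \<in> smooth_funs A UNIV"
    and law: "\<And>c d m a b r. c \<in> charts_at A m \<Longrightarrow> d \<in> charts_at A m \<Longrightarrow>
      law c d m a b \<Longrightarrow> law c d m (r *\<^sub>R a) (r *\<^sub>R b)"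
  shows "scale_field f \<sigma> \<in> smooth_sections A law"
  unfolding smooth_sections_def scale_field_def
proof (intro CollectI conjI allI ballI impI)
  show "law c d m (f m *\<^sub>R \<sigma> m c) (f m *\<^sub>R \<sigma> m d)" if "c \<in> charts_at A m" "d \<in> charts_at A m" for m c d
    by (rule law[OF that smooth_sectionsD(1)[OF \<sigma> that]])
  show "f m *\<^sub>R \<sigma> m c = 0" if "c \<notin> charts_at A m" for m c
    using smooth_sectionsD(2)[OF \<sigma> that] by simp
  show "smooth_on (cmap c ` cdom c) (rep (\<lambda>m c. f m *\<^sub>R \<sigma> m c) c)" if "c \<in> A" for c
    using smooth_on_scaleR[OF open_chart_image[OF that] smooth_on_chart_UNIV[OF f that]
        smooth_sectionsD(3)[OF \<sigma> that]]
    by (simp add: rep_def[abs_def])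
qed

lemma t2_law_add:
  assumes c: "c \<in> charts_at A m" and d: "d \<in> charts_at A m"
    and "t2_law c d m a b" "t2_law c d m a' b'"
  shows "t2_law c d m (a + a') (b + b')"
  using assms(3,4) unfolding t2_law_iff[OF c d]
  by (simp add: linear_add[OF linear_act] c d)

lemma t2_law_scale:
  assumes c: "c \<in> charts_at A m" and d: "d \<in> charts_at A m" and "t2_law c d m a b"
  shows "t2_law c d m (r *\<^sub>R a) (r *\<^sub>R b)"
  using assms(3) unfolding t2_law_iff[OF c d]
  by (simp add: linear_cmul[OF linear_act] c d)

lemma tangent_law_add:
  assumes c: "c \<in> charts_at A m" and d: "d \<in> charts_at A m"
    and "tangent_law c d m v w" "tangent_law c d m v' w'"
  shows "tangent_law c d m (v + v') (w + w')"
  using assms(3,4) by (simp add: tangent_law_def linear_add[OF linear_D1_transition[OF c d]])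

lemma tangent_law_scale:
  assumes c: "c \<in> charts_at A m" and d: "d \<in> charts_at A m" and "tangent_law c d m v w"
  shows "tangent_law c d m (r *\<^sub>R v) (r *\<^sub>R w)"
  using assms(3) by (simp add: tangent_law_def linear_cmul[OF linear_D1_transition[OF c d]])

lemma vector_fields_add:
  "X \<in> vector_fields A \<Longrightarrow> Y \<in> vector_fields A \<Longrightarrow> add_field X Y \<in> vector_fields A"
  unfolding vector_fields_def by (rule sections_add) (auto intro: tangent_law_add)

lemma vector_fields_scale:
  "X \<in> vector_fields A \<Longrightarrow> f \<in> smooth_funs A UNIV \<Longrightarrow> scale_field f X \<in> vector_fields A"
  unfolding vector_fields_def by (rule sections_scale) (auto intro: tangent_law_scale)

lemma t2_sections_add:
  "\<sigma> \<in> t2_sections A \<Longrightarrow> \<tau> \<in> t2_sections A \<Longrightarrow> add_field \<sigma> \<tau> \<in> t2_sections A"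
  unfolding t2_sections_def by (rule sections_add) (auto intro: t2_law_add)

lemma t2_sections_scale:
  "\<tau> \<in> t2_sections A \<Longrightarrow> f \<in> smooth_funs A UNIV \<Longrightarrow> scale_field f \<tau> \<in> t2_sections A"
  unfolding t2_sections_def by (rule sections_scale) (auto intro: t2_law_scale)

lemmas vector_fieldsD = smooth_sectionsD[where law = tangent_law, folded vector_fields_def]
lemmas t2_sectionsD = smooth_sectionsD[where law = t2_law, folded t2_sections_def]

section \<open>Sections acting on functions, and connections in a chart\<close>

definition t2_apply :: "('m \<Rightarrow> real) \<Rightarrow> ('m, 'e, 'e \<times> 'e sym_square) family \<Rightarrow> 'm \<Rightarrow> real"
  where "t2_apply f \<tau> y = (let c = (SOME c. c \<in> charts_at A y) in act f c y (\<tau> y c))"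

lemma t2_apply_chart:
  assumes \<tau>: "\<tau> \<in> t2_sections A" and f: "f \<in> smooth_funs A UNIV" and c: "c \<in> charts_at A y"
  shows "t2_apply f \<tau> y = act f c y (\<tau> y c)"
  unfolding t2_apply_def Let_def by (rule act_section[OF \<tau> someI[of "\<lambda>c. c \<in> charts_at A y", OF c] c f])

lemma t2_apply_cinv:
  assumes \<tau>: "\<tau> \<in> t2_sections A" and f: "f \<in> smooth_funs A UNIV" and c: "c \<in> A" and u: "u \<in> cmap c ` cdom c"
  shows "(t2_apply f \<tau> \<circ> cinv c) u = op2 (f \<circ> cinv c) u (rep \<tau> c u)"
  using t2_apply_chart[OF \<tau> f charts_atI[OF c cinv_in[OF c u]]]
  by (simp add: act_def cmap_cinv[OF c u] rep_def)

lemma t2_apply_smooth: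
  assumes \<tau>: "\<tau> \<in> t2_sections A" and f: "f \<in> smooth_funs A UNIV"
  shows "t2_apply f \<tau> \<in> smooth_funs A UNIV"
proof (rule smooth_funsI_chart)
  fix c assume c: "c \<in> A"
  have "smooth_on (cmap c ` cdom c) (\<lambda>u. op2 (f \<circ> cinv c) u (rep \<tau> c u))"
    by (rule smooth_on_op2[OF smooth_on_chart_UNIV[OF f c] open_chart_image[OF c] t2_sectionsD(3)[OF \<tau> c]])
  then show "smooth_on (cmap c ` cdom c) (t2_apply f \<tau> \<circ> cinv c)"
    by (rule smooth_on_transform[OF open_chart_image[OF c]]) (rule t2_apply_cinv[OF \<tau> f c])
qed

definition conn_loc :: "'e chr1 \<Rightarrow> 'e chr2 \<Rightarrow> ('m, 'e) chart \<Rightarrow> ('m, 'e, 'e) family \<Rightarrow>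
    ('m, 'e, 'e \<times> 'e sym_square) family \<Rightarrow> 'm \<Rightarrow> 'e \<times> 'e sym_square"
  where "conn_loc R C c X \<tau> m = (let u = cmap c m; x = X m c; a = \<tau> m c in
    D1 (rep \<tau> c) u x - (R u x (snd a), - (x \<triangle> fst a) + C u x (snd a)))"

text \<open>\<open>K f(x, s)\<close> in terms of the Christoffel symbols, for a general element \<open>s\<close> of the symmetric
  square.\<close>

definition kext :: "'e chr1 \<Rightarrow> 'e chr2 \<Rightarrow> ('m, 'e) chart \<Rightarrow> ('m \<Rightarrow> real) \<Rightarrow> 'm \<Rightarrow> 'e \<Rightarrow> 'e sym_square \<Rightarrow> real"
  where "kext R C c f m x s = (let u = cmap c m in
    sym_ext (D3 (f \<circ> cinv c) u x) s + op2 (f \<circ> cinv c) u (R u x s, C u x s))"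

lemma
  assumes f: "f \<in> smooth_funs A UNIV" and c: "c \<in> charts_at A m"
  shows linear_kext: "linear (kext R C c f m x)"
    and kext_prod: "kext R C c f m x (y \<triangle> z) =
      op3 (f \<circ> cinv c) (cmap c m) x y z (R (cmap c m) x (y \<triangle> z), C (cmap c m) x (y \<triangle> z))"
proof -
  note cA = charts_atD[OF c]
  let ?u = "cmap c m"
  have U: "open (cmap c ` cdom c)" "?u \<in> cmap c ` cdom c" using open_chart_image cA by auto
  note g = smooth_on_chart_UNIV[OF f cA(1)]
  have pair: "linear (\<lambda>s. (R ?u x s, C ?u x s))"
    by (rule linearI) (simp_all add: blinfun.bilinear_simps)
  have "linear (\<lambda>s. op2 (f \<circ> cinv c) ?u (R ?u x s, C ?u x s))"
    using linear_compose[OF pair linear_op2[OF g U]] by (simp add: o_def)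
  from linear_compose_add[OF linear_sym_ext_D3[OF g U] this]
  have "linear (\<lambda>s. sym_ext (D3 (f \<circ> cinv c) ?u x) s + op2 (f \<circ> cinv c) ?u (R ?u x s, C ?u x s))" .
  then show "linear (kext R C c f m x)" by (simp add: kext_def[abs_def] Let_def)
  show "kext R C c f m x (y \<triangle> z) =
      op3 (f \<circ> cinv c) ?u x y z (R ?u x (y \<triangle> z), C ?u x (y \<triangle> z))"
    by (simp add: kext_def Let_def op3_def sym_ext_D3_prod[OF g U])
qed

text \<open>\<open>D1_op2\<close> rearranged, with the cross term cancelled by
  \<open>- x \<triangle> v\<close>. The first term on the right is independent of the chart, so
  chart independence passes between the connection and \<open>kext\<close>; both directions of the
  correspondence rest on this.\<close>

lemma act_conn_loc:
  assumes X: "X \<in> vector_fields A" and \<tau>: "\<tau> \<in> t2_sections A" and f: "f \<in> smooth_funs A UNIV"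
    and c: "c \<in> charts_at A m"
  shows "act f c m (conn_loc R C c X \<tau> m) =
    vf_apply A X (t2_apply f \<tau>) m - kext R C c f m (X m c) (snd (\<tau> m c))"
proof -
  note cA = charts_atD[OF c]
  let ?u = "cmap c m"
  have U: "open (cmap c ` cdom c)" "?u \<in> cmap c ` cdom c" using open_chart_image cA by auto
  note g = smooth_on_chart_UNIV[OF f cA(1)]
  define x v s where "x = X m c" and "v = fst (\<tau> m c)" and "s = snd (\<tau> m c)"
  have "vf_apply A X (t2_apply f \<tau>) m = D1 (t2_apply f \<tau> \<circ> cinv c) ?u x"
    unfolding x_def by (rule vf_apply_chart[OF X t2_apply_smooth[OF \<tau> f] c])
  also have "\<dots> = D1 (\<lambda>w. op2 (f \<circ> cinv c) w (rep \<tau> c w)) ?u x"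
    by (rule fun_cong[OF D1_cong[OF eventually_nhds_open[OF U t2_apply_cinv[OF \<tau> f cA(1)]]]])
  also have "\<dots> = sym_ext (D3 (f \<circ> cinv c) ?u x) s + op2 (f \<circ> cinv c) ?u (D1 (rep \<tau> c) ?u x + (0, x \<triangle> v))"
    unfolding D1_op2[OF g U t2_sectionsD(3)[OF \<tau> cA(1)]] by (simp add: rep_cmap[OF c] v_def s_def)
  finally have 1: "vf_apply A X (t2_apply f \<tau>) m = \<dots>" .
  have "conn_loc R C c X \<tau> m = (D1 (rep \<tau> c) ?u x + (0, x \<triangle> v)) - (R ?u x s, C ?u x s)"
    by (simp add: conn_loc_def Let_def x_def v_def s_def prod_eq_iff)
  then show ?thesis
    using 1 by (simp add: act_def kext_def Let_def linear_diff[OF linear_op2[OF g U]] x_def s_def)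
qed

definition conn :: "(('m, 'e) chart \<Rightarrow> 'e chr1) \<Rightarrow> (('m, 'e) chart \<Rightarrow> 'e chr2) \<Rightarrow> ('m, 'e) t2_connection"
  where "conn R C = (\<lambda>X\<in>vector_fields A. \<lambda>\<tau>\<in>t2_sections A.
    \<lambda>m c. if c \<in> charts_at A m then conn_loc (R c) (C c) c X \<tau> m else 0)"

lemma christoffel_symbolsD:
  assumes "christoffel_symbols A nabla c R C" "X \<in> vector_fields A" "\<tau> \<in> t2_sections A" "u \<in> cmap c ` cdom c"
  shows "rep (nabla X \<tau>) c u = D1 (rep \<tau> c) u (rep X c u) - (R u (rep X c u) (snd (rep \<tau> c u)),
    - (rep X c u \<triangle> fst (rep \<tau> c u)) + C u (rep X c u) (snd (rep \<tau> c u)))"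
  using assms unfolding christoffel_symbols_def Let_def by blast

text \<open>Any \<open>x\<close> and \<open>0 \<oplus> s\<close> at a point are values of a vector
  field and a section. The derivative of the section is the same in both formulas and cancels, which
  leaves the symbols.\<close>

lemma christoffel_unique:
  assumes 1: "christoffel_symbols A nabla c R C" and 2: "christoffel_symbols A nabla c R' C'"
    and c: "c \<in> A" and u: "u \<in> cmap c ` cdom c"
  shows "R u = R' u \<and> C u = C' u"
proof -
  define m where "m = cinv c u"
  have m: "c \<in> charts_at A m" "cmap c m = u"
    using cinv_in[OF c u] cmap_cinv[OF c u] c by (simp_all add: m_def charts_at_def)
  have "R u x s = R' u x s \<and> C u x s = C' u x s" for x s
  proof -
    obtain X where X: "X \<in> vector_fields A" "eventually (\<lambda>p. X p c = x) (nhds m)"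
      by (rule vector_field_through[OF m(1)]) (rule that)
    obtain \<tau> where \<tau>: "\<tau> \<in> t2_sections A" "eventually (\<lambda>p. \<tau> p c = (0, s)) (nhds m)"
      by (rule t2_section_through[OF m(1), of "(0, s)"]) (rule that)
    have eq: "rep X c u = x" "rep \<tau> c u = (0, s)"
      using eventually_nhds_x_imp_x[OF X(2)] eventually_nhds_x_imp_x[OF \<tau>(2)] by (simp_all add: rep_def m_def)
    from christoffel_symbolsD[OF 1 X(1) \<tau>(1) u] christoffel_symbolsD[OF 2 X(1) \<tau>(1) u]
    have "D1 (rep \<tau> c) u x - (R u x s, - (x \<triangle> 0) + C u x s)
        = D1 (rep \<tau> c) u x - (R' u x s, - (x \<triangle> 0) + C' u x s)"
      by (simp only: eq fst_conv snd_conv)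
    then show ?thesis by (simp add: prod_eq_iff)
  qed
  then show ?thesis by (auto intro!: blinfun_eqI)
qed

lemma christoffel_conn_loc:
  assumes "christoffel_symbols A nabla c R C" and X: "X \<in> vector_fields A" and \<tau>: "\<tau> \<in> t2_sections A"
    and c: "c \<in> charts_at A m"
  shows "nabla X \<tau> m c = conn_loc R C c X \<tau> m"
proof -
  note cA = charts_atD[OF c]
  have "cmap c m \<in> cmap c ` cdom c" using cA by blast
  from christoffel_symbolsD[OF assms(1) X \<tau> this] show ?thesis
    unfolding conn_loc_def Let_def by (simp only: rep_cmap[OF c])
qed

text \<open>Symbols are evaluated only on chart images, where they give every value of the
  connection; extensionality of the maps and the zero convention for families settle the
  rest.\<close>

lemma special_connection_eqI:
  assumes n: "special_connection A nabla" "special_connection A nabla'"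
    and "\<And>c. c \<in> A \<Longrightarrow> christoffel_symbols A nabla c (R c) (C c)"
    and "\<And>c. c \<in> A \<Longrightarrow> christoffel_symbols A nabla' c (R' c) (C' c)"
    and "\<And>c u. c \<in> A \<Longrightarrow> u \<in> cmap c ` cdom c \<Longrightarrow> R c u = R' c u \<and> C c u = C' c u"
  shows "nabla = nabla'"
proof -
  have ty: "nabla \<in> vector_fields A \<rightarrow>\<^sub>E (t2_sections A \<rightarrow>\<^sub>E t2_sections A)"
    "nabla' \<in> vector_fields A \<rightarrow>\<^sub>E (t2_sections A \<rightarrow>\<^sub>E t2_sections A)"
    using n by (auto simp: special_connection_def koszul_connection_def)
  show ?thesis
  proof (rule PiE_ext[OF ty])
    fix X assume X: "X \<in> vector_fields A"
    show "nabla X = nabla' X"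
    proof (rule PiE_ext[OF PiE_mem[OF ty(1) X] PiE_mem[OF ty(2) X]])
      fix \<tau> assume \<tau>: "\<tau> \<in> t2_sections A"
      show "nabla X \<tau> = nabla' X \<tau>"
      proof (rule section_eqI)
        show "nabla X \<tau> \<in> smooth_sections A t2_law" "nabla' X \<tau> \<in> smooth_sections A t2_law"
          using PiE_mem[OF PiE_mem[OF ty(1) X] \<tau>] PiE_mem[OF PiE_mem[OF ty(2) X] \<tau>]
          by (simp_all add: t2_sections_def)
        fix m c assume c: "c \<in> charts_at A m"
        note cA = charts_atD[OF c]
        show "nabla X \<tau> m c = nabla' X \<tau> m c"
          using assms(5)[OF cA(1), of "cmap c m"] cA
          by (simp add: christoffel_conn_loc[OF assms(3)[OF cA(1)] X \<tau> c]
              christoffel_conn_loc[OF assms(4)[OF cA(1)] X \<tau> c] conn_loc_def Let_def)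
      qed
    qed
  qed
qed

lemmas t2_section_eqI = section_eqI[where law = t2_law and law' = t2_law, folded t2_sections_def]


subsection \<open>From Hessian structures to connections\<close>

context
  fixes K :: "('m, 'e) hess" and R :: "('m, 'e) chart \<Rightarrow> 'e chr1" and C :: "('m, 'e) chart \<Rightarrow> 'e chr2"
  assumes Kcov: "\<And>f. f \<in> smooth_funs A UNIV \<Longrightarrow> K f \<in> cov3_fields A"
    and hf: "\<And>c. c \<in> A \<Longrightarrow> hess_form K c (R c) (C c)"
begin

text \<open>On elements \<open>y \<triangle> z\<close> this is the tensor law of \<open>K f\<close>.
  Both sides are linear in the symmetric part, so it extends to the whole symmetric square.\<close>

lemma kext_invariant:
  assumes X: "X \<in> vector_fields A" and \<tau>: "\<tau> \<in> t2_sections A" and f: "f \<in> smooth_funs A UNIV"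
    and c: "c \<in> charts_at A m" and d: "d \<in> charts_at A m"
  shows "kext (R c) (C c) c f m (X m c) (snd (\<tau> m c)) = kext (R d) (C d) d f m (X m d) (snd (\<tau> m d))"
proof -
  note cA = charts_atD[OF c] and dA = charts_atD[OF d]
  let ?A = "D1 (transition c d) (cmap c m)"
  have linA: "linear ?A" by (rule linear_D1_transition[OF c d])
  have X: "X m d = ?A (X m c)" using vector_fieldsD(1)[OF X c d] by (simp add: tangent_law_def)
  have s: "snd (\<tau> m d) = sym_ext (\<lambda>y z. ?A y \<triangle> ?A z) (snd (\<tau> m c))"
    using t2_sectionsD(1)[OF \<tau> c d] by (simp add: t2_law_def Let_def)
  have Kc: "kext (R c) (C c) c f m x (y \<triangle> z) = K f m c x y z" if "c \<in> charts_at A m" for c x y z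
    using hf[of c] f charts_atD[OF that] by (simp add: kext_prod[OF f that] hess_form_def)
  have "cov3_law c d m (K f m c) (K f m d)"
    using smooth_sectionsD(1)[OF Kcov[OF f, unfolded cov3_fields_def] c d] .
  then have law: "K f m c x y z = K f m d (?A x) (?A y) (?A z)" for x y z
    by (simp add: cov3_law_def Let_def)
  have "kext (R c) (C c) c f m (X m c) s = kext (R d) (C d) d f m (?A (X m c)) (sym_ext (\<lambda>y z. ?A y \<triangle> ?A z) s)"
    for s
  proof (rule sym_linear_eqI[OF linear_kext[OF f c]])
    show "linear (\<lambda>s. kext (R d) (C d) d f m (?A (X m c)) (sym_ext (\<lambda>y z. ?A y \<triangle> ?A z) s))"
      using linear_compose[OF linear_sym_ext_push[OF linA] linear_kext[OF f d]] by (simp add: o_def)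
    show "kext (R c) (C c) c f m (X m c) (y \<triangle> z) =
      kext (R d) (C d) d f m (?A (X m c)) (sym_ext (\<lambda>y z. ?A y \<triangle> ?A z) (y \<triangle> z))" for y z
      unfolding sym_ext_push_prod[OF linA] Kc[OF c] Kc[OF d] by (rule law)
  qed
  then show ?thesis by (simp add: X s)
qed

lemma conn_apply:
  "X \<in> vector_fields A \<Longrightarrow> \<tau> \<in> t2_sections A \<Longrightarrow> c \<in> charts_at A m \<Longrightarrow>
    conn R C X \<tau> m c = conn_loc (R c) (C c) c X \<tau> m"
  by (simp add: conn_def)

lemma conn_off:
  "X \<in> vector_fields A \<Longrightarrow> \<tau> \<in> t2_sections A \<Longrightarrow> c \<notin> charts_at A m \<Longrightarrow> conn R C X \<tau> m c = 0"
  by (simp add: conn_def)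

lemma rep_conn:
  assumes X: "X \<in> vector_fields A" and \<tau>: "\<tau> \<in> t2_sections A" and c: "c \<in> A" and u: "u \<in> cmap c ` cdom c"
  shows "rep (conn R C X \<tau>) c u = D1 (rep \<tau> c) u (rep X c u) - (R c u (rep X c u) (snd (rep \<tau> c u)),
    - (rep X c u \<triangle> fst (rep \<tau> c u)) + C c u (rep X c u) (snd (rep \<tau> c u)))"
proof -
  have "rep (conn R C X \<tau>) c u = conn_loc (R c) (C c) c X \<tau> (cinv c u)"
    unfolding rep_def by (rule conn_apply[OF X \<tau> charts_atI[OF c cinv_in[OF c u]]])
  then show ?thesis
    unfolding conn_loc_def Let_def cmap_cinv[OF c u] rep_def[of X c u, symmetric] rep_def[of \<tau> c u, symmetric] .
qed

text \<open>Tested on functions, the bundle law compares a chart-free derivative minus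
  \<open>kext\<close> in two charts, and \<open>kext\<close> is invariant by the tensor law of
  \<open>K f\<close>.\<close>

lemma conn_section:
  assumes X: "X \<in> vector_fields A" and \<tau>: "\<tau> \<in> t2_sections A"
  shows "conn R C X \<tau> \<in> t2_sections A"
  unfolding t2_sections_def smooth_sections_def
proof (intro CollectI conjI allI ballI impI)
  show "t2_law c d m (conn R C X \<tau> m c) (conn R C X \<tau> m d)"
    if c: "c \<in> charts_at A m" and d: "d \<in> charts_at A m" for m c d
    unfolding t2_law_iff[OF c d]
    using kext_invariant[OF X \<tau> _ c d]
    by (simp add: conn_apply[OF X \<tau> c] conn_apply[OF X \<tau> d] act_conn_loc[OF X \<tau> _ c] act_conn_loc[OF X \<tau> _ d])
  show "conn R C X \<tau> m c = 0" if "c \<notin> charts_at A m" for m c by (rule conn_off[OF X \<tau> that])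
  fix c assume c: "c \<in> A"
  let ?U = "cmap c ` cdom c"
  have U: "open ?U" by (rule open_chart_image[OF c])
  have sX: "smooth_on ?U (rep X c)" and s\<tau>: "smooth_on ?U (rep \<tau> c)"
    by (rule vector_fieldsD(3)[OF X c] t2_sectionsD(3)[OF \<tau> c])+
  have sR: "smooth_on ?U (R c)" "smooth_on ?U (C c)" using hf[OF c] by (auto simp: hess_form_def)
  have "smooth_on ?U (\<lambda>u. D1 (rep \<tau> c) u (rep X c u) - (R c u (rep X c u) (snd (rep \<tau> c u)),
      - (rep X c u \<triangle> fst (rep \<tau> c u)) + C c u (rep X c u) (snd (rep \<tau> c u))))"
    by (intro smooth_on_diff smooth_on_D1_apply smooth_on_Pair smooth_on_add smooth_on_minus
        smooth_on_blinfun_apply smooth_on_bilinear[OF U bounded_bilinear_sym_prod] smooth_on_fst smooth_on_snd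
        U sX s\<tau> sR)
  then show "smooth_on ?U (rep (conn R C X \<tau>) c)"
    by (rule smooth_on_transform[OF U]) (rule rep_conn[OF X \<tau> c])
qed

lemma conn_christoffel:
  assumes c: "c \<in> A"
  shows "christoffel_symbols A (conn R C) c (R c) (C c)"
  unfolding christoffel_symbols_def Let_def
proof (intro conjI ballI)
  show "smooth_on (cmap c ` cdom c) (R c)" "smooth_on (cmap c ` cdom c) (C c)"
    using hf[OF c] by (auto simp: hess_form_def)
qed (rule rep_conn[OF _ _ c])

text \<open>Each identity is checked in one chart at a time. The symbol terms are pointwise
  bilinear, so in the product rule the derivative of \<open>f\<close> arises only from
  differentiating the representative of \<open>\<tau>\<close>.\<close>

lemma conn_koszul: "koszul_connection A (conn R C)"
proof -
  have d: "rep \<tau> c differentiable (at (cmap c m))" if "\<tau> \<in> t2_sections A" "c \<in> charts_at A m" for \<tau> c m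
    by (rule smooth_on_differentiable[OF t2_sectionsD(3)[OF that(1)]])
      (use charts_atD[OF that(2)] in auto)
  note lin = D1_linear[OF d]
  note sp = linear_add[OF linear_sym_prod] linear_cmul[OF linear_sym_prod]
    linear_add[OF linear_sym_prod_right] linear_cmul[OF linear_sym_prod_right]
  have 1: "conn R C \<in> vector_fields A \<rightarrow>\<^sub>E (t2_sections A \<rightarrow>\<^sub>E t2_sections A)"
  proof (intro PiE_I)
    show "conn R C X \<tau> \<in> t2_sections A" if "X \<in> vector_fields A" "\<tau> \<in> t2_sections A" for X \<tau>
      by (rule conn_section[OF that])
  qed (simp_all add: conn_def)
  have 2: "conn R C (add_field X Y) \<tau> = add_field (conn R C X \<tau>) (conn R C Y \<tau>)"
    if X: "X \<in> vector_fields A" and Y: "Y \<in> vector_fields A" and \<tau>: "\<tau> \<in> t2_sections A" for X Y \<tau>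
  proof (rule t2_section_eqI)
    note XY = vector_fields_add[OF X Y]
    show "conn R C (add_field X Y) \<tau> \<in> t2_sections A" by (rule conn_section[OF XY \<tau>])
    show "add_field (conn R C X \<tau>) (conn R C Y \<tau>) \<in> t2_sections A"
      by (intro t2_sections_add conn_section X Y \<tau>)
    show "conn R C (add_field X Y) \<tau> m c = add_field (conn R C X \<tau>) (conn R C Y \<tau>) m c"
      if c: "c \<in> charts_at A m" for m c
      unfolding add_field_def[of "conn R C X \<tau>"] conn_apply[OF XY \<tau> c] conn_apply[OF X \<tau> c] conn_apply[OF Y \<tau> c]
      by (simp add: conn_loc_def Let_def add_field_def linear_add[OF lin[OF \<tau> c]] blinfun.bilinear_simps sp
          prod_eq_iff)
  qed
  have 3: "conn R C (scale_field f X) \<tau> = scale_field f (conn R C X \<tau>)"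
    if f: "f \<in> smooth_funs A UNIV" and X: "X \<in> vector_fields A" and \<tau>: "\<tau> \<in> t2_sections A" for f X \<tau>
  proof (rule t2_section_eqI)
    note fX = vector_fields_scale[OF X f]
    show "conn R C (scale_field f X) \<tau> \<in> t2_sections A" by (rule conn_section[OF fX \<tau>])
    show "scale_field f (conn R C X \<tau>) \<in> t2_sections A" by (intro t2_sections_scale conn_section X \<tau> f)
    show "conn R C (scale_field f X) \<tau> m c = scale_field f (conn R C X \<tau>) m c" if c: "c \<in> charts_at A m" for m c
      unfolding scale_field_def[of f "conn R C X \<tau>"] conn_apply[OF fX \<tau> c] conn_apply[OF X \<tau> c]
      by (simp add: conn_loc_def Let_def scale_field_def linear_cmul[OF lin[OF \<tau> c]] blinfun.bilinear_simps sp
          prod_eq_iff algebra_simps)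
  qed
  have 4: "conn R C X (add_field \<sigma> \<tau>) = add_field (conn R C X \<sigma>) (conn R C X \<tau>)"
    if X: "X \<in> vector_fields A" and \<sigma>: "\<sigma> \<in> t2_sections A" and \<tau>: "\<tau> \<in> t2_sections A" for X \<sigma> \<tau>
  proof (rule t2_section_eqI)
    note \<sigma>\<tau> = t2_sections_add[OF \<sigma> \<tau>]
    show "conn R C X (add_field \<sigma> \<tau>) \<in> t2_sections A" by (rule conn_section[OF X \<sigma>\<tau>])
    show "add_field (conn R C X \<sigma>) (conn R C X \<tau>) \<in> t2_sections A"
      by (intro t2_sections_add conn_section X \<sigma> \<tau>)
    have r: "rep (add_field \<sigma> \<tau>) c = (\<lambda>u. rep \<sigma> c u + rep \<tau> c u)" for c
      by (simp add: rep_def[abs_def] add_field_def)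
    show "conn R C X (add_field \<sigma> \<tau>) m c = add_field (conn R C X \<sigma>) (conn R C X \<tau>) m c"
      if c: "c \<in> charts_at A m" for m c
      unfolding add_field_def[of "conn R C X \<sigma>"] conn_apply[OF X \<sigma>\<tau> c] conn_apply[OF X \<tau> c] conn_apply[OF X \<sigma> c]
      by (simp add: conn_loc_def Let_def r D1_add[OF d[OF \<sigma> c] d[OF \<tau> c]])
        (simp add: add_field_def blinfun.bilinear_simps sp prod_eq_iff)
  qed
  have 5: "conn R C X (scale_field f \<tau>) = add_field (scale_field (vf_apply A X f) \<tau>) (scale_field f (conn R C X \<tau>))"
    if f: "f \<in> smooth_funs A UNIV" and X: "X \<in> vector_fields A" and \<tau>: "\<tau> \<in> t2_sections A" for f X \<tau>
  proof (rule t2_section_eqI)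
    note f\<tau> = t2_sections_scale[OF \<tau> f]
    show "conn R C X (scale_field f \<tau>) \<in> t2_sections A" by (rule conn_section[OF X f\<tau>])
    show "add_field (scale_field (vf_apply A X f) \<tau>) (scale_field f (conn R C X \<tau>)) \<in> t2_sections A"
      by (intro t2_sections_add t2_sections_scale vf_apply_smooth conn_section X \<tau> f)
    have r: "rep (scale_field f \<tau>) c = (\<lambda>u. (f \<circ> cinv c) u *\<^sub>R rep \<tau> c u)" for c
      by (simp add: rep_def[abs_def] scale_field_def)
    show "conn R C X (scale_field f \<tau>) m c
        = add_field (scale_field (vf_apply A X f) \<tau>) (scale_field f (conn R C X \<tau>)) m c"
      if c: "c \<in> charts_at A m" for m c
    proof -
      note cA = charts_atD[OF c]
      have df: "(f \<circ> cinv c) differentiable (at (cmap c m))"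
        by (rule smooth_on_differentiable[OF smooth_on_chart_UNIV[OF f cA(1)]]) (use cA in auto)
      have "D1 (rep (scale_field f \<tau>) c) (cmap c m) (X m c)
          = f m *\<^sub>R D1 (rep \<tau> c) (cmap c m) (X m c) + vf_apply A X f m *\<^sub>R \<tau> m c"
        unfolding r D1_scaleR[OF df d[OF \<tau> c]] vf_apply_chart[OF X f c]
        by (simp add: rep_cmap[OF c] cinv_cmap[OF cA])
      then show ?thesis
        unfolding add_field_def scale_field_def[of f "conn R C X \<tau>"] scale_field_def[of "vf_apply A X f"]
          conn_apply[OF X f\<tau> c] conn_apply[OF X \<tau> c]
        by (simp add: conn_loc_def Let_def)
          (simp add: scale_field_def blinfun.bilinear_simps sp prod_eq_iff algebra_simps)
    qed
  qed
  show ?thesis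
    unfolding koszul_connection_def using 1 2 3 4 5 by blast
qed

lemma conn_special: "special_connection A (conn R C)"
  unfolding special_connection_def using conn_koszul conn_christoffel by blast

end


subsection \<open>From connections to Hessian structures\<close>

text \<open>The asserted formula taken as a definition. Assembling it with \<open>mk_tri\<close>
  reduces the smoothness of the tensor field to finitely many coefficients.\<close>

definition hess :: "(('m, 'e) chart \<Rightarrow> 'e chr1) \<Rightarrow> (('m, 'e) chart \<Rightarrow> 'e chr2) \<Rightarrow> ('m, 'e) hess"
  where "hess R C = (\<lambda>f\<in>smooth_funs A UNIV. \<lambda>m c. if c \<in> charts_at A m then
    mk_tri (\<lambda>x y z. op3 (f \<circ> cinv c) (cmap c m) x y z
      (R c (cmap c m) x (y \<triangle> z), C c (cmap c m) x (y \<triangle> z))) else 0)"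

lemma hess_apply:
  assumes f: "f \<in> smooth_funs A UNIV" and c: "c \<in> charts_at A m"
  shows "hess R C f m c x y z = op3 (f \<circ> cinv c) (cmap c m) x y z
    (R c (cmap c m) x (y \<triangle> z), C c (cmap c m) x (y \<triangle> z))"
proof -
  note cA = charts_atD[OF c]
  let ?u = "cmap c m"
  have U: "open (cmap c ` cdom c)" "?u \<in> cmap c ` cdom c" using open_chart_image cA by auto
  note g = smooth_on_chart_UNIV[OF f cA(1)]
  note L = linear_op2[OF g U] and sp = linear_add[OF linear_sym_prod] linear_cmul[OF linear_sym_prod]
    linear_add[OF linear_sym_prod_right] linear_cmul[OF linear_sym_prod_right]
  have add: "(a + a', b + b') = (a, b) + (a', b')" and scale: "(r *\<^sub>R a, r *\<^sub>R b) = r *\<^sub>R (a, b)"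
    for a a' :: 'e and b b' :: "'e sym_square" and r by simp_all
  show ?thesis
    unfolding hess_def using f c
    by (simp, intro mk_tri_apply linearI)
      (simp_all only: op3_def sp blinfun.bilinear_simps add scale linear_add[OF L] linear_cmul[OF L]
        linear_add[OF linear_D3_1[OF g U]] linear_cmul[OF linear_D3_1[OF g U]]
        linear_add[OF linear_D3_2[OF g U]] linear_cmul[OF linear_D3_2[OF g U]]
        linear_add[OF linear_D3_3[OF g U]] linear_cmul[OF linear_D3_3[OF g U]]
        real_scaleR_def distrib_left add_ac)
qed

lemma hess_off: "f \<in> smooth_funs A UNIV \<Longrightarrow> c \<notin> charts_at A m \<Longrightarrow> hess R C f m c = 0"
  by (simp add: hess_def)

context
  fixes nabla :: "('m, 'e) t2_connection" and R :: "('m, 'e) chart \<Rightarrow> 'e chr1"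
    and C :: "('m, 'e) chart \<Rightarrow> 'e chr2"
  assumes sc: "special_connection A nabla"
    and chr: "\<And>c. c \<in> A \<Longrightarrow> christoffel_symbols A nabla c (R c) (C c)"
begin

lemma hess_form_hess: "c \<in> A \<Longrightarrow> hess_form (hess R C) c (R c) (C c)"
  using chr by (auto simp: hess_form_def hess_apply charts_atI christoffel_symbols_def)

text \<open>Take a field and a section with values \<open>x\<close> and
  \<open>0 \<oplus> y \<triangle> z\<close> at \<open>m\<close> in the chart \<open>c\<close>. In
  every chart the formula equals \<open>X \<cdot> (\<tau> \<cdot> f)\<close> minus the action of
  \<open>nabla X \<tau>\<close> on \<open>f\<close>, and neither depends on the chart, since
  \<open>nabla X \<tau>\<close> is a section.\<close>

lemma hess_law:
  assumes f: "f \<in> smooth_funs A UNIV" and c: "c \<in> charts_at A m" and d: "d \<in> charts_at A m"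
  shows "cov3_law c d m (hess R C f m c) (hess R C f m d)"
  unfolding cov3_law_def Let_def
proof (intro allI)
  fix x y z
  let ?A = "D1 (transition c d) (cmap c m)"
  have linA: "linear ?A" by (rule linear_D1_transition[OF c d])
  obtain X where X: "X \<in> vector_fields A" "eventually (\<lambda>p. X p c = x) (nhds m)"
    by (rule vector_field_through[OF c]) (rule that)
  obtain \<tau> where \<tau>: "\<tau> \<in> t2_sections A" "eventually (\<lambda>p. \<tau> p c = (0, y \<triangle> z)) (nhds m)"
    by (rule t2_section_through[OF c, of "(0, y \<triangle> z)"]) (rule that)
  have Xc: "X m c = x" and \<tau>c: "\<tau> m c = (0, y \<triangle> z)"
    using eventually_nhds_x_imp_x[OF X(2)] eventually_nhds_x_imp_x[OF \<tau>(2)] by auto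
  have Xd: "X m d = ?A x" using vector_fieldsD(1)[OF X(1) c d] by (simp add: tangent_law_def Xc)
  have \<tau>d: "snd (\<tau> m d) = ?A y \<triangle> ?A z"
    using t2_sectionsD(1)[OF \<tau>(1) c d] by (simp add: t2_law_def Let_def \<tau>c sym_ext_push_prod[OF linA])
  have nab: "nabla X \<tau> \<in> t2_sections A"
    using sc X(1) \<tau>(1) by (auto simp: special_connection_def koszul_connection_def)
  have "kext (R e) (C e) e f m (X m e) (snd (\<tau> m e)) = vf_apply A X (t2_apply f \<tau>) m - act f e m (nabla X \<tau> m e)"
    if e: "e \<in> charts_at A m" for e
    using act_conn_loc[OF X(1) \<tau>(1) f e, of "R e" "C e"]
      christoffel_conn_loc[OF chr[OF charts_atD(1)[OF e]] X(1) \<tau>(1) e] by simp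
  from this[OF c] this[OF d] act_section[OF nab c d f]
  have "kext (R c) (C c) c f m x (y \<triangle> z) = kext (R d) (C d) d f m (?A x) (?A y \<triangle> ?A z)"
    by (simp add: Xc Xd \<tau>c \<tau>d)
  then show "hess R C f m c x y z = hess R C f m d (?A x) (?A y) (?A z)"
    by (simp add: hess_apply[OF f c] hess_apply[OF f d] kext_prod[OF f c] kext_prod[OF f d])
qed

lemma hess_cov3_fields:
  assumes f: "f \<in> smooth_funs A UNIV"
  shows "hess R C f \<in> cov3_fields A"
  unfolding cov3_fields_def smooth_sections_def
proof (intro CollectI conjI allI ballI impI)
  show "cov3_law c d m (hess R C f m c) (hess R C f m d)"
    if "c \<in> charts_at A m" "d \<in> charts_at A m" for m c d by (rule hess_law[OF f that])
  show "hess R C f m c = 0" if "c \<notin> charts_at A m" for m c by (rule hess_off[OF f that])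
  fix c assume c: "c \<in> A"
  let ?U = "cmap c ` cdom c"
  have U: "open ?U" by (rule open_chart_image[OF c])
  note g = smooth_on_chart_UNIV[OF f c]
  have sR: "smooth_on ?U (R c)" "smooth_on ?U (C c)" using chr[OF c] by (auto simp: christoffel_symbols_def)
  have "smooth_on ?U (\<lambda>u. op3 (f \<circ> cinv c) u x y z (R c u x (y \<triangle> z), C c u x (y \<triangle> z)))" for x y z
    unfolding op3_def
    by (intro smooth_on_add smooth_on_D3 smooth_on_op2 smooth_on_Pair smooth_on_blinfun_apply smooth_on_const g U sR)
  from smooth_on_mk_tri[OF U this] show "smooth_on ?U (rep (hess R C f) c)"
  proof (rule smooth_on_transform[OF U])
    fix u assume u: "u \<in> ?U"
    show "rep (hess R C f) c u =
        mk_tri (\<lambda>x y z. op3 (f \<circ> cinv c) u x y z (R c u x (y \<triangle> z), C c u x (y \<triangle> z)))"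
      using f charts_atI[OF c cinv_in[OF c u]] by (simp add: rep_def hess_def cmap_cinv[OF c u])
  qed
qed

lemma hess_third_order: "third_order_hessian A (hess R C)"
  unfolding third_order_hessian_def
proof (intro conjI ballI allI)
  show "hess R C \<in> smooth_funs A UNIV \<rightarrow>\<^sub>E cov3_fields A"
    using hess_cov3_fields by (auto simp: hess_def)
next
  fix f g :: "'m \<Rightarrow> real" and a b :: real
  assume f: "f \<in> smooth_funs A UNIV" and g: "g \<in> smooth_funs A UNIV"
  note fg = smooth_funs_lincomb[OF f g, of a b]
  show "hess R C (\<lambda>x. a * f x + b * g x) =
      add_field (scale_field (\<lambda>_. a) (hess R C f)) (scale_field (\<lambda>_. b) (hess R C g))"
  proof (intro HOL.ext)
    fix m c
    show "hess R C (\<lambda>x. a * f x + b * g x) m c =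
      add_field (scale_field (\<lambda>_. a) (hess R C f)) (scale_field (\<lambda>_. b) (hess R C g)) m c"
    proof (cases "c \<in> charts_at A m")
      case c: True
      note cA = charts_atD[OF c]
      have U: "open (cmap c ` cdom c)" "cmap c m \<in> cmap c ` cdom c" using open_chart_image cA by auto
      note sf = smooth_on_chart_UNIV[OF f cA(1)] and sg = smooth_on_chart_UNIV[OF g cA(1)]
      have eq: "(\<lambda>x. a * f x + b * g x) \<circ> cinv c = (\<lambda>u. a * (f \<circ> cinv c) u + b * (g \<circ> cinv c) u)"
        by (simp add: o_def)
      have "op3 ((\<lambda>x. a * f x + b * g x) \<circ> cinv c) (cmap c m) x y z s =
          a * op3 (f \<circ> cinv c) (cmap c m) x y z s + b * op3 (g \<circ> cinv c) (cmap c m) x y z s" for x y z s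
        unfolding eq op3_add[OF U smooth_on_scale[OF U(1) sf] smooth_on_scale[OF U(1) sg]]
          op3_scale[OF U sf] op3_scale[OF U sg] ..
      then show ?thesis
        by (intro blinfun_eqI) (simp add: hess_apply[OF fg c] hess_apply[OF f c] hess_apply[OF g c]
            add_field_def scale_field_def blinfun.bilinear_simps)
    next
      case False
      then show ?thesis by (simp add: hess_off[OF fg] hess_off[OF f] hess_off[OF g] add_field_def scale_field_def)
    qed
  qed
next
  fix m f X Y Z c
  assume f': "f \<in> smooth_funs A UNIV \<inter> F3 A m" and XYZ: "X \<in> vector_fields A" "Y \<in> vector_fields A" "Z \<in> vector_fields A"
    and c: "c \<in> charts_at A m"
  note cA = charts_atD[OF c]
  have U: "open (cmap c ` cdom c)" "cmap c m \<in> cmap c ` cdom c" using open_chart_image cA by auto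
  have f: "f \<in> smooth_funs A UNIV" and fl: "flat2 (f \<circ> cinv c) (cmap c m)"
    using f' F3_iff_flat2[OF _ c] by auto
  \<comment> \<open>On \<open>F3\<close> the second-order part of the formula vanishes, so the
    symbols drop out and the prescribed third derivative remains.\<close>
  show "hess R C f m c (X m c) (Y m c) (Z m c) = vf_apply A X (vf_apply A Y (vf_apply A Z f)) m"
    unfolding third_derivative_flat2[OF XYZ f c fl] hess_apply[OF f c] op3_def
      flat2_op2[OF smooth_on_chart_UNIV[OF f cA(1)] U fl] by simp
qed

lemma hess_kills_constants: "kills_constants (hess R C)"
  unfolding kills_constants_def zero_field_def
proof (intro allI HOL.ext)
  fix a m c
  show "hess R C (\<lambda>_. a) m c = 0"
  proof (cases "c \<in> charts_at A m")
    case c: True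
    have "open (cmap c ` cdom c)" "cmap c m \<in> cmap c ` cdom c" using open_chart_image charts_atD[OF c] by auto
    from op3_const[OF this] show ?thesis
      by (intro blinfun_eqI) (simp add: hess_apply[OF smooth_funs_const c] o_def)
  qed (rule hess_off[OF smooth_funs_const])
qed

lemma hess_symmetric: "symmetric_in_last_two A (hess R C)"
  unfolding symmetric_in_last_two_def
proof (intro ballI allI)
  fix f m c x y z
  assume f: "f \<in> smooth_funs A UNIV" and c: "c \<in> charts_at A m"
  note cA = charts_atD[OF c]
  have U: "open (cmap c ` cdom c)" "cmap c m \<in> cmap c ` cdom c" using open_chart_image cA by auto
  show "hess R C f m c x y z = hess R C f m c x z y"
    unfolding hess_apply[OF f c] op3_def sym_prod_commute[of y z]
      D3_sym[OF smooth_on_chart_UNIV[OF f cA(1)] U, of x y z] ..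
qed

end

section \<open>The bijection between Hessian structures and special connections\<close>

definition christoffel_of :: "('m, 'e) hess \<Rightarrow> ('m, 'e) chart \<Rightarrow> 'e chr1 \<times> 'e chr2"
  where "christoffel_of K c = (SOME p. hess_form K c (fst p) (snd p))"

definition connection_of :: "('m, 'e) hess \<Rightarrow> ('m, 'e) t2_connection"
  where "connection_of K = conn (\<lambda>c. fst (christoffel_of K c)) (\<lambda>c. snd (christoffel_of K c))"

definition hessians :: "('m, 'e) hess set"
  where "hessians = {K. third_order_hessian A K \<and> kills_constants K \<and> symmetric_in_last_two A K}"

lemma hessians_form:
  assumes "K \<in> hessians" "c \<in> A"
  shows "hess_form K c (fst (christoffel_of K c)) (snd (christoffel_of K c))"
proof -
  obtain R C where "hess_form K c R C"
    using hess_form_exists[of K c] assms by (auto simp: hessians_def)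
  then have "hess_form K c (fst (R, C)) (snd (R, C))" by simp
  then show ?thesis unfolding christoffel_of_def by (rule someI)
qed

lemma
  assumes K: "K \<in> hessians"
  shows connection_of_special: "special_connection A (connection_of K)"
    and connection_of_christoffel: "c \<in> A \<Longrightarrow>
      christoffel_symbols A (connection_of K) c (fst (christoffel_of K c)) (snd (christoffel_of K c))"
proof -
  have cov: "K f \<in> cov3_fields A" if "f \<in> smooth_funs A UNIV" for f
    using hess_cov3[OF _ that] K by (simp add: hessians_def)
  show "special_connection A (connection_of K)"
    unfolding connection_of_def by (rule conn_special[OF cov hessians_form[OF K]])
  show "c \<in> A \<Longrightarrow>
      christoffel_symbols A (connection_of K) c (fst (christoffel_of K c)) (snd (christoffel_of K c))"
    unfolding connection_of_def by (rule conn_christoffel[OF cov hessians_form[OF K]])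
qed

text \<open>The final formula concerns arbitrary symbols of the connection, not just the chosen
  ones. By uniqueness they agree on the chart image, and the formula evaluates them only
  there.\<close>

lemma christoffel_hess_form:
  assumes K: "K \<in> hessians" and c: "c \<in> A" and chr: "christoffel_symbols A (connection_of K) c R C"
  shows "hess_form K c R C"
proof -
  have "R u = fst (christoffel_of K c) u \<and> C u = snd (christoffel_of K c) u" if "u \<in> cmap c ` cdom c" for u
    by (rule christoffel_unique[OF chr connection_of_christoffel[OF K c] c that])
  then show ?thesis
    using hessians_form[OF K c] chr by (auto simp: hess_form_def christoffel_symbols_def)
qed

text \<open>Equal connections have common symbols, and the formula recovers \<open>K f\<close> from
  these.\<close>

lemma inj_connection_of: "inj_on connection_of hessians"
proof (rule inj_onI)
  fix K K' assume K: "K \<in> hessians" and K': "K' \<in> hessians" and eq: "connection_of K = connection_of K'"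
  have ty: "K \<in> smooth_funs A UNIV \<rightarrow>\<^sub>E cov3_fields A" "K' \<in> smooth_funs A UNIV \<rightarrow>\<^sub>E cov3_fields A"
    using K K' by (auto simp: hessians_def third_order_hessian_def)
  show "K = K'"
  proof (rule PiE_ext[OF ty])
    fix f assume f: "f \<in> smooth_funs A UNIV"
    show "K f = K' f"
    proof (rule section_eqI)
      show "K f \<in> smooth_sections A cov3_law" "K' f \<in> smooth_sections A cov3_law"
        using PiE_mem[OF ty(1) f] PiE_mem[OF ty(2) f] by (simp_all add: cov3_fields_def)
      fix m c assume c: "c \<in> charts_at A m"
      note cA = charts_atD[OF c]
      have "hess_form K c (fst (christoffel_of K' c)) (snd (christoffel_of K' c))"
        by (rule christoffel_hess_form[OF K cA(1)]) (simp add: eq connection_of_christoffel[OF K' cA(1)])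
      with hessians_form[OF K' cA(1)] show "K f m c = K' f m c"
        using f cA by (intro blinfun_eqI) (simp add: hess_form_def)
    qed
  qed
qed

text \<open>Symbols of \<open>nabla\<close>, chosen in each chart, define \<open>hess R C\<close>.
  The symbols selected for that structure can differ from \<open>R\<close> and \<open>C\<close> only
  off the chart images, so its connection is \<open>nabla\<close>.\<close>

lemma connection_of_surj:
  assumes "special_connection A nabla"
  shows "\<exists>K\<in>hessians. connection_of K = nabla"
proof -
  have "\<forall>c\<in>A. \<exists>p. christoffel_symbols A nabla c (fst p) (snd p)"
    using assms by (force simp: special_connection_def)
  then obtain p where p: "\<And>c. c \<in> A \<Longrightarrow> christoffel_symbols A nabla c (fst (p c)) (snd (p c))" by metis
  define R C where "R c = fst (p c)" and "C c = snd (p c)" for c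
  have chr: "christoffel_symbols A nabla c (R c) (C c)" if "c \<in> A" for c using p[OF that] by (simp add: R_def C_def)
  have K: "hess R C \<in> hessians"
    using hess_third_order[OF assms chr] hess_kills_constants[OF assms chr] hess_symmetric[OF assms chr]
    by (simp add: hessians_def)
  have "connection_of (hess R C) = nabla"
  proof (rule special_connection_eqI[OF connection_of_special[OF K] assms connection_of_christoffel[OF K] chr])
    show "fst (christoffel_of (hess R C) c) u = R c u \<and> snd (christoffel_of (hess R C) c) u = C c u"
      if "c \<in> A" "u \<in> cmap c ` cdom c" for c u
      by (rule hess_form_unique[OF hessians_form[OF K that(1)] hess_form_hess[OF assms chr that(1)] that])
  qed
  then show ?thesis using K by blast
qed

text \<open>The global function selected in \<open>local_hessian\<close> has the germ of
  \<open>f\<close> at \<open>m\<close>, and the right-hand side depends only on that germ.\<close>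

lemma local_hessian_formula:
  assumes K: "K \<in> hessians" and c: "c \<in> A" and chr: "christoffel_symbols A (connection_of K) c R C"
    and f: "f \<in> smooth_funs A (cdom c)" and m: "m \<in> cdom c"
  shows "local_hessian A K f m c x y z =
    op3 (f \<circ> cinv c) (cmap c m) x y z (R (cmap c m) x (y \<triangle> z), C (cmap c m) x (y \<triangle> z))"
proof -
  have cm: "c \<in> charts_at A m" by (rule charts_atI[OF c m])
  define g where "g = (SOME g. g \<in> smooth_funs A UNIV \<and> eventually (\<lambda>x. g x = f x) (nhds m))"
  have "\<exists>g. g \<in> smooth_funs A UNIV \<and> eventually (\<lambda>x. g x = f x) (nhds m)"
    by (rule extend_germ[OF cm open_cdom[OF c] m f]) blast
  from someI_ex[OF this] have g: "g \<in> smooth_funs A UNIV" "eventually (\<lambda>x. g x = f x) (nhds m)"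
    by (auto simp: g_def)
  have "local_hessian A K f m c x y z = K g m c x y z" by (simp add: local_hessian_def g_def)
  also have "\<dots> = op3 (g \<circ> cinv c) (cmap c m) x y z (R (cmap c m) x (y \<triangle> z), C (cmap c m) x (y \<triangle> z))"
    using christoffel_hess_form[OF K c chr] g(1) m by (simp add: hess_form_def)
  also have "\<dots> = op3 (f \<circ> cinv c) (cmap c m) x y z (R (cmap c m) x (y \<triangle> z), C (cmap c m) x (y \<triangle> z))"
    by (rule op3_cong[OF chart_germ_eq[OF cm g(2)]])
  finally show ?thesis .
qed

end

theorem proposition4p2:
  fixes A :: "('m::t2_space, 'e::finite_dim_banach) chart set"
  assumes "paracompact_space (euclidean :: 'm topology)"
    and "smooth_structure A"
  shows "\<exists>\<Phi>.
    bij_betw \<Phi>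
      {K. third_order_hessian A K \<and> kills_constants K \<and> symmetric_in_last_two A K}
      {nabla. special_connection A nabla} \<and>
    (\<forall>K. third_order_hessian A K \<and> kills_constants K \<and> symmetric_in_last_two A K \<longrightarrow>
      (\<forall>c\<in>A. \<forall>R C. christoffel_symbols A (\<Phi> K) c R C \<longrightarrow>
        (\<forall>X\<in>vector_fields A. \<forall>Y\<in>vector_fields A. \<forall>Z\<in>vector_fields A.
         \<forall>f\<in>smooth_funs A (cdom c). \<forall>m\<in>cdom c.
          let u = cmap c m; f' = f \<circ> cinv c; x = X m c; y = Y m c; z = Z m c in
            local_hessian A K f m c x y z =
              D3 f' u x y z + sym_ext (D2 f' u) (C u x (y \<triangle> z)) + D1 f' u (R u x (y \<triangle> z)))))"
proof -
  interpret smooth_manifold A using assms(2) by unfold_locales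
  show ?thesis
  proof (intro exI[of _ connection_of] conjI allI impI ballI)
    show "bij_betw connection_of
        {K. third_order_hessian A K \<and> kills_constants K \<and> symmetric_in_last_two A K}
        {nabla. special_connection A nabla}"
      unfolding hessians_def[symmetric] bij_betw_def
      using inj_connection_of connection_of_special connection_of_surj by blast
  next
    fix K c R C X Y Z f m
    assume K: "third_order_hessian A K \<and> kills_constants K \<and> symmetric_in_last_two A K"
      and "c \<in> A" "christoffel_symbols A (connection_of K) c R C" "f \<in> smooth_funs A (cdom c)" "m \<in> cdom c"
    then have "K \<in> hessians" by (simp add: hessians_def)
    show "let u = cmap c m; f' = f \<circ> cinv c; x = X m c; y = Y m c; z = Z m c in
        local_hessian A K f m c x y z =
          D3 f' u x y z + sym_ext (D2 f' u) (C u x (y \<triangle> z)) + D1 f' u (R u x (y \<triangle> z))"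
      unfolding Let_def local_hessian_formula[OF \<open>K \<in> hessians\<close> \<open>c \<in> A\<close>
          \<open>christoffel_symbols A (connection_of K) c R C\<close> \<open>f \<in> smooth_funs A (cdom c)\<close> \<open>m \<in> cdom c\<close>]
      by (simp add: op3_def op2_def)
  qed
qed

end
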